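(* Let $(A,\mathfrak a)$ be a unital good pair over $\Bbbk$ with $(A,\mathfrak a)$-basis $B=B_{\mathfrak a}\sqcup B_{\mathfrak c}\sqcup B_{\bar1}$, let $n,d\ge1$, and let $1:=1_{M_n(A)}$. Put $Y:=\mathrm{span}_\Bbbk(\xi^b_{r,s}\mid r,s\in[1,n],\ b\in B_{\mathfrak c}\sqcup B_{\bar1})\subseteq M_n(A)$. Then $T^A_{\mathfrak a}(n,d)$ is the subalgebra of $S^A(n,d)$ generated by $S^{\mathfrak a}(n,d)$ and $1^{\otimes d-1}*Y:=\{1^{\otimes d-1}*y\mid y\in Y\}$.
   Context: $\Bbbk$ is a commutative domain of characteristic $0$. Superalgebras are $\mathbb Z/2$-graded associative (not necessarily unital) $\Bbbk$-algebras $A=A_{\bar 0}\oplus A_{\bar 1}$; $\bar a$ denotes the parity of a homogeneous element $a$; tensor products of superalgebras carry the product $(x\otimes y)(z\otimes w)=(-1)^{\bar y\bar z}xz\otimes yw$. A good pair $(A,\mathfrak a)$ consists of a superalgebra $A$ with $A_{\bar 0},A_{\bar 1}$ free over $\Bbbk$ and a subalgebra $\mathfrak a\subseteq A_{\bar 0}$ such that $\mathfrak a$ and $A/\mathfrak a$ are free $\Bbbk$-modules; it is a unital good pair if $A$ and $\mathfrak a$ are unital with $1_{\mathfrak a}=1_A$. An $(A,\mathfrak a)$-basis is a $\Bbbk$-basis $B=B_{\mathfrak a}\sqcup B_{\mathfrak c}\sqcup B_{\bar 1}$ of $A$, where $B_{\mathfrak a}$, $B_{\mathfrak c}$, $B_{\bar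 1}$ are bases of $\mathfrak a$, of a chosen $\Bbbk$-module complement $\mathfrak c$ of $\mathfrak a$ in $A_{\bar 0}$, and of $A_{\bar 1}$, respectively. For $a\in A$ put $\xi^a_{r,s}:=aE_{r,s}\in M_n(A)$ ($E_{r,s}$ the matrix units; $M_n(A)$ is a superalgebra via parities of entries). Write $[1,n]=\{1,\dots,n\}$. The symmetric group $\mathfrak S_d$ acts on the right on words by $(x_1\cdots x_d)\sigma=x_{\sigma 1}\cdots x_{\sigma d}$, diagonally on tuples of words, and on $M_n(A)^{\otimes d}$ by superalgebra automorphisms $(\xi^{a_1}_{r_1,s_1}\otimes\cdots\otimes\xi^{a_d}_{r_d,s_d})^\sigma=(-1)^{\langle\sigma;\boldsymbol a\rangle}\xi^{a_{\sigma1}}_{r_{\sigma1},s_{\sigma1}}\otimes\cdots\otimes\xi^{a_{\sigma d}}_{r_{\sigma d},s_{\sigma d}}$ for homogeneous $a_i$, where $\langle\sigma;\boldsymbol a\rangle=\#\{(k,l): k<l,\ \sigma^{-1}k>\sigma^{-1}l,\ a_k,a_l \text{ odd}\}$. Define $S^A(n,d):=(M_n(A)^{\otimes d})^{\mathfrak S_d}$; likewise $S^{\mathfrak a}(n,d):=(M_n(\mathfrak a)^{\otimes d})^{\mathfrak S_d}\subseteq S^A(n,d)$. $\mathrm{Tri}^B(n,d)$ is the set of triples $(\boldsymbol b,\boldsymbol r,\boldsymbol s)\in B^d\times[1,n]^d\times[1,n]^d$ such that for $k\ne l$ the equality $(b_k,r_k,s_k)=(b_l,r_l,s_l)$ holds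 only if $b_k$ is even. For such a triple let $\xi^{\boldsymbol b}_{\boldsymbol r,\boldsymbol s}:=\sum_\sigma(\xi^{b_1}_{r_1,s_1}\otimes\cdots\otimes\xi^{b_d}_{r_d,s_d})^\sigma\in S^A(n,d)$, with $\sigma$ over representatives of the cosets $\mathfrak S_{\boldsymbol b,\boldsymbol r,\boldsymbol s}\backslash\mathfrak S_d$, where $\mathfrak S_{\boldsymbol b,\boldsymbol r,\boldsymbol s}$ is the stabilizer of the triple. Let $[\boldsymbol b,\boldsymbol r,\boldsymbol s]^b_{r,s}:=\#\{k: (b_k,r_k,s_k)=(b,r,s)\}$, $[\boldsymbol b,\boldsymbol r,\boldsymbol s]^!_{\mathfrak c}:=\prod_{b\in B_{\mathfrak c},\,r,s\in[1,n]}[\boldsymbol b,\boldsymbol r,\boldsymbol s]^b_{r,s}!$, and $\eta^{\boldsymbol b}_{\boldsymbol r,\boldsymbol s}:=[\boldsymbol b,\boldsymbol r,\boldsymbol s]^!_{\mathfrak c}\,\xi^{\boldsymbol b}_{\boldsymbol r,\boldsymbol s}$. Finally $T^A_{\mathfrak a}(n,d)$ is the $\Bbbk$-span of all $\eta^{\boldsymbol b}_{\boldsymbol r,\boldsymbol s}$ with $(\boldsymbol b,\boldsymbol r,\boldsymbol s)\in\mathrm{Tri}^B(n,d)$. Star product: for $x\in M_n(A)^{\otimes d}$, $y\in M_n(A)^{\otimes f}$, $x*y:=\sum_\sigma(x\otimes y)^\sigma$, with $\sigma$ over the shortest representatives of the cosets $(\mathfrak S_d\times\mathfrak S_f)\backslash\mathfrak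 S_{d+f}$. *)

theory Defs
  imports
    "HOL-Library.Poly_Mapping"
    "HOL-Combinatorics.Permutations"
    "HOL-Analysis.Finite_Cartesian_Product"
begin

section \<open>Formal linear combinations and tensor powers\<close>

definition fscale :: "'k::comm_ring_1 \<Rightarrow> ('x \<Rightarrow>\<^sub>0 'k) \<Rightarrow> ('x \<Rightarrow>\<^sub>0 'k)" where
  "fscale c p = Poly_Mapping.map ((*) c) p"

lemma lookup_fscale [simp]: "Poly_Mapping.lookup (fscale c p) x = c * Poly_Mapping.lookup p x"
  by (simp add: fscale_def map.rep_eq when_def)

interpretation formal: module "fscale :: 'k::comm_ring_1 \<Rightarrow> ('x \<Rightarrow>\<^sub>0 'k) \<Rightarrow> ('x \<Rightarrow>\<^sub>0 'k)"
  by unfold_locales (auto intro!: poly_mapping_eqI simp: lookup_add algebra_simps)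

definition lin_ext :: "('x \<Rightarrow> ('y \<Rightarrow>\<^sub>0 'k)) \<Rightarrow> ('x \<Rightarrow>\<^sub>0 'k::comm_ring_1) \<Rightarrow> ('y \<Rightarrow>\<^sub>0 'k)" where
  "lin_ext f p = (\<Sum>x\<in>Poly_Mapping.keys p. fscale (Poly_Mapping.lookup p x) (f x))"

definition bilin_ext ::
    "('x \<Rightarrow> 'y \<Rightarrow> ('z \<Rightarrow>\<^sub>0 'k)) \<Rightarrow> ('x \<Rightarrow>\<^sub>0 'k::comm_ring_1) \<Rightarrow> ('y \<Rightarrow>\<^sub>0 'k) \<Rightarrow> ('z \<Rightarrow>\<^sub>0 'k)" where
  "bilin_ext f p q = lin_ext (\<lambda>x. lin_ext (f x) q) p"

text \<open>
  The \<open>d\<close>-th tensor power of a \<open>k\<close>-module \<open>M\<close> is the free \<open>k\<close>-module on the words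
  of length \<open>d\<close> in \<open>M\<close> modulo the multilinearity relations.  Its elements are the
  cosets \<open>tensor_class smul d p\<close>, where \<open>p\<close> is supported on words of length \<open>d\<close>.
\<close>

type_synonym ('k, 'm) tensor = "('m list \<Rightarrow>\<^sub>0 'k) set"

definition tensor_relations ::
    "('k::comm_ring_1 \<Rightarrow> 'm::ab_group_add \<Rightarrow> 'm) \<Rightarrow> nat \<Rightarrow> ('m list \<Rightarrow>\<^sub>0 'k) set" where
  "tensor_relations smul d =
     {Poly_Mapping.single (us @ (x + y) # vs) 1
        - Poly_Mapping.single (us @ x # vs) 1 - Poly_Mapping.single (us @ y # vs) 1
      | us x y vs. length us + 1 + length vs = d}
   \<union> {Poly_Mapping.single (us @ smul c x # vs) 1
        - fscale c (Poly_Mapping.single (us @ x # vs) 1)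
      | us c x vs. length us + 1 + length vs = d}"

definition tensor_class ::
    "('k::comm_ring_1 \<Rightarrow> 'm::ab_group_add \<Rightarrow> 'm) \<Rightarrow> nat \<Rightarrow> ('m list \<Rightarrow>\<^sub>0 'k) \<Rightarrow> ('k, 'm) tensor" where
  "tensor_class smul d p = {q. q - p \<in> formal.span (tensor_relations smul d)}"

text \<open>The span of all \<open>x\<^sub>1 \<otimes> \<dots> \<otimes> x\<^sub>d\<close> with factors in \<open>W\<close>; \<open>W = UNIV\<close> gives the whole tensor power.\<close>

definition tensors_over ::
    "('k::comm_ring_1 \<Rightarrow> 'm::ab_group_add \<Rightarrow> 'm) \<Rightarrow> nat \<Rightarrow> 'm set \<Rightarrow> ('k, 'm) tensor set" where
  "tensors_over smul d W =
     tensor_class smul d ` {p. \<forall>xs\<in>Poly_Mapping.keys p. length xs = d \<and> set xs \<subseteq> W}"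

definition pure_tensor ::
    "('k::comm_ring_1 \<Rightarrow> 'm::ab_group_add \<Rightarrow> 'm) \<Rightarrow> 'm list \<Rightarrow> ('k, 'm) tensor" where
  "pure_tensor smul xs = tensor_class smul (length xs) (Poly_Mapping.single xs 1)"

definition tensor_add ::
    "('k::comm_ring_1 \<Rightarrow> 'm::ab_group_add \<Rightarrow> 'm) \<Rightarrow> nat
       \<Rightarrow> ('k, 'm) tensor \<Rightarrow> ('k, 'm) tensor \<Rightarrow> ('k, 'm) tensor" where
  "tensor_add smul d X Y = (\<Union>p\<in>X. \<Union>q\<in>Y. tensor_class smul d (p + q))"

definition tensor_scale ::
    "('k::comm_ring_1 \<Rightarrow> 'm::ab_group_add \<Rightarrow> 'm) \<Rightarrow> nat
       \<Rightarrow> 'k \<Rightarrow> ('k, 'm) tensor \<Rightarrow> ('k, 'm) tensor" where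
  "tensor_scale smul d c X = (\<Union>p\<in>X. tensor_class smul d (fscale c p))"

definition tensor_submodule ::
    "('k::comm_ring_1 \<Rightarrow> 'm::ab_group_add \<Rightarrow> 'm) \<Rightarrow> nat \<Rightarrow> ('k, 'm) tensor set \<Rightarrow> bool" where
  "tensor_submodule smul d U \<longleftrightarrow>
     U \<subseteq> tensors_over smul d UNIV \<and> tensor_class smul d 0 \<in> U \<and>
     (\<forall>X\<in>U. \<forall>Y\<in>U. tensor_add smul d X Y \<in> U) \<and>
     (\<forall>c. \<forall>X\<in>U. tensor_scale smul d c X \<in> U)"


section \<open>Permutations\<close>

text \<open>
  Positions are numbered from \<open>0\<close>, and \<open>permute_list \<sigma> [x\<^sub>0, x\<^sub>1, \<dots>] = [x\<^bsub>\<sigma> 0\<^esub>, x\<^bsub>\<sigma> 1\<^esub>, \<dots>]\<close>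
  is the right action of \<open>\<sigma>\<close> on words.  The product \<open>\<sigma>\<tau>\<close> is \<open>\<sigma> \<circ> \<tau>\<close>, so the
  right coset \<open>H\<sigma>\<close> is \<open>{h \<circ> \<sigma> | h \<in> H}\<close>.
\<close>

definition symgroup :: "nat \<Rightarrow> (nat \<Rightarrow> nat) set" where
  "symgroup d = {\<sigma>. \<sigma> permutes {..<d}}"

definition right_cosets :: "(nat \<Rightarrow> nat) set \<Rightarrow> nat \<Rightarrow> (nat \<Rightarrow> nat) set set" where
  "right_cosets H d = (\<lambda>\<sigma>. (\<lambda>h. h \<circ> \<sigma>) ` H) ` symgroup d"

definition perm_length :: "nat \<Rightarrow> (nat \<Rightarrow> nat) \<Rightarrow> nat" where
  "perm_length d \<sigma> = card {(i, j). i < j \<and> j < d \<and> \<sigma> i > \<sigma> j}"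

text \<open>The subgroup \<open>\<SS>\<^sub>d \<times> \<SS>\<^sub>f\<close> of \<open>\<SS>\<^bsub>d+f\<^esub>\<close>.\<close>

definition young_subgroup :: "nat \<Rightarrow> nat \<Rightarrow> (nat \<Rightarrow> nat) set" where
  "young_subgroup d f = {h \<in> symgroup (d + f). h ` {..<d} = {..<d}}"

definition shortest_reps :: "nat \<Rightarrow> nat \<Rightarrow> (nat \<Rightarrow> nat) set" where
  "shortest_reps d f = {\<sigma> \<in> symgroup (d + f).
     \<forall>h\<in>young_subgroup d f. perm_length (d + f) \<sigma> \<le> perm_length (d + f) (h \<circ> \<sigma>)}"


section \<open>Matrices\<close>

text \<open>
  \<open>M\<^sub>n(A)\<close> is the type \<open>'a^'n^'n\<close> with \<open>n = CARD('n)\<close>.  The library operations \<open>*\<close> and \<open>1\<close>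
  on this type are entrywise, and \<open>**\<close> and \<open>mat 1\<close> need \<open>0 \<noteq> 1\<close> in the coefficients, so the
  matrix ring structure is spelled out.
\<close>

definition matrix_scale :: "('k \<Rightarrow> 'a \<Rightarrow> 'a) \<Rightarrow> 'k \<Rightarrow> 'a^'n^'n \<Rightarrow> 'a^'n^'n" where
  "matrix_scale smul c X = (\<chi> r s. smul c (X $ r $ s))"

definition matrix_mult :: "'a::ring^'n^'n \<Rightarrow> 'a^'n^'n \<Rightarrow> 'a^'n^'n" where
  "matrix_mult X Y = (\<chi> r s. \<Sum>t\<in>UNIV. X $ r $ t * Y $ t $ s)"

definition matrix_one :: "'a::{ring, monoid_mult}^'n^'n" where
  "matrix_one = (\<chi> r s. if r = s then 1 else 0)"

text \<open>The matrix \<open>\<xi>\<^sup>a\<^bsub>r,s\<^esub> = a E\<^bsub>r,s\<^esub>\<close>.\<close>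

definition xi :: "'a::zero \<Rightarrow> 'n \<Rightarrow> 'n \<Rightarrow> 'a^'n^'n" where
  "xi a r s = (\<chi> i j. if i = r \<and> j = s then a else 0)"

definition matrices_over :: "'a set \<Rightarrow> ('a^'n^'n) set" where
  "matrices_over W = {X. \<forall>r s. X $ r $ s \<in> W}"


section \<open>Superalgebras and good pairs\<close>

locale superalgebra = module smul
  for smul :: "'k::comm_ring_1 \<Rightarrow> 'a::ring \<Rightarrow> 'a" +
  fixes A0 A1 :: "'a set"
  assumes scale_mult_left: "smul c (a * b) = smul c a * b"
    and scale_mult_right: "smul c (a * b) = a * smul c b"
    and subspace_A0: "subspace A0"
    and subspace_A1: "subspace A1"
    and A0_Int_A1: "A0 \<inter> A1 = {0}"
    and A0_plus_A1: "\<exists>u\<in>A0. \<exists>v\<in>A1. a = u + v"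
    and mult_A0_A0: "a \<in> A0 \<Longrightarrow> b \<in> A0 \<Longrightarrow> a * b \<in> A0"
    and mult_A0_A1: "a \<in> A0 \<Longrightarrow> b \<in> A1 \<Longrightarrow> a * b \<in> A1"
    and mult_A1_A0: "a \<in> A1 \<Longrightarrow> b \<in> A0 \<Longrightarrow> a * b \<in> A1"
    and mult_A1_A1: "a \<in> A1 \<Longrightarrow> b \<in> A1 \<Longrightarrow> a * b \<in> A0"
begin

definition is_basis :: "'a set \<Rightarrow> 'a set \<Rightarrow> bool" where
  "is_basis B W \<longleftrightarrow> independent B \<and> span B = W"

definition free :: "'a set \<Rightarrow> bool" where
  "free W \<longleftrightarrow> (\<exists>B. is_basis B W)"

text \<open>\<open>A/W\<close> is free: the classes modulo \<open>W\<close> of the elements of some \<open>C\<close> form a basis of it.\<close>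

definition free_quotient :: "'a set \<Rightarrow> bool" where
  "free_quotient W \<longleftrightarrow> (\<exists>C.
     (\<forall>t u. finite t \<and> t \<subseteq> C \<and> (\<Sum>v\<in>t. smul (u v) v) \<in> W \<longrightarrow> (\<forall>v\<in>t. u v = 0)) \<and>
     (\<forall>a. \<exists>v\<in>span C. a - v \<in> W))"

text \<open>Parities are encoded as Booleans, \<open>True\<close> being odd.\<close>

definition component :: "bool \<Rightarrow> 'a \<Rightarrow> 'a" where
  "component e a = (if e then THE v. v \<in> A1 \<and> a - v \<in> A0 else THE u. u \<in> A0 \<and> a - u \<in> A1)"

definition matrix_component :: "bool \<Rightarrow> 'a^'n^'n \<Rightarrow> 'a^'n^'n" where
  "matrix_component e X = (\<chi> r s. component e (X $ r $ s))"

definition components :: "bool list \<Rightarrow> ('a^'n^'n) list \<Rightarrow> ('a^'n^'n) list" where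
  "components es xs = map2 matrix_component es xs"

text \<open>
  Product of tensors of the same length.  Iterating
  \<open>(x \<otimes> y)(z \<otimes> w) = (-1)\<^bsup>|y||z|\<^esup> xz \<otimes> yw\<close>, for homogeneous factors
  \<open>(x\<^sub>1 \<otimes> \<dots> \<otimes> x\<^sub>d)(y\<^sub>1 \<otimes> \<dots> \<otimes> y\<^sub>d)\<close> is \<open>x\<^sub>1y\<^sub>1 \<otimes> \<dots> \<otimes> x\<^sub>dy\<^sub>d\<close> up to the sign
  given by the number of \<open>k < l\<close> with \<open>y\<^sub>k\<close> and \<open>x\<^sub>l\<close> odd.  General factors are split into
  their homogeneous components.
\<close>

definition word_mult :: "('a^'n^'n) list \<Rightarrow> ('a^'n^'n) list \<Rightarrow> (('a^'n^'n) list \<Rightarrow>\<^sub>0 'k)" where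
  "word_mult xs ys =
     (\<Sum>es | length es = length xs. \<Sum>fs | length fs = length ys.
        Poly_Mapping.single (map2 matrix_mult (components es xs) (components fs ys))
          ((-1) ^ card {(k, l). k < l \<and> l < length xs \<and> fs ! k \<and> es ! l}))"

definition tensor_mult ::
    "nat \<Rightarrow> ('k, 'a^'n^'n) tensor \<Rightarrow> ('k, 'a^'n^'n) tensor \<Rightarrow> ('k, 'a^'n^'n) tensor" where
  "tensor_mult d X Y =
     (\<Union>p\<in>X. \<Union>q\<in>Y. tensor_class (matrix_scale smul) d (bilin_ext word_mult p q))"

text \<open>
  The action of \<open>\<sigma> \<in> \<SS>\<^sub>d\<close>.  Again words are split into homogeneous components; the
  exponent of \<open>-1\<close> is \<open>\<langle>\<sigma>; a\<rangle>\<close>.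
\<close>

definition word_act :: "(nat \<Rightarrow> nat) \<Rightarrow> ('a^'n^'n) list \<Rightarrow> (('a^'n^'n) list \<Rightarrow>\<^sub>0 'k)" where
  "word_act \<sigma> xs =
     (\<Sum>es | length es = length xs.
        Poly_Mapping.single (permute_list \<sigma> (components es xs))
          ((-1) ^ card {(k, l). k < l \<and> l < length xs \<and> inv \<sigma> k > inv \<sigma> l \<and> es ! k \<and> es ! l}))"

definition tensor_act ::
    "nat \<Rightarrow> (nat \<Rightarrow> nat) \<Rightarrow> ('k, 'a^'n^'n) tensor \<Rightarrow> ('k, 'a^'n^'n) tensor" where
  "tensor_act d \<sigma> X = (\<Union>p\<in>X. tensor_class (matrix_scale smul) d (lin_ext (word_act \<sigma>) p))"

text \<open>
  \<open>invariants \<aa> d\<close> is \<open>S\<^sup>\<aa>(n,d)\<close>, with \<open>M\<^sub>n(\<aa>)\<^bsup>\<otimes>d\<^esup>\<close> identified with its image in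
  \<open>M\<^sub>n(A)\<^bsup>\<otimes>d\<^esup>\<close> (the canonical map is injective when \<open>\<aa>\<close> and \<open>A/\<aa>\<close> are free);
  \<open>invariants UNIV d\<close> is \<open>S\<^sup>A(n,d)\<close>.
\<close>

definition invariants :: "'a set \<Rightarrow> nat \<Rightarrow> ('k, 'a^'n^'n) tensor set" where
  "invariants W d = {X \<in> tensors_over (matrix_scale smul) d (matrices_over W).
                       \<forall>\<sigma>\<in>symgroup d. tensor_act d \<sigma> X = X}"

text \<open>\<open>star d f X Y\<close> is \<open>X * Y\<close> for \<open>X\<close> of degree \<open>d\<close> and \<open>Y\<close> of degree \<open>f\<close>.\<close>

definition star ::
    "nat \<Rightarrow> nat \<Rightarrow> ('k, 'a^'n^'n) tensor \<Rightarrow> ('k, 'a^'n^'n) tensor \<Rightarrow> ('k, 'a^'n^'n) tensor" where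
  "star d f X Y =
     (\<Union>p\<in>X. \<Union>q\<in>Y. tensor_class (matrix_scale smul) (d + f)
        (\<Sum>\<sigma>\<in>shortest_reps d f.
           lin_ext (word_act \<sigma>) (bilin_ext (\<lambda>xs ys. Poly_Mapping.single (xs @ ys) 1) p q)))"

definition Tri :: "'a set \<Rightarrow> nat \<Rightarrow> ('a list \<times> 'n list \<times> 'n list) set" where
  "Tri B d = {(bs, rs, ss).
     length bs = d \<and> length rs = d \<and> length ss = d \<and> set bs \<subseteq> B \<and>
     (\<forall>k<d. \<forall>l<d. k \<noteq> l \<and> (bs ! k, rs ! k, ss ! k) = (bs ! l, rs ! l, ss ! l) \<longrightarrow> bs ! k \<in> A0)}"

definition stabilizer :: "'a list \<Rightarrow> 'n list \<Rightarrow> 'n list \<Rightarrow> (nat \<Rightarrow> nat) set" where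
  "stabilizer bs rs ss = {\<sigma> \<in> symgroup (length bs).
     permute_list \<sigma> bs = bs \<and> permute_list \<sigma> rs = rs \<and> permute_list \<sigma> ss = ss}"

definition xi_word :: "'a list \<Rightarrow> 'n list \<Rightarrow> 'n list \<Rightarrow> ('a^'n^'n) list" where
  "xi_word bs rs ss = map (\<lambda>(b, r, s). xi b r s) (zip bs (zip rs ss))"

text \<open>The representative of each coset is an arbitrary choice; \<open>xi_sum\<close> does not depend on it on \<open>Tri\<close>.\<close>

definition xi_sum :: "'a list \<Rightarrow> 'n list \<Rightarrow> 'n list \<Rightarrow> ('k, 'a^'n^'n) tensor" where
  "xi_sum bs rs ss = tensor_class (matrix_scale smul) (length bs)
     (\<Sum>C\<in>right_cosets (stabilizer bs rs ss) (length bs).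
        word_act (SOME \<sigma>. \<sigma> \<in> C) (xi_word bs rs ss))"

definition multiplicity :: "'a list \<Rightarrow> 'n list \<Rightarrow> 'n list \<Rightarrow> 'a \<Rightarrow> 'n \<Rightarrow> 'n \<Rightarrow> nat" where
  "multiplicity bs rs ss b r s = card {k. k < length bs \<and> (bs ! k, rs ! k, ss ! k) = (b, r, s)}"

text \<open>
  The product runs over the letters of \<open>bs\<close> only: \<open>Bc\<close> may be infinite, and all other
  factors are \<open>0! = 1\<close>.
\<close>

definition c_factorial :: "'a set \<Rightarrow> 'a list \<Rightarrow> 'n::finite list \<Rightarrow> 'n list \<Rightarrow> nat" where
  "c_factorial Bc bs rs ss =
     (\<Prod>b\<in>Bc \<inter> set bs. \<Prod>r\<in>UNIV. \<Prod>s\<in>UNIV. fact (multiplicity bs rs ss b r s))"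

definition eta :: "'a set \<Rightarrow> 'a list \<Rightarrow> 'n list \<Rightarrow> 'n list \<Rightarrow> ('k, 'a^'n^'n) tensor" where
  "eta Bc bs rs ss = tensor_scale (matrix_scale smul) (length bs)
     (of_nat (c_factorial Bc bs rs ss)) (xi_sum bs rs ss)"

text \<open>\<open>T_alg Ba Bc B1 d\<close> is \<open>T\<^sup>A\<^sub>\<aa>(n,d)\<close>, defined through the given \<open>(A,\<aa>)\<close>-basis.\<close>

definition T_alg :: "'a set \<Rightarrow> 'a set \<Rightarrow> 'a set \<Rightarrow> nat \<Rightarrow> ('k, 'a^'n^'n) tensor set" where
  "T_alg Ba Bc B1 d = tensor_submodule (matrix_scale smul) d hull
     {eta Bc bs rs ss | bs rs ss. (bs, rs, ss) \<in> Tri (Ba \<union> Bc \<union> B1) d}"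

definition is_subalgebra :: "nat \<Rightarrow> ('k, 'a^'n^'n) tensor set \<Rightarrow> bool" where
  "is_subalgebra d U \<longleftrightarrow>
     tensor_submodule (matrix_scale smul) d U \<and> (\<forall>X\<in>U. \<forall>Y\<in>U. tensor_mult d X Y \<in> U)"

text \<open>The subalgebra of \<open>S\<^sup>A(n,d)\<close> generated by a subset of it.\<close>

definition generated_subalgebra ::
    "nat \<Rightarrow> ('k, 'a^'n^'n) tensor set \<Rightarrow> ('k, 'a^'n^'n) tensor set" where
  "generated_subalgebra d G = (\<lambda>U. is_subalgebra d U \<and> U \<subseteq> invariants UNIV d) hull G"

end

locale good_pair = superalgebra smul A0 A1
  for smul :: "'k::comm_ring_1 \<Rightarrow> 'a::ring \<Rightarrow> 'a" and A0 A1 +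
  fixes \<aa> :: "'a set"
  assumes free_A0: "free A0" and free_A1: "free A1"
    and \<aa>_subset: "\<aa> \<subseteq> A0"
    and subspace_\<aa>: "subspace \<aa>"
    and mult_\<aa>: "a \<in> \<aa> \<Longrightarrow> b \<in> \<aa> \<Longrightarrow> a * b \<in> \<aa>"
    and free_\<aa>: "free \<aa>" and free_quotient_\<aa>: "free_quotient \<aa>"
begin

definition adapted_basis :: "'a set \<Rightarrow> 'a set \<Rightarrow> 'a set \<Rightarrow> 'a set \<Rightarrow> bool" where
  "adapted_basis \<cc> Ba Bc B1 \<longleftrightarrow>
     subspace \<cc> \<and> \<aa> \<inter> \<cc> = {0} \<and> {u + v | u v. u \<in> \<aa> \<and> v \<in> \<cc>} = A0 \<and>
     is_basis Ba \<aa> \<and> is_basis Bc \<cc> \<and> is_basis B1 A1"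

end

text \<open>
  The type class \<open>{ring, monoid_mult}\<close> is that of unital rings in which \<open>0 = 1\<close> is allowed.
\<close>

locale unital_good_pair = good_pair smul A0 A1 \<aa>
  for smul :: "'k::comm_ring_1 \<Rightarrow> 'a::{ring, monoid_mult} \<Rightarrow> 'a" and A0 A1 \<aa> +
  assumes one_\<aa>: "1 \<in> \<aa>"

end

theory Submission
  imports Defs "HOL-Library.Multiset"
begin

text \<open>
  Expanding in basis words identifies \<open>M\<^sub>n(A)\<^bsup>\<otimes>d\<^esup>\<close> with finitely supported functions on words
  of length \<open>d\<close>, and \<open>S\<^sup>A(n,d)\<close> with the functions that are symmetric up to sign.  Let \<open>H\<^sub>w\<close> be the
  group of the permutations that stabilize \<open>w\<close> and move only positions with letters from \<open>Bc\<close>.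
  Then \<open>T\<close> consists of the symmetric functions whose value at every \<open>w\<close> is divisible by \<open>|H\<^sub>w|\<close>.

  \<open>T\<close> is closed under products: \<open>H\<^sub>w\<close> acts on the pairs \<open>(u, v)\<close> over which the coefficient of \<open>w\<close> in a
  product is summed, and the stabilizer of a pair that contributes embeds into \<open>H\<^sub>u \<times> H\<^sub>v\<close> because \<open>\<aa>\<close>
  is closed under multiplication.

  \<open>T\<close> is generated as claimed: let \<open>x\<close> be the orbit sum of a word with a letter \<open>y\<close> from \<open>Y\<close>, and
  \<open>z\<close> the orbit sum of the word in which \<open>y\<close> is replaced by \<open>1\<close>.  The product of \<open>1\<^bsup>\<otimes>d-1\<^esup> * y\<close>
  and \<open>z\<close> is \<open>x\<close>, up to sign, plus orbit sums of words with fewer letters from \<open>Y\<close> or with as many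
  letters from \<open>Y\<close> but more letters \<open>1\<close> than \<open>x\<close>, so that one can conclude by induction.
\<close>

section \<open>Signs\<close>

text \<open>The identity matrix need not be a basis matrix, so replacing a letter by 1 leaves the
  basis words. The generation argument therefore admits words with arbitrary factors from M_n(\<aa>)
  and divides symmetrizations only by the stabilizer of these factors. On basis words this gives the
  required normalization: odd letters are distinct, so the stabilizer of a word has as order the
  product of its \<open>Ba\<close>-part and its \<open>Bc\<close>-part, and dividing by the first
  leaves the second.

  There is no division in the ground ring. Identities between orbit sums are proved after
  multiplication by a stabilizer order, where sums over the whole symmetric group are available, and
  the order is cancelled in a domain of characteristic 0. For the correction terms in a product
  cancelling is not enough: they have to be that order times an element of the subalgebra. This
  holds because equal factors from M_n(\<aa>) give equal symmetrized terms, and the number of these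
  terms supplies exactly the missing factor.

  The same property of the ground ring makes an invariant vanish on words with a repeated odd
  letter, which is why odd letters never enter a stabilizer.\<close>

definition index_pairs :: "nat \<Rightarrow> (nat \<times> nat) set" where
  "index_pairs d = {(k, l). k < l \<and> l < d}"

lemma finite_index_pairs [simp]: "finite (index_pairs d)"
  by (rule finite_subset[of _ "{..<d} \<times> {..<d}"]) (auto simp: index_pairs_def)

text \<open>A sign written as a product over pairs of positions can be compared with another one
  pair by pair; no cardinality has to be computed modulo 2.\<close>

lemma minus_one_power_card:
  assumes "finite S"
  shows "(-1 :: 'k::comm_ring_1) ^ card {x \<in> S. P x} = (\<Prod>x\<in>S. if P x then -1 else 1)"
  using assms by (simp add: prod.If_cases Int_def)

text \<open>A permutation acts on unordered pairs of positions; listing each pair in increasing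
  order costs a case distinction, according to whether the pair is reversed.\<close>

lemma prod_index_pairs_permute:
  fixes g :: "nat \<Rightarrow> nat \<Rightarrow> 'k::comm_monoid_mult"
  assumes "\<sigma> permutes {..<d}"
  shows "(\<Prod>(i, j)\<in>index_pairs d. g (\<sigma> i) (\<sigma> j)) =
         (\<Prod>(k, l)\<in>index_pairs d. if inv \<sigma> k < inv \<sigma> l then g k l else g l k)"
proof -
  have inv: "inv \<sigma> (\<sigma> i) = i" "\<sigma> (inv \<sigma> i) = i" for i
    using permutes_inverses[OF assms] by auto
  have lt: "\<sigma> i < d \<longleftrightarrow> i < d" "inv \<sigma> i < d \<longleftrightarrow> i < d" for i
    using permutes_in_image[OF assms, of i] permutes_in_image[OF permutes_inv[OF assms], of i] by auto
  have neq: "\<sigma> i < \<sigma> j \<or> \<sigma> j < \<sigma> i" "inv \<sigma> i < inv \<sigma> j \<or> inv \<sigma> j < inv \<sigma> i" if "i < j" for i j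
    using that inv by (metis linorder_neqE_nat less_irrefl)+
  show ?thesis
  proof (rule prod.reindex_bij_witness
      [where i = "\<lambda>(k, l). if inv \<sigma> k < inv \<sigma> l then (inv \<sigma> k, inv \<sigma> l) else (inv \<sigma> l, inv \<sigma> k)"
        and j = "\<lambda>(i, j). if \<sigma> i < \<sigma> j then (\<sigma> i, \<sigma> j) else (\<sigma> j, \<sigma> i)"], goal_cases)
    case (1 a)
    then show ?case by (cases a) (simp add: index_pairs_def inv)
  next
    case (2 a)
    then show ?case using neq(1)[of "fst a" "snd a"] by (cases a) (auto simp: index_pairs_def lt)
  next
    case (3 b)
    then show ?case by (cases b) (simp add: index_pairs_def inv)
  next
    case (4 b)
    then show ?case using neq(2)[of "fst b" "snd b"] by (cases b) (auto simp: index_pairs_def lt)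
  next
    case (5 a)
    then show ?case by (cases a) (simp add: index_pairs_def inv)
  qed
qed

text \<open>The sign by which \<open>\<sigma>\<close> acts on a word whose letter at
  \<open>k\<close> is odd exactly if \<open>a k\<close>. Parities are a function on positions, so
  that permuting them is composition.\<close>

definition perm_sign :: "nat \<Rightarrow> (nat \<Rightarrow> nat) \<Rightarrow> (nat \<Rightarrow> bool) \<Rightarrow> 'k::comm_ring_1" where
  "perm_sign d \<sigma> a = (\<Prod>(k, l)\<in>index_pairs d. if inv \<sigma> l < inv \<sigma> k \<and> a k \<and> a l then -1 else 1)"

text \<open>The sign of a product of two words with parities \<open>a\<close> on the left and
  \<open>b\<close> on the right: the right letter at \<open>k\<close> passes the left letters at all
  \<open>l > k\<close>.\<close>

definition mult_sign :: "nat \<Rightarrow> (nat \<Rightarrow> bool) \<Rightarrow> (nat \<Rightarrow> bool) \<Rightarrow> 'k::comm_ring_1" where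
  "mult_sign d a b = (\<Prod>(k, l)\<in>index_pairs d. if b k \<and> a l then -1 else 1)"

lemma perm_sign_eq_power:
  "(-1) ^ card {(k, l). k < l \<and> l < d \<and> inv \<sigma> k > inv \<sigma> l \<and> a k \<and> a l} = perm_sign d \<sigma> a"
proof -
  have "{(k, l). k < l \<and> l < d \<and> inv \<sigma> k > inv \<sigma> l \<and> a k \<and> a l} =
      {x \<in> index_pairs d. case x of (k, l) \<Rightarrow> inv \<sigma> l < inv \<sigma> k \<and> a k \<and> a l}"
    by (auto simp: index_pairs_def)
  then show ?thesis
    by (simp only: minus_one_power_card[OF finite_index_pairs] perm_sign_def)
      (auto intro!: prod.cong)
qed

lemma mult_sign_eq_power:
  "(-1) ^ card {(k, l). k < l \<and> l < d \<and> b k \<and> a l} = mult_sign d a b"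
proof -
  have "{(k, l). k < l \<and> l < d \<and> b k \<and> a l} = {x \<in> index_pairs d. case x of (k, l) \<Rightarrow> b k \<and> a l}"
    by (auto simp: index_pairs_def)
  then show ?thesis
    by (simp only: minus_one_power_card[OF finite_index_pairs] mult_sign_def)
      (auto intro!: prod.cong)
qed

lemma perm_sign_cong:
  assumes "\<And>k. k < d \<Longrightarrow> a k = b k"
  shows "perm_sign d \<sigma> a = perm_sign d \<sigma> b"
  unfolding perm_sign_def using assms by (intro prod.cong) (auto simp: index_pairs_def)

lemma mult_sign_cong:
  assumes "\<And>k. k < d \<Longrightarrow> a k = a' k" "\<And>k. k < d \<Longrightarrow> b k = b' k"
  shows "mult_sign d a b = mult_sign d a' b'"
  unfolding mult_sign_def using assms by (intro prod.cong) (auto simp: index_pairs_def)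

lemma perm_sign_square: "perm_sign d \<sigma> a * perm_sign d \<sigma> a = (1 :: 'k::comm_ring_1)"
  unfolding perm_sign_def prod.distrib[symmetric] by (intro prod.neutral) auto

text \<open>Cocycle identity of a right action. A pair is an inversion of the composite exactly if
  one of the two permutations reverses it and the other does not; a pair reversed twice contributes
  -1 twice.\<close>

lemma perm_sign_comp:
  assumes "\<sigma> permutes {..<d}" "\<tau> permutes {..<d}"
  shows "perm_sign d (\<sigma> \<circ> \<tau>) a = perm_sign d \<sigma> a * (perm_sign d \<tau> (\<lambda>k. a (\<sigma> k)) :: 'k::comm_ring_1)"
proof -
  have ne: "inv \<sigma> i = inv \<sigma> j \<longleftrightarrow> i = j" "inv \<tau> i = inv \<tau> j \<longleftrightarrow> i = j" for i j
    using assms by (metis permutes_inverses(1))+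
  \<comment> \<open>\<open>g\<close> is the sign contributed by \<open>\<tau>\<close>, rewritten in
    the positions before \<open>\<sigma>\<close>, so that both products run over the same
    pairs.\<close>
  define g :: "nat \<Rightarrow> nat \<Rightarrow> 'k" where
    "g k l = (if inv \<tau> (inv \<sigma> l) < inv \<tau> (inv \<sigma> k) \<and> a k \<and> a l then -1 else 1)" for k l
  have "perm_sign d \<tau> (\<lambda>k. a (\<sigma> k)) = (\<Prod>(i, j)\<in>index_pairs d. g (\<sigma> i) (\<sigma> j))"
    unfolding perm_sign_def g_def using permutes_inverses(2)[OF assms(1)] by (intro prod.cong) auto
  also have "\<dots> = (\<Prod>(k, l)\<in>index_pairs d. if inv \<sigma> k < inv \<sigma> l then g k l else g l k)"
    by (rule prod_index_pairs_permute[OF assms(1)])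
  finally have e: "perm_sign d \<tau> (\<lambda>k. a (\<sigma> k)) =
      (\<Prod>(k, l)\<in>index_pairs d. if inv \<sigma> k < inv \<sigma> l then g k l else g l k)" .
  have "perm_sign d \<sigma> a * perm_sign d \<tau> (\<lambda>k. a (\<sigma> k)) =
     (\<Prod>(k, l)\<in>index_pairs d. (if inv \<sigma> l < inv \<sigma> k \<and> a k \<and> a l then -1 else 1) *
        (if inv \<sigma> k < inv \<sigma> l then g k l else g l k))"
    unfolding e by (simp add: perm_sign_def prod.distrib case_prod_unfold)
  also have "\<dots> = perm_sign d (\<sigma> \<circ> \<tau>) a"
    unfolding perm_sign_def o_inv_distrib[OF permutes_bij[OF assms(1)] permutes_bij[OF assms(2)]] g_def
  proof (rule prod.cong[OF refl], clarify)
    fix k l assume "(k, l) \<in> index_pairs d"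
    then have "inv \<sigma> k \<noteq> inv \<sigma> l" "inv \<tau> (inv \<sigma> k) \<noteq> inv \<tau> (inv \<sigma> l)"
      by (auto simp: index_pairs_def ne)
    then show "(if inv \<sigma> l < inv \<sigma> k \<and> a k \<and> a l then - 1 else (1::'k)) *
       (if inv \<sigma> k < inv \<sigma> l then if inv \<tau> (inv \<sigma> l) < inv \<tau> (inv \<sigma> k) \<and> a k \<and> a l then - 1 else 1
        else if inv \<tau> (inv \<sigma> k) < inv \<tau> (inv \<sigma> l) \<and> a l \<and> a k then - 1 else 1) =
       (if (inv \<tau> \<circ> inv \<sigma>) l < (inv \<tau> \<circ> inv \<sigma>) k \<and> a k \<and> a l then - 1 else (1::'k))"
      by (auto simp: not_less)
  qed
  finally show ?thesis by simp
qed

text \<open>This makes the action multiplicative. For a pair that \<open>\<sigma>\<close> reverses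
  it is, modulo 2, the expansion of \<open>(a k + b k) * (a l + b l)\<close>, whose mixed terms are
  the exponents of the product sign before and after the reversal.\<close>

lemma mult_sign_permute:
  assumes "\<sigma> permutes {..<d}"
  shows "perm_sign d \<sigma> a * perm_sign d \<sigma> b * mult_sign d (\<lambda>k. a (\<sigma> k)) (\<lambda>k. b (\<sigma> k)) =
         perm_sign d \<sigma> (\<lambda>k. a k \<noteq> b k) * (mult_sign d a b :: 'k::comm_ring_1)"
proof -
  have ne: "inv \<sigma> i = inv \<sigma> j \<longleftrightarrow> i = j" for i j
    using assms by (metis permutes_inverses(1))
  define g :: "nat \<Rightarrow> nat \<Rightarrow> 'k" where "g k l = (if b k \<and> a l then -1 else 1)" for k l
  have "mult_sign d (\<lambda>k. a (\<sigma> k)) (\<lambda>k. b (\<sigma> k)) = (\<Prod>(i, j)\<in>index_pairs d. g (\<sigma> i) (\<sigma> j))"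
    unfolding mult_sign_def g_def by (intro prod.cong) auto
  also have "\<dots> = (\<Prod>(k, l)\<in>index_pairs d. if inv \<sigma> k < inv \<sigma> l then g k l else g l k)"
    by (rule prod_index_pairs_permute[OF assms])
  finally have e: "mult_sign d (\<lambda>k. a (\<sigma> k)) (\<lambda>k. b (\<sigma> k)) =
      (\<Prod>(k, l)\<in>index_pairs d. if inv \<sigma> k < inv \<sigma> l then g k l else g l k)" .
  show ?thesis
    unfolding e unfolding perm_sign_def mult_sign_def prod.distrib[symmetric] g_def
  proof (rule prod.cong[OF refl], clarify, goal_cases)
    case (1 k l)
    then have "inv \<sigma> k < inv \<sigma> l \<or> inv \<sigma> l < inv \<sigma> k"
      using ne[of k l] by (auto simp: index_pairs_def)
    then show ?case by auto
  qed
qed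

text \<open>Only pairs of odd positions matter, and positions that are fixed are not inverted among
  themselves.\<close>

lemma perm_sign_fixed_odd:
  assumes "\<sigma> permutes {..<d}" "\<And>k. k < d \<Longrightarrow> a k \<Longrightarrow> \<sigma> k = k"
  shows "perm_sign d \<sigma> a = 1"
proof -
  have "inv \<sigma> k = k" if "k < d" "a k" for k
    using assms that by (metis permutes_inverses(2))
  then show ?thesis
    unfolding perm_sign_def by (intro prod.neutral) (auto simp: index_pairs_def)
qed

lemma mult_sign_square: "mult_sign d a b * mult_sign d a b = (1 :: 'k::comm_ring_1)"
  unfolding mult_sign_def prod.distrib[symmetric] by (intro prod.neutral) auto

lemma perm_sign_transpose_01:
  assumes "a 0" "a 1" "1 < d"
  shows "perm_sign d (Transposition.transpose 0 1) a = (-1 :: 'k::comm_ring_1)"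
proof -
  let ?f = "\<lambda>(k, l). if inv (Transposition.transpose 0 1) l < inv (Transposition.transpose 0 (1::nat)) k \<and> a k \<and> a l then -1 else (1::'k)"
  have swap: "k = 0 \<and> l = 1"
    if "k < l" "Transposition.transpose 0 1 l < Transposition.transpose 0 (1::nat) k" for k l
    using that by (auto simp: Transposition.transpose_def split: if_splits)
  have "perm_sign d (Transposition.transpose 0 1) a = (\<Prod>x\<in>{(0, 1)}. ?f x)"
    unfolding perm_sign_def
  proof (rule prod.mono_neutral_right)
    show "{(0, 1)} \<subseteq> index_pairs d" using assms by (auto simp: index_pairs_def)
    show "\<forall>x\<in>index_pairs d - {(0, 1)}. ?f x = 1"
    proof
      fix x assume "x \<in> index_pairs d - {(0, 1)}"
      then obtain k l where x: "x = (k, l)" "k < l" "\<not> (k = 0 \<and> l = 1)"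
        by (cases x) (auto simp: index_pairs_def)
      then have "\<not> Transposition.transpose 0 1 l < Transposition.transpose 0 1 k" using swap by blast
      then show "?f x = 1" by (simp add: x(1) inv_transpose_eq)
    qed
  qed simp
  then show ?thesis using assms by (simp add: inv_transpose_eq)
qed

lemma permutation_to_front:
  assumes "k < d" "l < d" "k \<noteq> l"
  obtains \<tau> where "\<tau> permutes {..<d}" "\<tau> 0 = k" "\<tau> 1 = (l::nat)"
proof
  \<comment> \<open>\<open>?m\<close> is the preimage of \<open>l\<close> under the outer
    transposition, so \<open>?t\<close> maps 1 to \<open>l\<close>. It is not 0 because
    \<open>l\<close> differs from \<open>k\<close>; hence the inner transposition leaves 0
    alone.\<close>
  let ?m = "Transposition.transpose 0 k l"
  let ?t = "Transposition.transpose 0 k \<circ> Transposition.transpose 1 ?m"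
  have "?m < d" "?m \<noteq> 0" using assms by (auto simp: Transposition.transpose_def)
  then show "?t permutes {..<d}" using assms
    by (intro permutes_compose permutes_swap_id) auto
  show "?t 0 = k" using \<open>?m \<noteq> 0\<close> by (simp add: Transposition.transpose_def)
  show "?t 1 = l" by simp
qed

section \<open>Group actions and stabilizers of words\<close>

definition perm_group :: "('i \<Rightarrow> 'i) set \<Rightarrow> bool" where
  "perm_group G \<longleftrightarrow> finite G \<and> id \<in> G \<and> (\<forall>g\<in>G. \<forall>h\<in>G. g \<circ> h \<in> G) \<and> (\<forall>g\<in>G. inv g \<in> G \<and> bij g)"

text \<open>The orbit of \<open>x\<close> contributes \<open>card orbit * F x\<close>, and \<open>card G = card orbit * card stabilizer\<close>.\<close>

lemma card_group_dvd_sum: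
  fixes F :: "'x \<Rightarrow> 'k::comm_ring_1" and act :: "('i \<Rightarrow> 'i) \<Rightarrow> 'x \<Rightarrow> 'x"
  assumes "finite \<Omega>" and group: "perm_group G"
    and act_in: "\<And>g x. g \<in> G \<Longrightarrow> x \<in> \<Omega> \<Longrightarrow> act g x \<in> \<Omega>"
    and act_id: "\<And>x. x \<in> \<Omega> \<Longrightarrow> act id x = x"
    and act_comp: "\<And>g h x. g \<in> G \<Longrightarrow> h \<in> G \<Longrightarrow> x \<in> \<Omega> \<Longrightarrow> act (g \<circ> h) x = act h (act g x)"
    and F_act: "\<And>g x. g \<in> G \<Longrightarrow> x \<in> \<Omega> \<Longrightarrow> F (act g x) = F x"
    and dvd: "\<And>x. x \<in> \<Omega> \<Longrightarrow> of_nat (card {g \<in> G. act g x = x}) dvd F x"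
  shows "of_nat (card G) dvd (\<Sum>x\<in>\<Omega>. F x)"
  using assms(1) act_in act_id act_comp F_act dvd
proof (induction \<Omega> rule: finite_psubset_induct)
  case (psubset \<Omega>)
  have G: "id \<in> G" "\<And>g h. g \<in> G \<Longrightarrow> h \<in> G \<Longrightarrow> g \<circ> h \<in> G"
      "\<And>g. g \<in> G \<Longrightarrow> inv g \<in> G" "\<And>g. g \<in> G \<Longrightarrow> bij g" and "finite G"
    using group by (simp_all add: perm_group_def)
  note act_in = psubset.prems(1) and act_id = psubset.prems(2) and act_comp = psubset.prems(3)
    and F_act = psubset.prems(4) and dvd = psubset.prems(5)
  show ?case
  proof (cases "\<Omega> = {}")
    case False
    then obtain x where x: "x \<in> \<Omega>" by blast
    define orb where "orb = (\<lambda>g. act g x) ` G"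
    have inv_comp: "g \<circ> inv g = id" "inv g \<circ> g = id" if "g \<in> G" for g
      using G(4)[OF that] by (simp_all add: bij_is_surj bij_is_inj surj_iff[symmetric] inj_iff[symmetric])
    have inv_act: "act (inv g) (act g y) = y" "act g (act (inv g) y) = y" if "g \<in> G" "y \<in> \<Omega>" for g y
      using act_comp[OF that(1) G(3)[OF that(1)] that(2)] act_comp[OF G(3)[OF that(1)] that(1,2)]
      unfolding inv_comp[OF that(1)] act_id[OF that(2)] by simp_all
    have orb: "orb \<subseteq> \<Omega>" "x \<in> orb"
      using act_in x image_eqI[OF _ G(1), of x "\<lambda>g. act g x"] act_id[OF x] by (auto simp: orb_def)
    have orb_closed: "act g y \<in> orb" if "g \<in> G" "y \<in> orb" for g y
    proof -
      from that(2) obtain h where h: "h \<in> G" "y = act h x" by (auto simp: orb_def)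
      show ?thesis unfolding orb_def h(2) act_comp[OF h(1) that(1) x, symmetric]
        using G(2)[OF h(1) that(1)] by (rule imageI)
    qed
    \<comment> \<open>The complement of an orbit is again stable under the group, so the induction
      hypothesis covers it.\<close>
    have rest: "of_nat (card G) dvd (\<Sum>x\<in>\<Omega> - orb. F x)"
    proof (rule psubset.IH)
      show "\<Omega> - orb \<subset> \<Omega>" using orb by blast
      show "act g y \<in> \<Omega> - orb" if "g \<in> G" "y \<in> \<Omega> - orb" for g y
      proof -
        have "act g y \<notin> orb"
          using orb_closed[OF G(3)[OF that(1)], of "act g y"] inv_act(1)[of g y] that by auto
        then show ?thesis using act_in that by simp
      qed
    qed (use act_id act_comp F_act dvd in auto)
    \<comment> \<open>The elements that carry \<open>x\<close> to \<open>y\<close> form a coset of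
      the stabilizer of \<open>x\<close>, obtained by composing with one such element
      \<open>g0\<close>.\<close>
    have fib: "card {g \<in> G. act g x = y} = card {g \<in> G. act g x = x}" if "y \<in> orb" for y
    proof -
      from that obtain g0 where g0: "g0 \<in> G" "y = act g0 x" by (auto simp: orb_def)
      have "bij_betw (\<lambda>s. s \<circ> g0) {g \<in> G. act g x = x} {g \<in> G. act g x = y}"
      proof (rule bij_betw_byWitness[where f' = "\<lambda>s. s \<circ> inv g0"])
        show "\<forall>s\<in>{g \<in> G. act g x = x}. s \<circ> g0 \<circ> inv g0 = s"
          by (simp add: o_assoc[symmetric] inv_comp[OF g0(1)])
        show "\<forall>s\<in>{g \<in> G. act g x = y}. s \<circ> inv g0 \<circ> g0 = s"
          by (simp add: o_assoc[symmetric] inv_comp[OF g0(1)])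
        show "(\<lambda>s. s \<circ> g0) ` {g \<in> G. act g x = x} \<subseteq> {g \<in> G. act g x = y}"
        proof clarify
          fix s assume s: "s \<in> G" "act s x = x"
          then show "s \<circ> g0 \<in> G \<and> act (s \<circ> g0) x = y"
            unfolding act_comp[OF s(1) g0(1) x] using G(2) g0 by simp
        qed
        show "(\<lambda>s. s \<circ> inv g0) ` {g \<in> G. act g x = y} \<subseteq> {g \<in> G. act g x = x}"
        proof clarify
          fix s assume s: "s \<in> G" "y = act s x"
          then show "s \<circ> inv g0 \<in> G \<and> act (s \<circ> inv g0) x = x"
            unfolding act_comp[OF s(1) G(3)[OF g0(1)] x] s(2)[symmetric]
            using G(2,3) g0 inv_act(1)[OF g0(1) x] by simp
        qed
      qed
      then show ?thesis by (simp add: bij_betw_same_card)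
    qed
    have "card G = (\<Sum>g\<in>G. 1)" by simp
    also have "\<dots> = (\<Sum>y\<in>orb. \<Sum>g | g \<in> G \<and> act g x = y. 1)"
      unfolding orb_def by (rule sum.image_gen[OF \<open>finite G\<close>])
    also have "\<dots> = card orb * card {g \<in> G. act g x = x}" using fib by simp
    finally have card: "card G = card orb * card {g \<in> G. act g x = x}" .
    have "(\<Sum>y\<in>orb. F y) = (\<Sum>y\<in>orb. F x)"
      using F_act x by (intro sum.cong) (auto simp: orb_def)
    then have "(\<Sum>y\<in>orb. F y) = of_nat (card orb) * F x" by simp
    then have "of_nat (card G) dvd (\<Sum>y\<in>orb. F y)"
      using dvd[OF x] unfolding card of_nat_mult by (simp add: mult_dvd_mono)
    moreover have "(\<Sum>x\<in>\<Omega>. F x) = (\<Sum>x\<in>\<Omega> - orb. F x) + (\<Sum>y\<in>orb. F y)"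
      using orb(1) psubset.hyps by (rule sum.subset_diff)
    ultimately show ?thesis using rest by simp
  qed simp
qed

text \<open>\<open>F\<close> is constant on each coset and every coset has as many elements as
  \<open>H\<close>, so neither the choice of representatives nor a division enters.\<close>

lemma sum_right_cosets:
  fixes F :: "(nat \<Rightarrow> nat) \<Rightarrow> 'k::comm_ring_1"
  assumes "H \<subseteq> symgroup d" "perm_group H"
    and F: "\<And>h \<sigma>. h \<in> H \<Longrightarrow> \<sigma> \<in> symgroup d \<Longrightarrow> F (h \<circ> \<sigma>) = F \<sigma>"
  shows "of_nat (card H) * (\<Sum>C\<in>right_cosets H d. F (SOME \<sigma>. \<sigma> \<in> C)) = (\<Sum>\<sigma>\<in>symgroup d. F \<sigma>)"
proof -
  have H: "H \<subseteq> symgroup d" "id \<in> H" "\<And>g h. g \<in> H \<Longrightarrow> h \<in> H \<Longrightarrow> g \<circ> h \<in> H"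
      "\<And>g. g \<in> H \<Longrightarrow> inv g \<in> H"
    using assms(1,2) by (auto simp: perm_group_def)
  let ?c = "\<lambda>\<sigma>. (\<lambda>h. h \<circ> \<sigma>) ` H"
  have fin: "finite (symgroup d)" by (simp add: symgroup_def finite_permutations)
  have fib: "{\<tau> \<in> symgroup d. ?c \<tau> = ?c \<sigma>} = ?c \<sigma>" if "\<sigma> \<in> symgroup d" for \<sigma>
  proof safe
    fix \<tau> assume "\<tau> \<in> symgroup d" "?c \<tau> = ?c \<sigma>"
    moreover have "\<tau> \<in> ?c \<tau>" using imageI[OF H(2), of "\<lambda>h. h \<circ> \<tau>"] by simp
    ultimately show "\<tau> \<in> ?c \<sigma>" by simp
  next
    fix h assume h: "h \<in> H"
    show "h \<circ> \<sigma> \<in> symgroup d"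
      using h H(1) that by (auto simp: symgroup_def intro!: permutes_compose)
    show "g \<circ> (h \<circ> \<sigma>) \<in> ?c \<sigma>" if "g \<in> H" for g
      using H(3)[OF that h] by (auto simp: o_assoc)
    fix g assume g: "g \<in> H"
    have "bij h" using h H(1) by (auto simp: symgroup_def permutes_bij)
    then have "(g \<circ> inv h) \<circ> (h \<circ> \<sigma>) = g \<circ> \<sigma>"
      by (auto simp: fun_eq_iff bij_is_inj)
    then show "g \<circ> \<sigma> \<in> ?c (h \<circ> \<sigma>)" using H(3)[OF g H(4)[OF h]] by (metis image_eqI)
  qed
  have card_c: "card (?c \<sigma>) = card H" if "\<sigma> \<in> symgroup d" for \<sigma>
  proof (rule card_image, rule inj_onI)
    fix g h assume "g \<circ> \<sigma> = h \<circ> \<sigma>"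
    then show "g = h" using that permutes_surj[of \<sigma> "{..<d}"]
      by (auto simp: symgroup_def fun_eq_iff) (metis surjD)
  qed
  have "(\<Sum>\<sigma>\<in>symgroup d. F \<sigma>) = (\<Sum>C\<in>right_cosets H d. \<Sum>\<tau> | \<tau> \<in> symgroup d \<and> ?c \<tau> = C. F \<tau>)"
    unfolding right_cosets_def by (rule sum.image_gen[OF fin])
  also have "\<dots> = (\<Sum>C\<in>right_cosets H d. of_nat (card H) * F (SOME \<sigma>. \<sigma> \<in> C))"
  proof (rule sum.cong[OF refl])
    fix C assume "C \<in> right_cosets H d"
    then obtain \<sigma> where \<sigma>: "\<sigma> \<in> symgroup d" "C = ?c \<sigma>" by (auto simp: right_cosets_def)
    then have "\<sigma> \<in> C" using imageI[OF H(2), of "\<lambda>h. h \<circ> \<sigma>"] by simp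
    then have "(SOME \<sigma>. \<sigma> \<in> C) \<in> C" by (rule someI[of "\<lambda>\<sigma>. \<sigma> \<in> C"])
    then have "F \<tau> = F (SOME \<sigma>. \<sigma> \<in> C)" if "\<tau> \<in> C" for \<tau> using that F \<sigma> by auto
    then show "(\<Sum>\<tau> | \<tau> \<in> symgroup d \<and> ?c \<tau> = C. F \<tau>) = of_nat (card H) * F (SOME \<sigma>. \<sigma> \<in> C)"
      using \<sigma> fib[OF \<sigma>(1)] card_c[OF \<sigma>(1)] by (simp cong: sum.cong)
  qed
  finally show ?thesis by (simp add: sum_distrib_left)
qed

definition restrict_perm :: "'i set \<Rightarrow> ('i \<Rightarrow> 'i) \<Rightarrow> 'i \<Rightarrow> 'i" where
  "restrict_perm S \<sigma> i = (if i \<in> S then \<sigma> i else i)"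

lemma restrict_perm_permutes:
  assumes "\<sigma> permutes A" "S \<subseteq> A" "\<sigma> ` S \<subseteq> S" "finite S"
  shows "restrict_perm S \<sigma> permutes S"
proof (rule bij_imp_permutes)
  have inj: "inj_on \<sigma> S" using assms(1) by (simp add: permutes_inj_on)
  then have "bij_betw \<sigma> S S"
    using assms by (simp add: bij_betw_def endo_inj_surj)
  then show "bij_betw (restrict_perm S \<sigma>) S S"
    by (rule bij_betw_cong[THEN iffD1, rotated]) (simp add: restrict_perm_def)
qed (simp add: restrict_perm_def)

lemma restrict_perm_comp:
  assumes "\<And>k. k \<in> S \<Longrightarrow> \<tau> k \<in> S"
  shows "restrict_perm S (\<sigma> \<circ> \<tau>) = restrict_perm S \<sigma> \<circ> restrict_perm S \<tau>"
  using assms by (auto simp: restrict_perm_def)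

text \<open>The label-preserving permutations form the product of the symmetric groups of the fibres
  of \<open>f\<close>; the induction on the set of labels splits off one fibre at a time.\<close>

lemma card_label_preserving:
  assumes "finite S"
  shows "card {\<sigma>. \<sigma> permutes S \<and> (\<forall>k\<in>S. f (\<sigma> k) = f k)} = (\<Prod>y\<in>f ` S. fact (card {k \<in> S. f k = y}))"
proof -
  have "\<forall>S. finite S \<longrightarrow> f ` S = Y \<longrightarrow>
    card {\<sigma>. \<sigma> permutes S \<and> (\<forall>k\<in>S. f (\<sigma> k) = f k)} = (\<Prod>y\<in>Y. fact (card {k \<in> S. f k = y}))"
    if "finite Y" for Y
    using that
  proof (induction Y)
    case empty
    have "{\<sigma>. \<sigma> permutes {}} = {id :: 'a \<Rightarrow> 'a}" by auto
    then show ?case by simp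
  next
    case (insert y Y)
    show ?case
    proof (intro allI impI)
      fix S assume S: "finite S" "f ` S = insert y Y"
      define P where "P = {k \<in> S. f k = y}"
      define Q where "Q = {k \<in> S. f k \<noteq> y}"
      have PQ: "finite P" "finite Q" "P \<subseteq> S" "Q \<subseteq> S" "P \<inter> Q = {}" "S = P \<union> Q" using S by (auto simp: P_def Q_def)
      have fQ: "f ` Q = Y" using S(2) insert.hyps by (auto simp: Q_def)
      have inP: "\<sigma> k \<in> P \<longleftrightarrow> k \<in> P" if "\<sigma> permutes S" "\<forall>k\<in>S. f (\<sigma> k) = f k" for \<sigma> k
        using that permutes_in_image[OF that(1), of k] by (auto simp: P_def)
      have inQ: "\<sigma> k \<in> Q \<longleftrightarrow> k \<in> Q" if "\<sigma> permutes S" "\<forall>k\<in>S. f (\<sigma> k) = f k" for \<sigma> k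
        using that permutes_in_image[OF that(1), of k] by (auto simp: Q_def)
      \<comment> \<open>Both restrictions are extended by the identity, so composing them recovers
        the permutation.\<close>
      have "bij_betw (\<lambda>\<sigma>. (restrict_perm P \<sigma>, restrict_perm Q \<sigma>))
         {\<sigma>. \<sigma> permutes S \<and> (\<forall>k\<in>S. f (\<sigma> k) = f k)}
         ({\<sigma>. \<sigma> permutes P} \<times> {\<sigma>. \<sigma> permutes Q \<and> (\<forall>k\<in>Q. f (\<sigma> k) = f k)})"
      proof (rule bij_betw_byWitness[where f' = "\<lambda>(\<sigma>, \<tau>). \<sigma> \<circ> \<tau>"], goal_cases)
        case 1
        show ?case
        proof safe
          fix \<sigma> assume \<sigma>: "\<sigma> permutes S" "\<forall>k\<in>S. f (\<sigma> k) = f k"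
          show "restrict_perm P \<sigma> \<circ> restrict_perm Q \<sigma> = \<sigma>"
          proof
            fix k show "(restrict_perm P \<sigma> \<circ> restrict_perm Q \<sigma>) k = \<sigma> k"
              using inP[OF \<sigma>, of k] inQ[OF \<sigma>, of k] PQ permutes_not_in[OF \<sigma>(1), of k]
              by (auto simp: restrict_perm_def)
          qed
        qed
      next
        case 2
        show ?case
        proof clarify
          fix \<sigma> \<tau> assume st: "\<sigma> permutes P" "\<tau> permutes Q"
          have "restrict_perm P (\<sigma> \<circ> \<tau>) k = \<sigma> k" for k
            using PQ(5) permutes_not_in[OF st(1), of k] permutes_not_in[OF st(2), of k]
            by (cases "k \<in> P") (auto simp: restrict_perm_def disjoint_iff)
          moreover have "restrict_perm Q (\<sigma> \<circ> \<tau>) k = \<tau> k" for k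
            using PQ(5) permutes_not_in[OF st(1), of "\<tau> k"] permutes_not_in[OF st(2), of k]
              permutes_in_image[OF st(2), of k]
            by (cases "k \<in> Q") (auto simp: restrict_perm_def disjoint_iff)
          ultimately show "restrict_perm P (\<sigma> \<circ> \<tau>) = \<sigma> \<and> restrict_perm Q (\<sigma> \<circ> \<tau>) = \<tau>" by blast
        qed
      next
        case 3
        show ?case
        proof clarify
          fix \<sigma> assume \<sigma>: "\<sigma> permutes S" "\<forall>k\<in>S. f (\<sigma> k) = f k"
          have "\<sigma> ` P \<subseteq> P" "\<sigma> ` Q \<subseteq> Q" using inP[OF \<sigma>] inQ[OF \<sigma>] by blast+
          then have "restrict_perm P \<sigma> permutes P" "restrict_perm Q \<sigma> permutes Q"
            using restrict_perm_permutes[OF \<sigma>(1)] PQ(1-4) by blast+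
          moreover have "\<forall>k\<in>Q. f (restrict_perm Q \<sigma> k) = f k"
            using \<sigma>(2) PQ(4) by (auto simp: restrict_perm_def)
          ultimately show "restrict_perm P \<sigma> \<in> {\<sigma>. \<sigma> permutes P} \<and>
            restrict_perm Q \<sigma> \<in> {\<sigma>. \<sigma> permutes Q \<and> (\<forall>k\<in>Q. f (\<sigma> k) = f k)}"
            by blast
        qed
      next
        case 4
        show ?case
        proof clarify
          fix \<sigma> \<tau> assume st: "\<sigma> permutes P" "\<tau> permutes Q" "\<forall>k\<in>Q. f (\<tau> k) = f k"
          have "\<sigma> \<circ> \<tau> permutes S"
            using permutes_subset[OF st(1) PQ(3)] permutes_subset[OF st(2) PQ(4)]
            by (rule permutes_compose[rotated])
          moreover have "f ((\<sigma> \<circ> \<tau>) k) = f k" if "k \<in> S" for k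
          proof (cases "k \<in> Q")
            case True
            then have "\<sigma> (\<tau> k) = \<tau> k" using permutes_in_image[OF st(2), of k] PQ(5) permutes_not_in[OF st(1)] by blast
            then show ?thesis using st(3) True by simp
          next
            case False
            then have "k \<in> P" "\<tau> k = k" using that PQ(6) permutes_not_in[OF st(2)] by auto
            then show ?thesis using permutes_in_image[OF st(1), of k] by (auto simp: P_def)
          qed
          ultimately show "\<sigma> \<circ> \<tau> permutes S \<and> (\<forall>k\<in>S. f ((\<sigma> \<circ> \<tau>) k) = f k)" by blast
        qed
      qed
      then have "card {\<sigma>. \<sigma> permutes S \<and> (\<forall>k\<in>S. f (\<sigma> k) = f k)} =
          fact (card P) * (\<Prod>z\<in>Y. fact (card {k \<in> Q. f k = z}))"
        using insert.IH fQ PQ(1,2) by (simp add: bij_betw_same_card card_cartesian_product card_permutations)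
      also have "(\<Prod>z\<in>Y. fact (card {k \<in> Q. f k = z})) = (\<Prod>z\<in>Y. fact (card {k \<in> S. f k = z}) :: nat)"
      proof (rule prod.cong[OF refl])
        fix z assume "z \<in> Y"
        then have "{k \<in> Q. f k = z} = {k \<in> S. f k = z}" using insert.hyps by (auto simp: Q_def)
        then show "fact (card {k \<in> Q. f k = z}) = (fact (card {k \<in> S. f k = z}) :: nat)" by simp
      qed
      finally show "card {\<sigma>. \<sigma> permutes S \<and> (\<forall>k\<in>S. f (\<sigma> k) = f k)} =
          (\<Prod>z\<in>insert y Y. fact (card {k \<in> S. f k = z}))"
        using insert.hyps by (simp add: P_def)
    qed
  qed
  then show ?thesis using assms by blast
qed

text \<open>With \<open>P\<close> selecting the letters over \<open>Bc\<close> this is the group of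
  the overview. It is also used with all letters selected, with the letters over \<open>Ba\<close>,
  and, on words of matrices, with the factors in M_n(\<aa>).\<close>

definition stab_on :: "('x \<Rightarrow> bool) \<Rightarrow> 'x list \<Rightarrow> (nat \<Rightarrow> nat) set" where
  "stab_on P w = {\<sigma>. \<sigma> permutes {k. k < length w \<and> P (w ! k)} \<and> (\<forall>k<length w. w ! \<sigma> k = w ! k)}"

lemma stab_on_permutes: "\<sigma> \<in> stab_on P w \<Longrightarrow> \<sigma> permutes {..<length w}"
  by (auto simp: stab_on_def intro: permutes_subset)

lemma stab_on_nth: "\<sigma> \<in> stab_on P w \<Longrightarrow> k < length w \<Longrightarrow> w ! \<sigma> k = w ! k"
  by (simp add: stab_on_def)

lemma stab_on_moved: "\<sigma> \<in> stab_on P w \<Longrightarrow> \<sigma> k \<noteq> k \<Longrightarrow> k < length w \<and> P (w ! k)"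
  unfolding stab_on_def using permutes_not_in[of \<sigma> _ k] by blast

lemma stab_on_permute_list: "\<sigma> \<in> stab_on P w \<Longrightarrow> permute_list \<sigma> w = w"
  by (intro nth_equalityI) (auto simp: permute_list_nth stab_on_permutes stab_on_nth)

lemma stab_on_lt: "\<sigma> \<in> stab_on P w \<Longrightarrow> \<sigma> k < length w \<longleftrightarrow> k < length w"
  using permutes_in_image[OF stab_on_permutes, of \<sigma> P w k] by simp

lemma stab_on_id: "id \<in> stab_on P w"
  by (simp add: stab_on_def permutes_id)

lemma stab_on_comp:
  assumes "g \<in> stab_on P w" "h \<in> stab_on P w"
  shows "g \<circ> h \<in> stab_on P w"
  using assms stab_on_lt[OF assms(2)] by (auto simp: stab_on_def permutes_compose)

lemma stab_on_inv:
  assumes "g \<in> stab_on P w"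
  shows "inv g \<in> stab_on P w"
proof -
  have "w ! inv g k = w ! k" if "k < length w" for k
    using stab_on_nth[OF assms, of "inv g k"] stab_on_lt[OF assms, of "inv g k"] that
      permutes_inverses[OF stab_on_permutes[OF assms]] by simp
  then show ?thesis using assms by (simp add: stab_on_def permutes_inv)
qed

lemma stab_on_bij: "g \<in> stab_on P w \<Longrightarrow> bij g"
  using stab_on_permutes permutes_bij by blast

lemma finite_stab_on: "finite (stab_on P w)"
  by (rule finite_subset[of _ "{\<sigma>. \<sigma> permutes {..<length w}}"])
    (auto simp: stab_on_permutes finite_permutations)

lemma perm_group_stab_on: "perm_group (stab_on P w)"
  by (simp add: perm_group_def finite_stab_on stab_on_id stab_on_comp stab_on_inv stab_on_bij)

lemma card_stab_on_pos: "card (stab_on P w) \<noteq> 0"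
  using stab_on_id[of P w] finite_stab_on[of P w] by auto

section \<open>Products of factorials of multiplicities\<close>

definition fact_mset :: "'x multiset \<Rightarrow> nat" where
  "fact_mset M = (\<Prod>x\<in>set_mset M. fact (count M x))"

lemma fact_mset_superset:
  assumes "finite S" "set_mset M \<subseteq> S"
  shows "fact_mset M = (\<Prod>x\<in>S. fact (count M x))"
  unfolding fact_mset_def using assms
  by (intro prod.mono_neutral_left) (auto simp: not_in_iff)

lemma fact_mset_add: "fact_mset (add_mset x M) = Suc (count M x) * fact_mset M"
proof -
  let ?S = "insert x (set_mset M)"
  have "fact_mset (add_mset x M) = fact (Suc (count M x)) * (\<Prod>y\<in>?S - {x}. fact (count (add_mset x M) y))"
    by (subst fact_mset_superset[of ?S]) (auto simp: prod.remove[of ?S x])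
  also have "(\<Prod>y\<in>?S - {x}. fact (count (add_mset x M) y)) = (\<Prod>y\<in>?S - {x}. fact (count M y) :: nat)"
    by (intro prod.cong) auto
  also have "fact (Suc (count M x)) * \<dots> = Suc (count M x) * (\<Prod>y\<in>?S. fact (count M y))"
    by (simp add: prod.remove[of ?S x] algebra_simps)
  also have "(\<Prod>y\<in>?S. fact (count M y)) = fact_mset M"
    by (subst fact_mset_superset[of ?S]) auto
  finally show ?thesis .
qed

lemma fact_mset_disjoint_union:
  assumes "set_mset M \<inter> set_mset N = {}"
  shows "fact_mset (M + N) = fact_mset M * fact_mset N"
proof -
  let ?S = "set_mset M \<union> set_mset N"
  have "fact (count (M + N) x) = fact (count M x) * (fact (count N x) :: nat)" for x
    using assms by (cases "x \<in># M") (auto simp: not_in_iff disjoint_iff)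
  then show ?thesis
    by (simp add: fact_mset_superset[of ?S] prod.distrib)
qed

lemma fact_mset_multiplicity_free:
  assumes "\<And>x. count M x \<le> 1"
  shows "fact_mset M = 1"
proof -
  have "fact (count M x) = (1::nat)" for x using assms[of x] by (cases "count M x") auto
  then show ?thesis by (simp add: fact_mset_def)
qed

lemma count_mset_conv_card: "count (mset w) y = card {k. k < length w \<and> w ! k = y}"
  by (simp add: count_mset count_list_eq_length_filter length_filter_conv_card eq_commute)

text \<open>The order depends on the multiset of letters only; it is therefore the same for all
  rearrangements of \<open>w\<close>, which lets divisibility be tested at one word of an
  orbit.\<close>

lemma card_stab_on: "card (stab_on P w) = fact_mset (filter_mset P (mset w))"
proof -
  let ?S = "{k. k < length w \<and> P (w ! k)}"
  have "stab_on P w = {\<sigma>. \<sigma> permutes ?S \<and> (\<forall>k\<in>?S. w ! \<sigma> k = w ! k)}"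
  proof -
    have "w ! \<sigma> k = w ! k" if "\<sigma> permutes ?S" "\<forall>k\<in>?S. w ! \<sigma> k = w ! k" for \<sigma> k
      using that permutes_not_in[OF that(1), of k] by (cases "k \<in> ?S") auto
    then show ?thesis by (auto simp: stab_on_def)
  qed
  then have "card (stab_on P w) = (\<Prod>y\<in>(!) w ` ?S. fact (card {k \<in> ?S. w ! k = y}))"
    by (simp only:) (rule card_label_preserving, simp)
  also have "\<dots> = fact_mset (filter_mset P (mset w))"
    unfolding fact_mset_def
  proof (rule prod.cong)
    show "(!) w ` ?S = set_mset (filter_mset P (mset w))" by (auto simp: in_set_conv_nth)
    fix y assume "y \<in> set_mset (filter_mset P (mset w))"
    then have "{k \<in> ?S. w ! k = y} = {k. k < length w \<and> w ! k = y}" "P y" by auto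
    then show "fact (card {k \<in> ?S. w ! k = y}) = fact (count (filter_mset P (mset w)) y)"
      by (simp add: count_mset_conv_card)
  qed
  finally show ?thesis .
qed

text \<open>Lets a word of labels and the word of the corresponding basis matrices share their
  stabilizers.\<close>

lemma stab_on_map:
  assumes "inj_on f (set w)"
  shows "stab_on P (map f w) = stab_on (\<lambda>x. P (f x)) w"
proof -
  have S: "{k. k < length (map f w) \<and> P (map f w ! k)} = {k. k < length w \<and> P (f (w ! k))}" by auto
  have "map f w ! \<sigma> k = map f w ! k \<longleftrightarrow> w ! \<sigma> k = w ! k"
    if "\<sigma> permutes {k. k < length w \<and> P (f (w ! k))}" "k < length w" for \<sigma> k
  proof -
    have "\<sigma> permutes {..<length w}" using that(1) by (rule permutes_subset) auto
    then have "\<sigma> k < length w" using permutes_in_image[of \<sigma> "{..<length w}" k] that(2) by simp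
    then show ?thesis using that(2) inj_on_eq_iff[OF assms, of "w ! \<sigma> k" "w ! k"] by simp
  qed
  then show ?thesis unfolding stab_on_def S by auto
qed

lemma stab_on_True: "stab_on (\<lambda>_. True) w = {\<sigma>. \<sigma> permutes {..<length w} \<and> permute_list \<sigma> w = w}"
proof -
  have "(\<forall>k<length w. w ! \<sigma> k = w ! k) \<longleftrightarrow> permute_list \<sigma> w = w" if "\<sigma> permutes {..<length w}" for \<sigma>
    using that by (auto simp: list_eq_iff_nth_eq permute_list_nth)
  then show ?thesis by (auto simp: stab_on_def lessThan_def)
qed

section \<open>Shortest coset representatives\<close>

text \<open>The permutation with values \<open>0, ..., k-1, n, k, ..., n-1\<close>: acting on a word
  it moves the last letter to position \<open>k\<close> and keeps the order of the others.\<close>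

definition insert_last :: "nat \<Rightarrow> nat \<Rightarrow> nat \<Rightarrow> nat" where
  "insert_last n k j = (if j < k then j else if j = k then n else if j \<le> n then j - 1 else j)"

lemma insert_last_permutes:
  assumes "k \<le> n"
  shows "insert_last n k permutes {..<n + 1}"
proof (rule bij_imp_permutes)
  have inj: "inj_on (insert_last n k) {..<n + 1}"
    using assms by (auto simp: inj_on_def insert_last_def split: if_splits)
  moreover have "insert_last n k ` {..<n + 1} \<subseteq> {..<n + 1}"
    using assms by (auto simp: insert_last_def)
  ultimately show "bij_betw (insert_last n k) {..<n + 1} {..<n + 1}"
    by (simp add: bij_betw_def endo_inj_surj)
  show "insert_last n k j = j" if "j \<notin> {..<n + 1}" for j
    using that assms by (auto simp: insert_last_def)
qed

lemma permutation_eq_card: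
  fixes \<sigma> :: "nat \<Rightarrow> nat"
  assumes "\<sigma> permutes {..<d}" "i < d"
  shows "\<sigma> i = card {j. j < d \<and> \<sigma> j < \<sigma> i}"
proof -
  have "\<sigma> ` {j. j < d \<and> \<sigma> j < \<sigma> i} = {..<\<sigma> i}"
  proof (intro equalityI subsetI)
    fix m assume "m \<in> {..<\<sigma> i}"
    moreover have "\<sigma> i < d" using permutes_in_image[OF assms(1), of i] assms(2) by simp
    ultimately have m: "m < d" "m < \<sigma> i" by auto
    have "inv \<sigma> m < d" using permutes_in_image[OF permutes_inv[OF assms(1)], of m] m by simp
    then show "m \<in> \<sigma> ` {j. j < d \<and> \<sigma> j < \<sigma> i}"
      using m permutes_inverses(1)[OF assms(1), of m] by (intro image_eqI[of _ _ "inv \<sigma> m"]) auto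
  qed auto
  moreover have "card (\<sigma> ` {j. j < d \<and> \<sigma> j < \<sigma> i}) = card {j. j < d \<and> \<sigma> j < \<sigma> i}"
    by (rule card_image) (use permutes_inj_on[OF assms(1)] in blast)
  ultimately show ?thesis by simp
qed

text \<open>The inversions decide for any two positions which one has the smaller value, and a value
  of a permutation is the number of positions with smaller values.\<close>

lemma permutation_eqI_inversions:
  fixes \<sigma> \<tau> :: "nat \<Rightarrow> nat"
  assumes "\<sigma> permutes {..<d}" "\<tau> permutes {..<d}"
    and inv: "\<And>i j. i < j \<Longrightarrow> j < d \<Longrightarrow> \<sigma> j < \<sigma> i \<longleftrightarrow> \<tau> j < \<tau> i"
  shows "\<sigma> = \<tau>"
proof
  fix i
  show "\<sigma> i = \<tau> i"
  proof (cases "i < d")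
    case True
    have ne: "\<sigma> j \<noteq> \<sigma> i" "\<tau> j \<noteq> \<tau> i" if "j \<noteq> i" for j
      using that permutes_inj[OF assms(1)] permutes_inj[OF assms(2)] by (auto dest: injD)
    have "\<sigma> j < \<sigma> i \<longleftrightarrow> \<tau> j < \<tau> i" if "j < d" for j
    proof (rule linorder_cases[of i j])
      assume "i < j" then show ?thesis using inv that by blast
    next
      assume "j < i" then show ?thesis using inv[OF _ True, of j] ne[of j] by linarith
    qed simp
    then have "{j. j < d \<and> \<sigma> j < \<sigma> i} = {j. j < d \<and> \<tau> j < \<tau> i}" by blast
    then show ?thesis
      using permutation_eq_card[OF assms(1) True] permutation_eq_card[OF assms(2) True] by simp
  next
    case False
    then show ?thesis using permutes_not_in[OF assms(1)] permutes_not_in[OF assms(2)] by simp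
  qed
qed

text \<open>A coset is determined by the position to which its elements carry the last letter. Among
  the permutations with the same such position, the inversions of \<open>insert_last\<close> are
  contained in those of every other one, so it is the unique shortest.\<close>

lemma bij_betw_shortest_reps: "bij_betw (\<lambda>\<sigma>. inv \<sigma> n) (shortest_reps n 1) {..<n + 1}"
proof -
  let ?I = "\<lambda>\<sigma>. {(i, j). i < j \<and> j < n + 1 \<and> \<sigma> i > (\<sigma> j :: nat)}"
  have fin: "finite (?I \<sigma>)" for \<sigma>
    by (rule finite_subset[of _ "{..<n + 1} \<times> {..<n + 1}"]) auto
  have Ic: "?I (insert_last n k) = {(i, j). i = k \<and> k < j \<and> j < n + 1}" if "k \<le> n" for k
    using that by (auto simp: insert_last_def split: if_splits)
  have inv_k: "\<sigma> (inv \<sigma> n) = n" "inv \<sigma> n \<le> n" if "\<sigma> permutes {..<n + 1}" for \<sigma>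
    using permutes_inverses(1)[OF that, of n] permutes_in_image[OF permutes_inv[OF that], of n] by auto
  \<comment> \<open>All values after position \<open>k\<close> are smaller than the maximal value
    \<open>n\<close> taken there, so these inversions are unavoidable.\<close>
  have sub: "?I (insert_last n k) \<subseteq> ?I \<sigma>" if "\<sigma> permutes {..<n + 1}" "\<sigma> k = n" "k \<le> n" for \<sigma> k
  proof -
    have "\<sigma> j < n" if "k < j" "j < n + 1" for j
    proof -
      have "\<sigma> j \<noteq> \<sigma> k" using that permutes_inj[OF \<open>\<sigma> permutes _\<close>] by (auto dest: injD)
      then show ?thesis using permutes_in_image[OF \<open>\<sigma> permutes _\<close>, of j] that \<open>\<sigma> k = n\<close> by simp
    qed
    then show ?thesis unfolding Ic[OF that(3)] using that(2) by auto
  qed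
  have young: "h n = n" if "h \<in> young_subgroup n 1" for h
  proof -
    have p: "h permutes {..<n + 1}" "h ` {..<n} = {..<n}" using that by (auto simp: young_subgroup_def symgroup_def)
    have "h n < n + 1" using permutes_in_image[OF p(1), of n] by simp
    moreover have "h n \<notin> h ` {..<n}" using permutes_inj[OF p(1)] by (auto dest: injD)
    then have "\<not> h n < n" using p(2) by auto
    ultimately show ?thesis by simp
  qed
  have c_inv: "inv (insert_last n k) n = k" if "k \<le> n" for k
    using permutes_inverses(2)[OF insert_last_permutes[OF that], of k] by (simp add: insert_last_def)
  have shortest: "insert_last n k \<in> shortest_reps n 1" if k: "k \<le> n" for k
    unfolding shortest_reps_def perm_length_def
  proof (intro CollectI conjI ballI)
    show "insert_last n k \<in> symgroup (n + 1)" using insert_last_permutes[OF k] by (simp add: symgroup_def)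
    fix h assume h: "h \<in> young_subgroup n 1"
    have "h \<circ> insert_last n k permutes {..<n + 1}"
      using h insert_last_permutes[OF k] by (auto simp: young_subgroup_def symgroup_def intro: permutes_compose)
    moreover have "(h \<circ> insert_last n k) k = n" using young[OF h] by (simp add: insert_last_def)
    ultimately show "card (?I (insert_last n k)) \<le> card (?I (h \<circ> insert_last n k))"
      using sub k by (intro card_mono fin) blast
  qed
  have unique: "\<sigma> = insert_last n (inv \<sigma> n)" if "\<sigma> \<in> shortest_reps n 1" for \<sigma>
  proof -
    have p: "\<sigma> permutes {..<n + 1}" using that by (simp add: shortest_reps_def symgroup_def)
    \<comment> \<open>\<open>?h\<close> is chosen so that \<open>?h \<circ> \<sigma>\<close> is the
      candidate; it fixes \<open>n\<close>, hence belongs to the Young subgroup, and minimality of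
      \<open>\<sigma>\<close> applies to it.\<close>
    let ?k = "inv \<sigma> n" and ?h = "insert_last n (inv \<sigma> n) \<circ> inv \<sigma>"
    note cp = insert_last_permutes[OF inv_k(2)[OF p]]
    have hp: "?h permutes {..<n + 1}" using cp permutes_inv[OF p] by (intro permutes_compose)
    have hn: "?h n = n" by (simp add: insert_last_def)
    have "?h ` {..<n} = {..<n}"
    proof -
      have "{..<n} = {..<n + 1} - {n}" by auto
      then have "?h ` {..<n} = ?h ` {..<n + 1} - ?h ` {n}"
        using image_set_diff[OF permutes_inj[OF hp], of "{..<n + 1}" "{n}"] by simp
      then show ?thesis using permutes_image[OF hp] hn by auto
    qed
    then have "?h \<in> young_subgroup n 1" using hp by (simp add: young_subgroup_def symgroup_def)
    moreover have "?h \<circ> \<sigma> = insert_last n ?k"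
      using permutes_inv_o(2)[OF p] by (simp add: o_assoc[symmetric])
    ultimately have "perm_length (n + 1) \<sigma> \<le> perm_length (n + 1) (insert_last n ?k)"
      using that unfolding shortest_reps_def by (metis (no_types, lifting) mem_Collect_eq)
    then have "card (?I \<sigma>) \<le> card (?I (insert_last n ?k))" unfolding perm_length_def .
    \<comment> \<open>A finite set that contains another one without having more elements is equal
      to it.\<close>
    then have I: "?I (insert_last n ?k) = ?I \<sigma>"
      using sub[OF p inv_k[OF p]] by (intro card_seteq fin)
    show ?thesis
    proof (rule permutation_eqI_inversions[OF p cp])
      fix i j assume "i < j" "j < n + 1"
      then show "\<sigma> j < \<sigma> i \<longleftrightarrow> insert_last n ?k j < insert_last n ?k i"
        using eqset_imp_iff[OF I, of "(i, j)"] by simp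
    qed
  qed
  show ?thesis
  proof (rule bij_betw_byWitness[where f' = "insert_last n"])
    show "\<forall>\<sigma>\<in>shortest_reps n 1. insert_last n (inv \<sigma> n) = \<sigma>" using unique by (metis)
    show "\<forall>k\<in>{..<n + 1}. inv (insert_last n k) n = k" using c_inv by auto
    show "(\<lambda>\<sigma>. inv \<sigma> n) ` shortest_reps n 1 \<subseteq> {..<n + 1}"
      using inv_k(2) by (auto simp: shortest_reps_def symgroup_def less_Suc_eq_le)
    show "insert_last n ` {..<n + 1} \<subseteq> shortest_reps n 1" using shortest by auto
  qed
qed

section \<open>Multilinear functionals on formal combinations of words\<close>

text \<open>The linear extension of a function on words. The quotient by the tensor relations is
  studied through these functionals; those with multilinear \<open>h\<close> descend to it.\<close>

definition lin_eval :: "('x \<Rightarrow> 'k::comm_ring_1) \<Rightarrow> ('x \<Rightarrow>\<^sub>0 'k) \<Rightarrow> 'k" where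
  "lin_eval h p = (\<Sum>x\<in>Poly_Mapping.keys p. Poly_Mapping.lookup p x * h x)"

lemma lin_eval_superset:
  assumes "finite S" "Poly_Mapping.keys p \<subseteq> S"
  shows "lin_eval h p = (\<Sum>x\<in>S. Poly_Mapping.lookup p x * h x)"
  unfolding lin_eval_def using assms by (intro sum.mono_neutral_left) (auto simp: in_keys_iff)

lemma lin_eval_add: "lin_eval h (p + q) = lin_eval h p + lin_eval h q"
proof -
  let ?S = "Poly_Mapping.keys p \<union> Poly_Mapping.keys q"
  have "Poly_Mapping.keys (p + q) \<subseteq> ?S" by (rule Poly_Mapping.keys_add)
  then show ?thesis
    by (simp add: lin_eval_superset[of ?S] lookup_add sum.distrib algebra_simps)
qed

lemma lin_eval_zero [simp]: "lin_eval h 0 = 0" by (simp add: lin_eval_def)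

lemma lin_eval_fscale: "lin_eval h (fscale c p) = c * lin_eval h p"
proof -
  have "Poly_Mapping.keys (fscale c p) \<subseteq> Poly_Mapping.keys p" by (auto simp: in_keys_iff)
  then show ?thesis
    by (simp add: lin_eval_superset[of "Poly_Mapping.keys p"] sum_distrib_left algebra_simps)
qed

lemma lin_eval_uminus: "lin_eval h (- p) = - lin_eval h p"
  by (simp add: lin_eval_def sum_negf)

lemma lin_eval_diff: "lin_eval h (p - q) = lin_eval h p - lin_eval h q"
  using lin_eval_add[of h p "- q"] by (simp add: lin_eval_uminus)

lemma lin_eval_single [simp]: "lin_eval h (Poly_Mapping.single x c) = c * h x"
  by (simp add: lin_eval_superset[of "{x}"])

lemma lin_eval_sum: "lin_eval h (sum f S) = (\<Sum>s\<in>S. lin_eval h (f s))"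
  by (induction S rule: infinite_finite_induct) (simp_all add: lin_eval_add)

lemma lin_eval_lin_ext: "lin_eval h (lin_ext f p) = lin_eval (\<lambda>x. lin_eval h (f x)) p"
  by (simp add: lin_ext_def lin_eval_sum lin_eval_fscale) (simp add: lin_eval_def)

lemma lin_eval_bilin_ext:
  "lin_eval h (bilin_ext f p q) = lin_eval (\<lambda>x. lin_eval (\<lambda>y. lin_eval h (f x y)) q) p"
  by (simp add: bilin_ext_def lin_eval_lin_ext)

lemma lin_eval_mult_left: "lin_eval (\<lambda>x. c * h x) p = c * lin_eval h p"
  by (simp add: lin_eval_def sum_distrib_left algebra_simps)

lemma lin_eval_fun_sum: "lin_eval (\<lambda>x. \<Sum>s\<in>S. h s x) p = (\<Sum>s\<in>S. lin_eval (h s) p)"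
  unfolding lin_eval_def by (simp add: sum_distrib_left) (rule sum.swap)

lemma lookup_lin_ext: "Poly_Mapping.lookup (lin_ext f p) y = lin_eval (\<lambda>x. Poly_Mapping.lookup (f x) y) p"
  by (simp add: lin_ext_def lookup_sum lin_eval_def)

lemma lin_ext_add: "lin_ext f (p + q) = lin_ext f p + lin_ext f q"
  by (intro poly_mapping_eqI) (simp add: lookup_lin_ext lookup_add lin_eval_add)

lemma lin_ext_fscale: "lin_ext f (fscale c p) = fscale c (lin_ext f p)"
  by (intro poly_mapping_eqI) (simp add: lookup_lin_ext lin_eval_fscale)

lemma lin_ext_sum: "lin_ext f (sum g S) = (\<Sum>s\<in>S. lin_ext f (g s))"
  by (intro poly_mapping_eqI) (simp add: lookup_lin_ext lookup_sum lin_eval_sum)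

lemma lin_ext_fun_fscale: "lin_ext (\<lambda>x. fscale c (f x)) p = fscale c (lin_ext f p)"
  by (intro poly_mapping_eqI) (simp add: lookup_lin_ext lin_eval_mult_left)

lemma lin_ext_fun_sum: "lin_ext (\<lambda>x. \<Sum>s\<in>S. f s x) p = (\<Sum>s\<in>S. lin_ext (f s) p)"
  by (intro poly_mapping_eqI) (simp add: lookup_lin_ext lookup_sum lin_eval_fun_sum)

lemma lin_eval_cong:
  "(\<And>x. x \<in> Poly_Mapping.keys p \<Longrightarrow> h x = h' x) \<Longrightarrow> lin_eval h p = lin_eval h' p"
  by (simp add: lin_eval_def)

lemma lin_eval_fun_diff: "lin_eval (\<lambda>x. h x - h' x) p = lin_eval h p - lin_eval h' p"
  by (simp add: lin_eval_def sum_subtractf algebra_simps)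

section \<open>Combinations of words of a fixed length\<close>

definition supported :: "nat \<Rightarrow> ('m list \<Rightarrow>\<^sub>0 'k::comm_ring_1) \<Rightarrow> bool" where
  "supported d p \<longleftrightarrow> (\<forall>xs\<in>Poly_Mapping.keys p. length xs = d)"

lemma supported_zero [simp]: "supported d 0" by (simp add: supported_def)

lemma supported_add [intro]: "supported d p \<Longrightarrow> supported d q \<Longrightarrow> supported d (p + q)"
  using Poly_Mapping.keys_add[of p q] by (auto simp: supported_def)

lemma supported_fscale [intro]: "supported d p \<Longrightarrow> supported d (fscale c p)"
  by (auto simp: supported_def in_keys_iff)

lemma supported_diff [intro]: "supported d p \<Longrightarrow> supported d q \<Longrightarrow> supported d (p - q)"
  using keys_diff[of p q] by (auto simp: supported_def)

lemma supported_single: "length xs = d \<Longrightarrow> supported d (Poly_Mapping.single xs c)"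
  by (auto simp: supported_def)

lemma supported_sum [intro]: "(\<And>x. x \<in> S \<Longrightarrow> supported d (f x)) \<Longrightarrow> supported d (sum f S)"
  by (induction S rule: infinite_finite_induct) auto

lemma supported_lin_ext:
  "(\<And>x. x \<in> Poly_Mapping.keys p \<Longrightarrow> supported d (f x)) \<Longrightarrow> supported d (lin_ext f p)"
  unfolding lin_ext_def by (intro supported_sum supported_fscale)

lemma supported_bilin_ext:
  "(\<And>x y. x \<in> Poly_Mapping.keys p \<Longrightarrow> y \<in> Poly_Mapping.keys q \<Longrightarrow> supported d (f x y)) \<Longrightarrow>
    supported d (bilin_ext f p q)"
  unfolding bilin_ext_def by (intro supported_lin_ext)

definition multilinear :: "('k::comm_ring_1 \<Rightarrow> 'm::ab_group_add \<Rightarrow> 'm) \<Rightarrow> nat \<Rightarrow> ('m list \<Rightarrow> 'k) \<Rightarrow> bool" where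
  "multilinear smul d h \<longleftrightarrow> (\<forall>xs k. length xs = d \<and> k < d \<longrightarrow>
     (\<forall>x y. h (xs[k := x + y]) = h (xs[k := x]) + h (xs[k := y])) \<and>
     (\<forall>c x. h (xs[k := smul c x]) = c * h (xs[k := x])))"

text \<open>Every defining relation of the tensor power is an instance of additivity or homogeneity
  in a single position.\<close>

lemma multilinear_relations:
  assumes h: "multilinear smul d h" and r: "r \<in> formal.span (tensor_relations smul d)"
  shows "lin_eval h r = 0"
  using r
proof (induction rule: formal.span_induct)
  case base
  show ?case
    by (auto simp: formal.subspace_def lin_eval_add lin_eval_fscale)
next
  case (step r)
  have upd: "us @ x # vs = (us @ y # vs)[length us := x]" for us vs and x y :: 'b by simp
  from step show ?case unfolding tensor_relations_def
  proof (elim UnE CollectE exE conjE)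
    fix us x y vs
    assume r: "r = Poly_Mapping.single (us @ (x + y) # vs) 1
        - Poly_Mapping.single (us @ x # vs) 1 - Poly_Mapping.single (us @ y # vs) 1"
      and "length us + 1 + length vs = d"
    then have "h (us @ (x + y) # vs) = h (us @ x # vs) + h (us @ y # vs)"
      using h[unfolded multilinear_def, rule_format, of "us @ x # vs" "length us"] by simp
    then show ?thesis by (simp add: r lin_eval_diff)
  next
    fix us c x vs
    assume r: "r = Poly_Mapping.single (us @ smul c x # vs) 1 - fscale c (Poly_Mapping.single (us @ x # vs) 1)"
      and "length us + 1 + length vs = d"
    then have "h (us @ smul c x # vs) = c * h (us @ x # vs)"
      using h[unfolded multilinear_def, rule_format, of "us @ x # vs" "length us"] by simp
    then show ?thesis by (simp add: r lin_eval_diff lin_eval_fscale)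
  qed
qed

lemma tensor_relation_add:
  "length us + 1 + length vs = d \<Longrightarrow>
    Poly_Mapping.single (us @ (x + y) # vs) 1 - Poly_Mapping.single (us @ x # vs) 1
      - Poly_Mapping.single (us @ y # vs) 1 \<in> tensor_relations smul d"
  unfolding tensor_relations_def by blast

lemma tensor_relation_scale:
  "length us + 1 + length vs = d \<Longrightarrow>
    Poly_Mapping.single (us @ smul c x # vs) 1 - fscale c (Poly_Mapping.single (us @ x # vs) 1)
      \<in> tensor_relations smul d"
  unfolding tensor_relations_def by blast

lemma supported_relations:
  assumes "r \<in> formal.span (tensor_relations smul d)"
  shows "supported d r"
  using assms
proof (induction rule: formal.span_induct)
  case base
  show ?case by (auto simp: formal.subspace_def)
next
  case (step r)
  then show ?case unfolding tensor_relations_def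
    by (auto intro!: supported_diff supported_fscale supported_single)
qed

text \<open>The value 0 on words of other lengths makes the coefficient functions built from it
  vanish outside their own tensor degree.\<close>

definition entry_product :: "nat \<Rightarrow> (nat \<Rightarrow> 'm \<Rightarrow> 'k::comm_ring_1) \<Rightarrow> 'm list \<Rightarrow> 'k" where
  "entry_product d g xs = (if length xs = d then \<Prod>k<d. g k (xs ! k) else 0)"

lemma multilinear_entry_product:
  assumes "\<And>k x y. g k (x + y) = g k x + g k y" "\<And>k c x. g k (smul c x) = c * g k x"
  shows "multilinear smul d (entry_product d g)"
proof -
  have "entry_product d g (xs[k := x]) = g k x * (\<Prod>j\<in>{..<d} - {k}. g j (xs ! j))"
    if "length xs = d" "k < d" for xs k x
  proof -
    have "(\<Prod>j<d. g j (xs[k := x] ! j)) = g k (xs[k := x] ! k) * (\<Prod>j\<in>{..<d} - {k}. g j (xs[k := x] ! j))"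
      using that by (intro prod.remove) auto
    then show ?thesis using that by (simp add: entry_product_def)
  qed
  then show ?thesis using assms by (simp add: multilinear_def algebra_simps)
qed

lemma multilinear_sum:
  "(\<And>s. s \<in> S \<Longrightarrow> multilinear smul d (h s)) \<Longrightarrow> multilinear smul d (\<lambda>xs. \<Sum>s\<in>S. c s * h s xs)"
  by (simp add: multilinear_def sum.distrib algebra_simps sum_distrib_left)

lemma multilinear_mult: "multilinear smul d h \<Longrightarrow> multilinear smul d (\<lambda>xs. c * h xs)"
  by (simp add: multilinear_def algebra_simps)

lemma multilinear_diff:
  "multilinear smul d h \<Longrightarrow> multilinear smul d h' \<Longrightarrow> multilinear smul d (\<lambda>xs. h xs - h' xs)"
  by (simp add: multilinear_def algebra_simps)

lemma multilinear_lin_eval: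
  "(\<And>y. y \<in> Poly_Mapping.keys q \<Longrightarrow> multilinear smul d (\<lambda>xs. h xs y)) \<Longrightarrow> multilinear smul d (\<lambda>xs. lin_eval (h xs) q)"
  unfolding lin_eval_def by (rule multilinear_sum)

lemma permute_list_update:
  assumes "\<sigma> permutes {..<length xs}" "k < length xs"
  shows "permute_list \<sigma> (xs[k := x]) = (permute_list \<sigma> xs)[inv \<sigma> k := x]"
proof (rule nth_equalityI)
  fix i assume "i < length (permute_list \<sigma> (xs[k := x]))"
  then have i: "i < length xs" by simp
  then have "\<sigma> i < length xs" using permutes_in_image[OF assms(1), of i] by simp
  moreover have "inv \<sigma> k = i \<longleftrightarrow> k = \<sigma> i"
    using permutes_inverses[OF assms(1)] by metis
  moreover have "inv \<sigma> k < length xs"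
    using permutes_in_image[OF permutes_inv[OF assms(1)], of k] assms(2) by simp
  ultimately show "permute_list \<sigma> (xs[k := x]) ! i = (permute_list \<sigma> xs)[inv \<sigma> k := x] ! i"
    using i assms by (simp add: permute_list_nth nth_list_update)
qed simp

lemma multilinear_permute:
  assumes "multilinear smul d h" "\<sigma> permutes {..<d}"
  shows "multilinear smul d (\<lambda>xs. h (permute_list \<sigma> xs))"
proof -
  have "inv \<sigma> k < d" if "k < d" for k
    using permutes_in_image[OF permutes_inv[OF assms(2)], of k] that by simp
  then show ?thesis using assms(1) assms(2)
    by (simp add: multilinear_def permute_list_update)
qed

lemma multilinear_has_zero:
  assumes "module smul" "multilinear smul d h" "length xs = d" "k < d" "xs ! k = 0"
  shows "h xs = 0"
proof -
  interpret module smul by fact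
  have "h (xs[k := smul 0 0]) = 0 * h (xs[k := 0])"
    using assms(2-4) unfolding multilinear_def by blast
  moreover have "xs[k := smul 0 0] = xs" using assms(5) by (metis scale_zero_left list_update_id)
  ultimately show ?thesis by simp
qed

lemma multilinear_cong:
  "multilinear smul d h \<Longrightarrow> (\<And>xs. length xs = d \<Longrightarrow> h' xs = h xs) \<Longrightarrow> multilinear smul d h'"
  by (simp add: multilinear_def)

lemma finite_lists_of_length [simp]: "finite {es :: bool list. length es = d}"
  using finite_lists_length_eq[of "UNIV :: bool set" d] by simp

lemma permute_list_inverse:
  assumes "\<sigma> permutes {..<length xs}"
  shows "permute_list \<sigma> (permute_list (inv \<sigma>) xs) = xs" "permute_list (inv \<sigma>) (permute_list \<sigma> xs) = xs"
  using permute_list_compose[OF assms, of "inv \<sigma>"] permute_list_compose[OF permutes_inv[OF assms], of \<sigma>]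
  by (simp_all add: permutes_inv_o[OF assms])

section \<open>Coordinates with respect to an adapted basis\<close>

type_synonym ('k, 'm) combination = "'m list \<Rightarrow>\<^sub>0 'k"
type_synonym ('a, 'n) index = "'a \<times> 'n \<times> 'n"

text \<open>
  The argument \<open>index_type\<close> only fixes the type \<open>'n\<close> of the matrix indices, so that the matrices can
  be interpreted as a module inside the locale.
\<close>

locale adapted_pair = unital_good_pair smul A0 A1 \<aa>
  for smul :: "'k::{idom, ring_char_0} \<Rightarrow> 'a::{ring, monoid_mult} \<Rightarrow> 'a" and A0 A1 \<aa> +
  fixes \<cc> Ba Bc B1 :: "'a set" and index_type :: "'n::finite itself"
  assumes adapted: "adapted_basis \<cc> Ba Bc B1"
begin

abbreviation mscale :: "'k \<Rightarrow> 'a^'n^'n \<Rightarrow> 'a^'n^'n" where "mscale \<equiv> matrix_scale smul"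

abbreviation word :: "('a^'n^'n) list \<Rightarrow> ('k, 'a^'n^'n) combination" where
  "word xs \<equiv> Poly_Mapping.single xs 1"

lemma module_mscale: "module mscale"
  by unfold_locales
    (simp_all add: matrix_scale_def vec_eq_iff scale_right_distrib scale_left_distrib)

sublocale mat: module mscale by (rule module_mscale)

text \<open>In a relation between elements of \<open>S\<close> and \<open>T\<close>, the
  \<open>S\<close>-part is the negative of the remaining part and so lies in both spans.\<close>

lemma independent_Un:
  assumes "independent S" "independent T" "span S \<inter> span T = {0}"
  shows "independent (S \<union> T)"
  unfolding dependent_explicit
proof clarify
  fix t u v
  assume t: "finite t" "t \<subseteq> S \<union> T" "(\<Sum>v\<in>t. smul (u v) v) = 0" "v \<in> t" and nz: "u v \<noteq> 0"
  define x where "x = (\<Sum>v\<in>t \<inter> S. smul (u v) v)"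
  define y where "y = (\<Sum>v\<in>t - S. smul (u v) v)"
  have xy: "x + y = 0"
    using t(1,3) by (simp add: x_def y_def sum.Int_Diff[of t _ S])
  have xS: "x \<in> span S" unfolding x_def
    by (rule span_sum) (auto intro: span_scale span_base)
  have yT: "y \<in> span T" unfolding y_def
    by (rule span_sum) (use t(2) in \<open>auto intro: span_scale span_base\<close>)
  have "x = - y" using xy by (simp add: eq_neg_iff_add_eq_0)
  then have "x \<in> span S \<inter> span T" using xS span_neg[OF yT] by simp
  then have x0: "x = 0" using assms(3) by blast
  then have y0: "y = 0" using xy by simp
  have "u v = 0"
  proof (cases "v \<in> S")
    case True
    then show ?thesis using assms(1) t(1,4) x0 unfolding dependent_explicit x_def by blast
  next
    case False
    have "t - S \<subseteq> T" using t(2) by blast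
    then show ?thesis using assms(2) t(1,4) y0 False unfolding dependent_explicit y_def
      by (metis Diff_iff finite_Diff)
  qed
  then show False using nz by simp
qed

section \<open>The homogeneous basis and coordinates in the algebra\<close>

definition B :: "'a set" where "B = Ba \<union> Bc \<union> B1"

lemma bases: "independent Ba" "span Ba = \<aa>" "independent Bc" "span Bc = \<cc>"
  "independent B1" "span B1 = A1"
  using adapted by (auto simp: adapted_basis_def is_basis_def)

lemma span_even: "span (Ba \<union> Bc) = A0"
  using adapted by (simp add: span_Un bases adapted_basis_def)

lemma independent_even: "independent (Ba \<union> Bc)"
  using adapted by (intro independent_Un) (auto simp: bases adapted_basis_def)

lemma independent_B: "independent B"
  unfolding B_def using A0_Int_A1 by (intro independent_Un independent_even) (simp_all add: span_even bases)

lemma span_B [simp]: "span B = UNIV"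
  unfolding B_def span_Un[of "Ba \<union> Bc"] span_even bases using A0_plus_A1 by fastforce

lemma zero_notin_B: "0 \<notin> B"
  using independent_B dependent_zero by blast

lemma B_disjoint: "Ba \<inter> Bc = {}" "Ba \<inter> B1 = {}" "Bc \<inter> B1 = {}"
proof -
  have "b = 0" if "b \<in> Ba" "b \<in> Bc" for b
    using that span_base[of b Ba] span_base[of b Bc] adapted by (auto simp: bases adapted_basis_def)
  moreover have "b = 0" if "b \<in> Ba \<union> Bc" "b \<in> B1" for b
    using that(2) span_base[OF that(1)] span_base[of b B1] A0_Int_A1 by (auto simp: bases span_even)
  ultimately show "Ba \<inter> Bc = {}" "Ba \<inter> B1 = {}" "Bc \<inter> B1 = {}"
    using zero_notin_B by (auto simp: B_def)
qed

lemma A0_A1_zero: "a \<in> A0 \<Longrightarrow> a \<in> A1 \<Longrightarrow> a = 0"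
  using A0_Int_A1 by blast

lemma B_mem_A0_iff: "b \<in> B \<Longrightarrow> b \<in> A0 \<longleftrightarrow> b \<notin> B1"
  using A0_A1_zero[of b] span_base[of b B1] span_base[of b "Ba \<union> Bc"] zero_notin_B
  by (auto simp: B_def bases span_even)

abbreviation repr :: "'a \<Rightarrow> 'a \<Rightarrow> 'k" where "repr \<equiv> representation B"

lemma repr_add: "repr (x + y) b = repr x b + repr y b"
  by (simp add: representation_add independent_B)

lemma repr_scale: "repr (smul c x) b = c * repr x b"
  by (simp add: representation_scale independent_B)

lemma repr_basis: "b \<in> B \<Longrightarrow> repr b b' = (if b' = b then 1 else 0)"
  by (simp add: representation_basis independent_B)

lemma repr_zero: "repr 0 b = 0"
  by (simp add: representation_zero)

text \<open>Coordinates with respect to the smaller basis \<open>S\<close>, extended by zero, are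
  the coordinates with respect to \<open>B\<close>.\<close>

lemma repr_span:
  assumes "S \<subseteq> B" "a \<in> span S" "repr a b \<noteq> 0"
  shows "b \<in> S"
proof -
  have "representation S a = repr a"
    by (rule representation_extend[OF independent_B assms(2,1), symmetric])
  then show ?thesis using assms(3) representation_ne_zero[of S a b] by simp
qed

lemma repr_parts:
  "a \<in> A0 \<Longrightarrow> repr a b \<noteq> 0 \<Longrightarrow> b \<in> Ba \<union> Bc"
  "a \<in> A1 \<Longrightarrow> repr a b \<noteq> 0 \<Longrightarrow> b \<in> B1"
  "a \<in> \<aa> \<Longrightarrow> repr a b \<noteq> 0 \<Longrightarrow> b \<in> Ba"
  using repr_span[of "Ba \<union> Bc" a b] repr_span[of B1 a b] repr_span[of Ba a b]
  by (auto simp: B_def span_even bases)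

text \<open>Resolves the definite description behind \<open>component\<close>: two candidates for
  the even part of \<open>a\<close> differ by an element that is both even and odd.\<close>

lemma component_False_eqI:
  assumes "u \<in> A0" "v \<in> A1" "a = u + v"
  shows "component False a = u"
proof -
  have "u' = u" if "u' \<in> A0" "a - u' \<in> A1" for u'
  proof -
    have "(a - u') - v = u - u'" using assms(3) by simp
    then have "u - u' \<in> A1"
      using subspace_diff[OF subspace_A1 that(2) assms(2)] by metis
    then have "u - u' = 0" by (rule A0_A1_zero[OF subspace_diff[OF subspace_A0 assms(1) that(1)]])
    then show ?thesis by simp
  qed
  then show ?thesis unfolding component_def using assms by auto
qed

lemma component_True_eqI:
  assumes "u \<in> A0" "v \<in> A1" "a = u + v"
  shows "component True a = v"
proof -
  have "v' = v" if "v' \<in> A1" "a - v' \<in> A0" for v'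
  proof -
    have "(a - v') - u = v - v'" using assms(3) by simp
    then have "v - v' \<in> A0"
      using subspace_diff[OF subspace_A0 that(2) assms(1)] by metis
    then have "v - v' = 0" by (rule A0_A1_zero[OF _ subspace_diff[OF subspace_A1 assms(2) that(1)]])
    then show ?thesis by simp
  qed
  then show ?thesis unfolding component_def using assms by auto
qed

definition part :: "bool \<Rightarrow> 'a set" where "part e = (if e then A1 else A0)"

lemma subspace_part: "subspace (part e)"
  by (simp add: part_def subspace_A0 subspace_A1)

lemma mult_part: "a \<in> part e \<Longrightarrow> b \<in> part f \<Longrightarrow> a * b \<in> part (e \<noteq> f)"
  by (auto simp: part_def mult_A0_A0 mult_A0_A1 mult_A1_A0 mult_A1_A1 split: if_splits)

lemma component_split:
  obtains u v where "u \<in> A0" "v \<in> A1" "a = u + v" "component False a = u" "component True a = v"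
proof -
  from A0_plus_A1[of a] obtain u v where "u \<in> A0" "v \<in> A1" "a = u + v" by blast
  with component_False_eqI component_True_eqI that show ?thesis by blast
qed

lemma component_add: "component e (a + b) = component e a + component e b"
proof -
  obtain u v where a: "u \<in> A0" "v \<in> A1" "a = u + v" "component False a = u" "component True a = v"
    by (rule component_split)
  obtain u' v' where b: "u' \<in> A0" "v' \<in> A1" "b = u' + v'" "component False b = u'" "component True b = v'"
    by (rule component_split)
  have "u + u' \<in> A0" "v + v' \<in> A1" "a + b = (u + u') + (v + v')"
    using a b subspace_add[OF subspace_A0] subspace_add[OF subspace_A1] by auto
  then show ?thesis
    using component_False_eqI component_True_eqI a(4,5) b(4,5) by (cases e) auto
qed

lemma component_scale: "component e (smul c a) = smul c (component e a)"
proof -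
  obtain u v where a: "u \<in> A0" "v \<in> A1" "a = u + v" "component False a = u" "component True a = v"
    by (rule component_split)
  have "smul c u \<in> A0" "smul c v \<in> A1" "smul c a = smul c u + smul c v"
    using a subspace_scale[OF subspace_A0] subspace_scale[OF subspace_A1] by (auto simp: scale_right_distrib)
  then show ?thesis
    using component_False_eqI component_True_eqI a(4,5) by (cases e) auto
qed

lemma component_part:
  assumes "a \<in> part e"
  shows "component f a = (if f = e then a else 0)"
proof (cases e)
  case True
  have "component False a = 0" "component True a = a"
    using component_False_eqI[of 0 a a] component_True_eqI[of 0 a a] assms True subspace_0[OF subspace_A0]
    by (auto simp: part_def)
  then show ?thesis using True by (cases f) auto
next
  case False
  have "component False a = a" "component True a = 0"
    using component_False_eqI[of a 0 a] component_True_eqI[of a 0 a] assms False subspace_0[OF subspace_A1]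
    by (auto simp: part_def)
  then show ?thesis using False by (cases f) auto
qed

section \<open>Homogeneous matrices and matrix multiplication\<close>

definition mpart :: "bool \<Rightarrow> ('a^'n^'n) set" where "mpart e = matrices_over (part e)"

lemma matrix_component_add: "matrix_component e (X + Y) = matrix_component e X + matrix_component e Y"
  by (simp add: matrix_component_def vec_eq_iff component_add)

lemma matrix_component_scale: "matrix_component e (mscale c X) = mscale c (matrix_component e X)"
  by (simp add: matrix_component_def matrix_scale_def vec_eq_iff component_scale)

lemma matrix_component_mpart:
  "X \<in> mpart e \<Longrightarrow> matrix_component f X = (if f = e then X else 0)"
  by (simp add: matrix_component_def mpart_def matrices_over_def vec_eq_iff component_part[of _ e])

lemma matrix_mult_add_left: "matrix_mult (X + Y) Z = matrix_mult X Z + (matrix_mult Y Z :: 'a^'n^'n)"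
  by (simp add: matrix_mult_def vec_eq_iff algebra_simps sum.distrib)

lemma matrix_mult_add_right: "matrix_mult Z (X + Y) = matrix_mult Z X + (matrix_mult Z Y :: 'a^'n^'n)"
  by (simp add: matrix_mult_def vec_eq_iff algebra_simps sum.distrib)

lemma matrix_mult_scale_left: "matrix_mult (mscale c X) Z = mscale c (matrix_mult X Z)"
  by (simp add: matrix_mult_def matrix_scale_def vec_eq_iff scale_mult_left scale_sum_right)

lemma matrix_mult_scale_right: "matrix_mult Z (mscale c X) = mscale c (matrix_mult Z X)"
  by (simp add: matrix_mult_def matrix_scale_def vec_eq_iff scale_mult_right scale_sum_right)

lemma matrix_mult_over:
  assumes "subspace W" "\<And>a b. a \<in> U \<Longrightarrow> b \<in> V \<Longrightarrow> a * b \<in> W"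
    "X \<in> matrices_over U" "Y \<in> matrices_over V"
  shows "matrix_mult X Y \<in> (matrices_over W :: ('a^'n^'n) set)"
  using assms by (auto simp: matrix_mult_def matrices_over_def intro!: subspace_sum)

lemma matrix_mult_mpart:
  "X \<in> mpart e \<Longrightarrow> Y \<in> mpart f \<Longrightarrow> matrix_mult X Y \<in> mpart (e \<noteq> f)"
  unfolding mpart_def using subspace_part mult_part by (rule matrix_mult_over)

lemma matrix_mult_one [simp]:
  "matrix_mult X matrix_one = X" "matrix_mult matrix_one X = (X :: 'a^'n^'n)"
proof -
  have "(\<Sum>t\<in>UNIV. (X $ r $ t) * (if t = s then 1 else 0)) = X $ r $ s" for r s
  proof -
    have "(\<Sum>t\<in>UNIV. (X $ r $ t) * (if t = s then 1 else 0)) = (\<Sum>t\<in>UNIV. if t = s then X $ r $ t else 0)"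
      by (intro sum.cong) auto
    then show ?thesis by simp
  qed
  moreover have "(\<Sum>t\<in>UNIV. (if r = t then 1 else 0) * X $ t $ s) = X $ r $ s" for r s
  proof -
    have "(\<Sum>t\<in>UNIV. (if r = t then 1 else 0) * X $ t $ s) = (\<Sum>t\<in>UNIV. if r = t then X $ t $ s else 0)"
      by (intro sum.cong) auto
    then show ?thesis by simp
  qed
  ultimately show "matrix_mult X matrix_one = X" "matrix_mult matrix_one X = X"
    by (simp_all add: matrix_mult_def matrix_one_def vec_eq_iff)
qed

section \<open>Basis matrices and matrix coordinates\<close>

abbreviation ximat :: "('a, 'n) index \<Rightarrow> 'a^'n^'n" where
  "ximat i \<equiv> xi (fst i) (fst (snd i)) (snd (snd i))"

definition coord :: "('a, 'n) index \<Rightarrow> 'a^'n^'n \<Rightarrow> 'k" where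
  "coord i X = repr (X $ fst (snd i) $ snd (snd i)) (fst i)"

definition labels :: "'a set \<Rightarrow> ('a, 'n) index set" where "labels S = {i. fst i \<in> S}"

abbreviation isodd :: "('a, 'n) index \<Rightarrow> bool" where "isodd i \<equiv> fst i \<in> B1"

abbreviation parity :: "('a, 'n) index list \<Rightarrow> nat \<Rightarrow> bool" where "parity w k \<equiv> isodd (w ! k)"

lemma coord_add: "coord i (X + Y) = coord i X + coord i Y"
  by (simp add: coord_def repr_add)

lemma coord_scale: "coord i (mscale c X) = c * coord i X"
  by (simp add: coord_def matrix_scale_def repr_scale)

lemma coord_zero [simp]: "coord i 0 = 0"
  by (simp add: coord_def repr_zero)

lemma coord_ximat: "j \<in> labels B \<Longrightarrow> coord i (ximat j) = (if i = j then 1 else 0)"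
  by (cases i; cases j) (auto simp: coord_def xi_def labels_def repr_basis repr_zero)

lemma coord_nonzero: "coord i X \<noteq> 0 \<Longrightarrow> i \<in> labels B"
  using representation_ne_zero by (auto simp: coord_def labels_def)

lemma finite_coord: "finite {i. coord i X \<noteq> 0}"
proof -
  have "{i. coord i X \<noteq> 0} \<subseteq> (\<Union>r. \<Union>s. {b. repr (X $ r $ s) b \<noteq> 0}) \<times> UNIV"
    by (auto simp: coord_def) blast
  then show ?thesis by (rule finite_subset) (auto simp: finite_representation)
qed

lemma ximat_inj: "i \<in> labels B \<Longrightarrow> j \<in> labels B \<Longrightarrow> ximat i = ximat j \<Longrightarrow> i = j"
  using coord_ximat[of i i] coord_ximat[of j i] by (metis zero_neq_one)

lemma xi_add: "xi (a + b) r s = xi a r s + (xi b r s :: 'a^'n^'n)"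
  by (simp add: xi_def vec_eq_iff)

lemma xi_scale: "xi (smul c a) r s = mscale c (xi a r s)"
  by (simp add: xi_def matrix_scale_def vec_eq_iff)

lemma matrix_eq_sum_xi: "X = (\<Sum>r\<in>UNIV. \<Sum>s\<in>UNIV. xi (X $ r $ s) r (s::'n))" for X :: "'a^'n^'n"
proof -
  have "(\<Sum>r\<in>UNIV. \<Sum>s\<in>UNIV. (xi (X $ r $ s) r (s::'n) :: 'a^'n^'n) $ i $ j) =
     (\<Sum>r\<in>UNIV. \<Sum>s\<in>UNIV. if s = j then if r = i then X $ r $ s else 0 else 0)" for i j
    unfolding xi_def by (intro sum.cong refl) auto
  then show ?thesis by (simp add: vec_eq_iff)
qed

lemma matrices_over_span: "matrices_over (span S) \<subseteq> mat.span (ximat ` labels S)"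
proof
  fix X :: "'a^'n^'n" assume X: "X \<in> matrices_over (span S)"
  have "xi a r s \<in> mat.span (ximat ` labels S)" if "a \<in> span S" for a r s
    using that
  proof (induction rule: span_induct_alt)
    case base
    have "xi 0 r s = (0 :: 'a^'n^'n)" by (simp add: xi_def vec_eq_iff)
    then show ?case by (simp add: mat.span_zero)
  next
    case (step c x y)
    have "xi x r s \<in> ximat ` labels S" using step.hyps
      by (intro image_eqI[where x = "(x, r, s)"]) (auto simp: labels_def)
    then show ?case unfolding xi_add xi_scale
      using step.IH by (rule mat.span_add[OF mat.span_scale[OF mat.span_base]])
  qed
  then have "(\<Sum>r\<in>UNIV. \<Sum>s\<in>UNIV. xi (X $ r $ s) r s) \<in> mat.span (ximat ` labels S)"
    using X by (intro mat.span_sum) (auto simp: matrices_over_def)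
  then show "X \<in> mat.span (ximat ` labels S)" using matrix_eq_sum_xi by metis
qed

lemma span_ximat [simp]: "mat.span (ximat ` labels B) = UNIV"
  using matrices_over_span[of B] by (auto simp: matrices_over_def)

lemma ximat_mpart: "i \<in> labels B \<Longrightarrow> ximat i \<in> mpart (isodd i)"
  using span_base[of "fst i" B1] span_base[of "fst i" "Ba \<union> Bc"]
    subspace_0[OF subspace_A0] subspace_0[OF subspace_A1]
  by (auto simp: mpart_def matrices_over_def part_def xi_def labels_def B_def bases span_even)

lemma coord_mpart: "X \<in> mpart e \<Longrightarrow> coord i X \<noteq> 0 \<Longrightarrow> isodd i = e"
  using repr_parts[of "X $ fst (snd i) $ snd (snd i)" "fst i"] B_disjoint
  by (auto simp: coord_def mpart_def matrices_over_def part_def split: if_splits)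

text \<open>The functional dual to the tensor of the basis matrices labelled by \<open>w\<close>,
  see \<open>wcoef_ximat\<close>. Its linear extension \<open>coef w\<close> is the value at
  \<open>w\<close> of the function that represents a tensor.\<close>

definition wcoef :: "('a, 'n) index list \<Rightarrow> ('a^'n^'n) list \<Rightarrow> 'k" where
  "wcoef w = entry_product (length w) (\<lambda>k. coord (w ! k))"

definition coef :: "('a, 'n) index list \<Rightarrow> ('k, 'a^'n^'n) combination \<Rightarrow> 'k" where
  "coef w p = lin_eval (wcoef w) p"

definition index_words :: "nat \<Rightarrow> ('a, 'n) index list set" where
  "index_words d = {w. length w = d \<and> set w \<subseteq> labels B}"

lemma multilinear_wcoef: "length w = d \<Longrightarrow> multilinear mscale d (wcoef w)"
  unfolding wcoef_def
  by (auto intro!: multilinear_entry_product simp: coord_add coord_scale)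

lemma wcoef_nonzero: "wcoef w xs \<noteq> 0 \<Longrightarrow> length xs = length w \<and> (\<forall>k<length w. coord (w ! k) (xs ! k) \<noteq> 0)"
  by (auto simp: wcoef_def entry_product_def split: if_splits)

lemma wcoef_ximat:
  assumes "u \<in> index_words d"
  shows "wcoef w (map ximat u) = (if w = u then 1 else 0)"
proof (cases "w = u")
  case True
  have "coord (u ! k) (ximat (u ! k)) = 1" if "k < length u" for k
    using assms that by (subst coord_ximat) (auto simp: index_words_def)
  then show ?thesis using assms True
    by (simp add: wcoef_def entry_product_def index_words_def)
next
  case False
  show ?thesis
  proof (rule ccontr)
    assume "wcoef w (map ximat u) \<noteq> (if w = u then 1 else 0)"
    then have "length u = length w" "\<forall>k<length w. coord (w ! k) (map ximat u ! k) \<noteq> 0"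
      using False wcoef_nonzero[of w "map ximat u"] by auto
    then have "w ! k = u ! k" if "k < length w" for k
    proof -
      have "u ! k \<in> labels B" "coord (w ! k) (ximat (u ! k)) \<noteq> 0"
        using that assms \<open>length u = length w\<close> \<open>\<forall>k<length w. _ k\<close> by (auto simp: index_words_def)
      then show ?thesis by (simp add: coord_ximat split: if_splits)
    qed
    then show False using False \<open>length u = length w\<close> by (simp add: list_eq_iff_nth_eq)
  qed
qed

lemma coef_add: "coef w (p + q) = coef w p + coef w q" by (simp add: coef_def lin_eval_add)
lemma coef_diff: "coef w (p - q) = coef w p - coef w q" by (simp add: coef_def lin_eval_diff)
lemma coef_fscale: "coef w (fscale c p) = c * coef w p" by (simp add: coef_def lin_eval_fscale)
lemma coef_sum: "coef w (sum f S) = (\<Sum>s\<in>S. coef w (f s))" by (simp add: coef_def lin_eval_sum)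
lemma coef_zero [simp]: "coef w 0 = 0" by (simp add: coef_def)
lemma coef_single: "coef w (Poly_Mapping.single xs c) = c * wcoef w xs" by (simp add: coef_def)

definition supp :: "('k, 'a^'n^'n) combination \<Rightarrow> ('a, 'n) index list set" where
  "supp p = {w. coef w p \<noteq> 0}"

lemma coef_nonzero:
  assumes "coef w p \<noteq> 0"
  obtains xs where "xs \<in> Poly_Mapping.keys p" "wcoef w xs \<noteq> 0"
proof -
  have "\<exists>xs\<in>Poly_Mapping.keys p. wcoef w xs \<noteq> 0"
  proof (rule ccontr)
    assume "\<not> ?thesis"
    then have "coef w p = 0" unfolding coef_def lin_eval_def by (intro sum.neutral) auto
    then show False using assms by simp
  qed
  then show ?thesis using that by blast
qed

lemma supp_index_words:
  assumes "supported d p"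
  shows "supp p \<subseteq> index_words d"
proof
  fix w assume "w \<in> supp p"
  then obtain xs where xs: "xs \<in> Poly_Mapping.keys p" "wcoef w xs \<noteq> 0"
    unfolding supp_def by (auto elim: coef_nonzero)
  have "length w = d" using assms xs(1) wcoef_nonzero[OF xs(2)] by (simp add: supported_def)
  moreover have "w ! k \<in> labels B" if "k < length w" for k
    using wcoef_nonzero[OF xs(2)] that by (blast intro: coord_nonzero)
  then have "set w \<subseteq> labels B" by (metis in_set_conv_nth subsetI)
  ultimately show "w \<in> index_words d" by (simp add: index_words_def)
qed

lemma finite_supp: "finite (supp p)"
proof -
  let ?W = "\<lambda>xs. {w. set w \<subseteq> (\<Union>x\<in>set xs. {i. coord i x \<noteq> 0}) \<and> length w = length (xs :: ('a^'n^'n) list)}"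
  have "supp p \<subseteq> (\<Union>xs\<in>Poly_Mapping.keys p. ?W xs)"
  proof
    fix w assume "w \<in> supp p"
    then obtain xs where xs: "xs \<in> Poly_Mapping.keys p" "wcoef w xs \<noteq> 0"
      unfolding supp_def by (auto elim: coef_nonzero)
    have "w \<in> ?W xs" using wcoef_nonzero[OF xs(2)] by (auto simp: set_conv_nth)
    then show "w \<in> (\<Union>xs\<in>Poly_Mapping.keys p. ?W xs)" using xs(1) by blast
  qed
  moreover have "finite (?W xs)" for xs
    by (intro finite_lists_length_eq) (simp add: finite_coord)
  ultimately show ?thesis by (auto intro: finite_subset)
qed

section \<open>The tensor power is free on the basis words\<close>

abbreviation rels :: "nat \<Rightarrow> ('k, 'a^'n^'n) combination set" where
  "rels d \<equiv> tensor_relations mscale d"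

abbreviation bwords :: "nat \<Rightarrow> ('k, 'a^'n^'n) combination set" where
  "bwords d \<equiv> (\<lambda>w. word (map ximat w)) ` index_words d"

text \<open>The factors are expanded one at a time from the left; \<open>w\<close> labels the prefix
  that already consists of basis matrices.\<close>

lemma single_in_span:
  "set w \<subseteq> labels B \<Longrightarrow> length w + length xs = d \<Longrightarrow>
    word (map ximat w @ xs) \<in> formal.span (bwords d \<union> rels d)"
proof (induction xs arbitrary: w)
  case Nil
  then show ?case by (auto intro!: formal.span_base simp: index_words_def)
next
  case (Cons x xs)
  let ?N = "formal.span (bwords d \<union> rels d)"
  let ?s = "\<lambda>x. word (map ximat w @ x # xs)"
  have len: "length (map ximat w) + 1 + length xs = d" using Cons.prems by simp
  have sub: "rels d \<subseteq> ?N" using formal.span_superset by blast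
  have "x \<in> mat.span (ximat ` labels B)" by simp
  then show ?case
  proof (induction rule: mat.span_induct_alt)
    case base
    have "?s (mscale 0 0) - fscale 0 (?s 0) \<in> ?N"
      using tensor_relation_scale[OF len] sub by blast
    then show ?case by simp
  next
    case (step c x y)
    obtain i where i: "i \<in> labels B" "x = ximat i" using step.hyps by blast
    have "?s x \<in> ?N"
      using Cons.IH[of "w @ [i]"] Cons.prems i by simp
    have "?s (mscale c x) - fscale c (?s x) \<in> ?N"
      using tensor_relation_scale[OF len] sub by blast
    from formal.span_add[OF this formal.span_scale[OF \<open>?s x \<in> ?N\<close>, of c]]
    have "?s (mscale c x) \<in> ?N" by (simp only: diff_add_cancel)
    then have sum: "?s (mscale c x) + ?s y \<in> ?N" using step.IH by (rule formal.span_add)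
    have "?s (mscale c x + y) - ?s (mscale c x) - ?s y \<in> ?N"
      using tensor_relation_add[OF len] sub by blast
    then have "(?s (mscale c x + y) - ?s (mscale c x) - ?s y) + (?s (mscale c x) + ?s y) \<in> ?N"
      using sum by (rule formal.span_add)
    then show ?case by (simp add: algebra_simps)
  qed
qed

lemma supported_in_span:
  assumes "supported d p"
  shows "p \<in> formal.span (bwords d \<union> rels d)"
proof -
  have "p = (\<Sum>xs\<in>Poly_Mapping.keys p. fscale (Poly_Mapping.lookup p xs) (word xs))"
  proof (rule poly_mapping_eqI)
    fix xs
    have "Poly_Mapping.lookup (\<Sum>xs\<in>Poly_Mapping.keys p. fscale (Poly_Mapping.lookup p xs) (word xs)) xs
      = (\<Sum>ys\<in>Poly_Mapping.keys p. if ys = xs then Poly_Mapping.lookup p ys else 0)"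
      unfolding lookup_sum by (intro sum.cong) (auto simp: lookup_single when_def)
    then show "Poly_Mapping.lookup p xs =
       Poly_Mapping.lookup (\<Sum>xs\<in>Poly_Mapping.keys p. fscale (Poly_Mapping.lookup p xs) (word xs)) xs"
      by (simp add: in_keys_iff)
  qed
  moreover have "\<dots> \<in> formal.span (bwords d \<union> rels d)"
    using assms single_in_span[of "[]" _ d]
    by (intro formal.span_sum formal.span_scale) (auto simp: supported_def)
  ultimately show ?thesis by simp
qed

text \<open>The difference of the two functionals kills the relations and the basis words, which
  together span. Most formulas for coefficients are reduced to basis words in this way.\<close>

lemma lin_eval_eq_on_basis:
  assumes "multilinear mscale d h" "multilinear mscale d h'" "supported d p"
    "\<And>u. u \<in> index_words d \<Longrightarrow> h (map ximat u) = h' (map ximat u)"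
  shows "lin_eval h p = lin_eval h' p"
proof -
  have "lin_eval (\<lambda>xs. h xs - h' xs) p = 0"
    using supported_in_span[OF assms(3)]
  proof (induction rule: formal.span_induct)
    case base
    show ?case by (auto simp: formal.subspace_def lin_eval_add lin_eval_fscale)
  next
    case (step x)
    then show ?case
      using assms(4) multilinear_relations[OF multilinear_diff[OF assms(1,2)] formal.span_base[of x "rels d"]] by auto
  qed
  then show ?thesis by (simp add: lin_eval_fun_diff)
qed

lemma coef_relations: "r \<in> formal.span (rels d) \<Longrightarrow> coef w r = 0"
proof (cases "length w = d")
  case False
  assume "r \<in> formal.span (rels d)"
  then have "supported d r" by (rule supported_relations)
  then show ?thesis using False supp_index_words[of d r] by (auto simp: supp_def index_words_def)
next
  case True
  assume "r \<in> formal.span (rels d)"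
  then show ?thesis
    unfolding coef_def by (rule multilinear_relations[OF multilinear_wcoef[OF True]])
qed

text \<open>Linear independence of the basis words modulo the relations. Up to relations
  \<open>p\<close> is a combination \<open>q\<close> of basis words; these words are separated by
  the functions \<open>coef\<close>, which vanish on relations, so \<open>q = 0\<close>.\<close>

lemma coef_zero_imp_relation:
  assumes "supported d p" "\<And>w. coef w p = 0"
  shows "p \<in> formal.span (rels d)"
proof -
  from supported_in_span[OF assms(1)] obtain q r
    where qr: "p = q + r" "q \<in> formal.span (bwords d)" "r \<in> formal.span (rels d)"
    unfolding formal.span_Un by blast
  have "coef w q = 0" for w
    using assms(2)[of w] coef_relations[OF qr(3)] by (simp add: qr(1) coef_add)
  \<comment> \<open>On the span of the basis words the formal coefficient of a basis word agrees
    with its multilinear coefficient. Both sides are linear, so this is checked on single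
    words.\<close>
  moreover have lookup: "(\<forall>w\<in>index_words d. Poly_Mapping.lookup q (map ximat w) = coef w q) \<and>
     (\<forall>xs. xs \<notin> map ximat ` index_words d \<longrightarrow> Poly_Mapping.lookup q xs = 0)"
    using qr(2)
  proof (induction rule: formal.span_induct)
    case base
    show ?case by (auto simp: formal.subspace_def lookup_add coef_add coef_fscale)
  next
    case (step x)
    then obtain u where u: "u \<in> index_words d" "x = word (map ximat u)" by blast
    have "map ximat u = map ximat w \<longleftrightarrow> w = u" if "w \<in> index_words d" for w
      using wcoef_ximat[OF that, of w] wcoef_ximat[OF u(1), of w] by (cases "w = u") auto
    then have "\<forall>w\<in>index_words d. Poly_Mapping.lookup x (map ximat w) = coef w x"
      by (simp add: u(2) lookup_single when_def coef_single wcoef_ximat[OF u(1)])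
    moreover have "\<forall>xs. xs \<notin> map ximat ` index_words d \<longrightarrow> Poly_Mapping.lookup x xs = 0"
      using u(1) by (auto simp: u(2) lookup_single when_def)
    ultimately show ?case ..
  qed
  ultimately have "Poly_Mapping.lookup q xs = 0" for xs
    by (cases "xs \<in> map ximat ` index_words d") auto
  then have "q = 0" by (intro poly_mapping_eqI) simp
  then show ?thesis using qr by simp
qed

text \<open>For combinations supported in one degree this is equality in the tensor power, by
  \<open>tensor_class_eq\<close>. Comparing coefficients replaces computations with cosets of the
  relations.\<close>

definition equiv_tensor :: "('k, 'a^'n^'n) combination \<Rightarrow> ('k, 'a^'n^'n) combination \<Rightarrow> bool" (infix "\<simeq>" 50) where
  "p \<simeq> q \<longleftrightarrow> (\<forall>w. coef w p = coef w q)"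

lemma equiv_refl [simp]: "p \<simeq> p" by (simp add: equiv_tensor_def)
lemma equiv_sym: "p \<simeq> q \<Longrightarrow> q \<simeq> p" by (simp add: equiv_tensor_def)
lemma equiv_trans [trans]: "p \<simeq> q \<Longrightarrow> q \<simeq> r \<Longrightarrow> p \<simeq> r" by (simp add: equiv_tensor_def)
lemma equiv_add: "p \<simeq> p' \<Longrightarrow> q \<simeq> q' \<Longrightarrow> p + q \<simeq> p' + q'" by (simp add: equiv_tensor_def coef_add)
lemma equiv_fscale: "p \<simeq> p' \<Longrightarrow> fscale c p \<simeq> fscale c p'" by (simp add: equiv_tensor_def coef_fscale)
lemma equiv_sum: "(\<And>x. x \<in> S \<Longrightarrow> f x \<simeq> g x) \<Longrightarrow> sum f S \<simeq> sum g S"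
  by (simp add: equiv_tensor_def coef_sum)

lemma equiv_cancel: "c \<noteq> 0 \<Longrightarrow> fscale c p \<simeq> fscale c q \<Longrightarrow> p \<simeq> q"
  by (simp add: equiv_tensor_def coef_fscale)

lemma tensor_class_eq:
  assumes "supported d p"
  shows "tensor_class mscale d p = {q. supported d q \<and> q \<simeq> p}"
proof safe
  fix q assume "q \<in> tensor_class mscale d p"
  then have r: "q - p \<in> formal.span (rels d)" by (simp add: tensor_class_def)
  show "supported d q" using supported_add[OF supported_relations[OF r] assms] by simp
  show "q \<simeq> p" using coef_relations[OF r] by (simp add: equiv_tensor_def coef_diff)
next
  fix q assume "supported d q" "q \<simeq> p"
  then show "q \<in> tensor_class mscale d p"
    using assms coef_zero_imp_relation[of d "q - p"]
    by (auto simp: tensor_class_def equiv_tensor_def coef_diff)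
qed

lemma tensor_class_eq_iff:
  assumes "supported d p" "supported d q"
  shows "tensor_class mscale d p = tensor_class mscale d q \<longleftrightarrow> p \<simeq> q"
  using assms by (auto simp: tensor_class_eq equiv_tensor_def)

lemma lin_eval_equiv:
  assumes "multilinear mscale d h" "supported d p" "supported d q" "p \<simeq> q"
  shows "lin_eval h p = lin_eval h q"
proof -
  have "p - q \<in> formal.span (rels d)"
    using assms coef_zero_imp_relation[of d "p - q"] by (auto simp: equiv_tensor_def coef_diff)
  from multilinear_relations[OF assms(1) this] show ?thesis by (simp add: lin_eval_diff)
qed

definition normal_form :: "('k, 'a^'n^'n) combination \<Rightarrow> ('k, 'a^'n^'n) combination" where
  "normal_form p = (\<Sum>u\<in>supp p. fscale (coef u p) (word (map ximat u)))"

lemma supported_normal_form: "supported d p \<Longrightarrow> supported d (normal_form p)"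
  unfolding normal_form_def using supp_index_words[of d p]
  by (auto intro!: supported_sum supported_fscale supported_single simp: index_words_def subset_iff)

lemma normal_form_equiv:
  assumes "supported d p"
  shows "normal_form p \<simeq> p"
  unfolding equiv_tensor_def
proof
  fix w
  have "coef w (normal_form p) = (\<Sum>u\<in>supp p. if u = w then coef u p else 0)"
    unfolding normal_form_def coef_sum using supp_index_words[OF assms]
    by (intro sum.cong refl) (auto simp: coef_fscale coef_single wcoef_ximat subset_iff)
  then show "coef w (normal_form p) = coef w p"
    by (simp add: finite_supp) (simp add: supp_def)
qed

lemma lin_eval_normal_form:
  assumes "multilinear mscale d h" "supported d p"
  shows "lin_eval h p = (\<Sum>u\<in>supp p. coef u p * h (map ximat u))"
proof -
  have "lin_eval h p = lin_eval h (normal_form p)"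
    using assms normal_form_equiv supported_normal_form equiv_sym by (intro lin_eval_equiv) auto
  then show ?thesis by (simp add: normal_form_def lin_eval_sum lin_eval_fscale)
qed

subsection \<open>The action of the symmetric group and the product\<close>

lemma length_components [simp]: "length es = length xs \<Longrightarrow> length (components es xs) = length xs"
  by (simp add: components_def)

lemma nth_components:
  "length es = length xs \<Longrightarrow> k < length xs \<Longrightarrow> components es xs ! k = matrix_component (es ! k) (xs ! k)"
  by (simp add: components_def)

lemma components_update:
  assumes "length es = length xs" "k < length xs"
  shows "components es (xs[k := x]) = (components es xs)[k := matrix_component (es ! k) x]"
  using assms by (intro nth_equalityI) (auto simp: nth_components nth_list_update)

lemma multilinear_components:
  "multilinear mscale d h \<Longrightarrow> length es = d \<Longrightarrow> multilinear mscale d (\<lambda>xs. h (components es xs))"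
  by (simp add: multilinear_def components_update matrix_component_add matrix_component_scale)

text \<open>In a homogeneous word every choice of components other than its own parities produces a
  zero factor, which a multilinear functional kills. The sums over all choices in the action and the
  product thus collapse to one term.\<close>

lemma components_zero:
  assumes "multilinear mscale d h" "length xs = d" "\<And>k. k < d \<Longrightarrow> xs ! k \<in> mpart (a k)"
    "length es = d" "es \<noteq> map a [0..<d]" "\<sigma> permutes {..<d}"
  shows "h (permute_list \<sigma> (components es xs)) = 0"
proof -
  obtain k where k: "k < d" "es ! k \<noteq> a k"
    using assms(4,5) by (auto simp: list_eq_iff_nth_eq)
  then have "components es xs ! k = 0"
    using assms by (simp add: nth_components matrix_component_mpart[OF assms(3)])
  then have "permute_list \<sigma> (components es xs) ! inv \<sigma> k = 0"
    using k(1) assms permutes_in_image[OF permutes_inv[OF assms(6)], of k]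
    by (simp add: permute_list_nth permutes_inverses)
  then show ?thesis
    using k(1) assms permutes_in_image[OF permutes_inv[OF assms(6)], of k]
    by (intro multilinear_has_zero[OF module_mscale assms(1), of _ "inv \<sigma> k"]) auto
qed

lemma components_homogeneous:
  assumes "length xs = d" "\<And>k. k < d \<Longrightarrow> xs ! k \<in> mpart (a k)"
  shows "components (map a [0..<d]) xs = xs"
  using assms by (intro nth_equalityI) (auto simp: nth_components matrix_component_mpart[OF assms(2)])

lemma lin_eval_word_act:
  assumes "length xs = d"
  shows "lin_eval h (word_act \<sigma> xs) =
    (\<Sum>es | length es = d. perm_sign d \<sigma> (\<lambda>k. es ! k) * h (permute_list \<sigma> (components es xs)))"
  unfolding word_act_def lin_eval_sum lin_eval_single assms perm_sign_eq_power ..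

lemma multilinear_word_act:
  assumes "multilinear mscale d h" "\<sigma> permutes {..<d}"
  shows "multilinear mscale d (\<lambda>xs. lin_eval h (word_act \<sigma> xs))"
proof (rule multilinear_cong)
  show "multilinear mscale d (\<lambda>xs. \<Sum>es | length es = d.
      perm_sign d \<sigma> (\<lambda>k. es ! k) * h (permute_list \<sigma> (components es xs)))"
    by (rule multilinear_sum)
      (use multilinear_components[OF multilinear_permute[OF assms]] in blast)
qed (rule lin_eval_word_act)

lemma lin_eval_word_act_homogeneous:
  assumes "multilinear mscale d h" "\<sigma> permutes {..<d}" "length xs = d" "\<And>k. k < d \<Longrightarrow> xs ! k \<in> mpart (a k)"
  shows "lin_eval h (word_act \<sigma> xs) = perm_sign d \<sigma> a * h (permute_list \<sigma> xs)"
proof -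
  have "lin_eval h (word_act \<sigma> xs) =
      (\<Sum>es\<in>{map a [0..<d]}. perm_sign d \<sigma> (\<lambda>k. es ! k) * h (permute_list \<sigma> (components es xs)))"
    unfolding lin_eval_word_act[OF assms(3)]
    using components_zero[OF assms(1,3,4) _ _ assms(2)]
    by (intro sum.mono_neutral_right) auto
  then show ?thesis
    by (simp add: components_homogeneous[OF assms(3,4)] cong: perm_sign_cong)
qed

lemma lin_eval_word_mult:
  assumes "length xs = d" "length ys = d"
  shows "lin_eval h (word_mult xs ys) =
    (\<Sum>es | length es = d. \<Sum>fs | length fs = d. mult_sign d (\<lambda>k. es ! k) (\<lambda>k. fs ! k) *
        h (map2 matrix_mult (components es xs) (components fs ys)))"
  unfolding word_mult_def lin_eval_sum lin_eval_single assms mult_sign_eq_power ..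

lemma multilinear_map2_left:
  assumes "multilinear mscale d h" "length ys = d"
  shows "multilinear mscale d (\<lambda>xs. h (map2 matrix_mult xs ys))"
proof -
  have "map2 matrix_mult (xs[k := x]) ys = (map2 matrix_mult xs ys)[k := matrix_mult x (ys ! k)]"
    if "length xs = d" "k < d" for xs k x
    using that assms(2) by (intro nth_equalityI) (auto simp: nth_list_update)
  then show ?thesis using assms
    by (simp add: multilinear_def matrix_mult_add_left matrix_mult_scale_left)
qed

lemma multilinear_map2_right:
  assumes "multilinear mscale d h" "length xs = d"
  shows "multilinear mscale d (\<lambda>ys. h (map2 matrix_mult xs ys))"
proof -
  have "map2 matrix_mult xs (ys[k := x]) = (map2 matrix_mult xs ys)[k := matrix_mult (xs ! k) x]"
    if "length ys = d" "k < d" for ys k x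
    using that assms(2) by (intro nth_equalityI) (auto simp: nth_list_update)
  then show ?thesis using assms
    by (simp add: multilinear_def matrix_mult_add_right matrix_mult_scale_right)
qed

lemma multilinear_word_mult_left:
  assumes "multilinear mscale d h" "length ys = d"
  shows "multilinear mscale d (\<lambda>xs. lin_eval h (word_mult xs ys))"
proof (rule multilinear_cong)
  have "multilinear mscale d (\<lambda>xs. h (map2 matrix_mult (components es xs) (components fs ys)))"
    if "length es = d" "length fs = d" for es fs
    using multilinear_components[OF multilinear_map2_left[OF assms(1)] that(1), of "components fs ys"]
      that assms(2) by simp
  then show "multilinear mscale d (\<lambda>xs. \<Sum>es | length es = d. 1 * (\<Sum>fs | length fs = d. mult_sign d (\<lambda>k. es ! k) (\<lambda>k. fs ! k) *
        h (map2 matrix_mult (components es xs) (components fs ys))))"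
    by (intro multilinear_sum) auto
qed (simp add: lin_eval_word_mult assms(2))

lemma multilinear_word_mult_right:
  assumes "multilinear mscale d h" "length xs = d"
  shows "multilinear mscale d (\<lambda>ys. lin_eval h (word_mult xs ys))"
proof (rule multilinear_cong)
  have "multilinear mscale d (\<lambda>ys. h (map2 matrix_mult (components es xs) (components fs ys)))"
    if "length es = d" "length fs = d" for es fs
    using multilinear_components[OF multilinear_map2_right[OF assms(1)] that(2), of "components es xs"]
      that assms(2) by simp
  then show "multilinear mscale d (\<lambda>ys. \<Sum>es | length es = d. 1 * (\<Sum>fs | length fs = d. mult_sign d (\<lambda>k. es ! k) (\<lambda>k. fs ! k) *
        h (map2 matrix_mult (components es xs) (components fs ys))))"
    by (intro multilinear_sum) auto
qed (simp add: lin_eval_word_mult assms(2))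

lemma lin_eval_word_mult_homogeneous:
  assumes h: "multilinear mscale d h" and xs: "length xs = d" "\<And>k. k < d \<Longrightarrow> xs ! k \<in> mpart (a k)"
    and ys: "length ys = d" "\<And>k. k < d \<Longrightarrow> ys ! k \<in> mpart (b k)"
  shows "lin_eval h (word_mult xs ys) = mult_sign d a b * h (map2 matrix_mult xs ys)"
proof -
  let ?f = "\<lambda>es fs. mult_sign d (\<lambda>k. es ! k) (\<lambda>k. fs ! k) * h (map2 matrix_mult (components es xs) (components fs ys))"
  have id: "id permutes {..<d}" by (simp add: permutes_id)
  have inner: "(\<Sum>fs | length fs = d. ?f es fs) = ?f es (map b [0..<d])" if "length es = d" for es
  proof -
    have "multilinear mscale d (\<lambda>ys. h (map2 matrix_mult (components es xs) ys))"
      using h that xs(1) by (intro multilinear_map2_right) auto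
    from components_zero[OF this ys _ _ id]
    have "(\<Sum>fs | length fs = d. ?f es fs) = (\<Sum>fs\<in>{map b [0..<d]}. ?f es fs)"
      by (intro sum.mono_neutral_right) auto
    then show ?thesis by simp
  qed
  have "multilinear mscale d (\<lambda>xs. h (map2 matrix_mult xs ys))"
    using h ys(1) by (intro multilinear_map2_left) auto
  from components_zero[OF this xs _ _ id]
  have "(\<Sum>es | length es = d. ?f es (map b [0..<d])) = (\<Sum>es\<in>{map a [0..<d]}. ?f es (map b [0..<d]))"
    by (intro sum.mono_neutral_right) (auto simp: components_homogeneous[OF ys])
  then show ?thesis
    by (simp add: lin_eval_word_mult[OF xs(1) ys(1)] inner components_homogeneous[OF ys] components_homogeneous[OF xs]
        cong: mult_sign_cong)
qed

text \<open>The operations are first treated on representatives; their compatibility with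
  \<open>\<simeq>\<close> is proved in \<open>act_cong\<close> and \<open>mul_cong\<close>, and
  tensors return only with \<open>cls\<close>.\<close>

definition act :: "(nat \<Rightarrow> nat) \<Rightarrow> ('k, 'a^'n^'n) combination \<Rightarrow> ('k, 'a^'n^'n) combination" where
  "act \<sigma> p = lin_ext (word_act \<sigma>) p"

definition mul :: "('k, 'a^'n^'n) combination \<Rightarrow> ('k, 'a^'n^'n) combination \<Rightarrow> ('k, 'a^'n^'n) combination" where
  "mul p q = bilin_ext word_mult p q"

lemma supported_word_act: "length xs = d \<Longrightarrow> supported d (word_act \<sigma> xs)"
  unfolding word_act_def by (auto intro!: supported_sum supported_single)

lemma supported_word_mult: "length xs = d \<Longrightarrow> length ys = d \<Longrightarrow> supported d (word_mult xs ys)"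
  unfolding word_mult_def by (auto intro!: supported_sum supported_single)

lemma supported_act [intro]: "supported d p \<Longrightarrow> supported d (act \<sigma> p)"
  unfolding act_def by (auto intro!: supported_lin_ext supported_word_act simp: supported_def[of d p])

lemma supported_mul [intro]: "supported d p \<Longrightarrow> supported d q \<Longrightarrow> supported d (mul p q)"
  unfolding mul_def
  by (auto intro!: supported_bilin_ext supported_word_mult simp: supported_def[of d p] supported_def[of d q])

lemma coef_wrong_length: "supported d p \<Longrightarrow> length w \<noteq> d \<Longrightarrow> coef w p = 0"
  using supp_index_words[of d p] by (auto simp: supp_def index_words_def)

lemma equivI: "supported d p \<Longrightarrow> supported d q \<Longrightarrow> (\<And>w. length w = d \<Longrightarrow> coef w p = coef w q) \<Longrightarrow> p \<simeq> q"
  unfolding equiv_tensor_def by (metis coef_wrong_length)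

lemma index_word_mpart: "w \<in> index_words d \<Longrightarrow> k < d \<Longrightarrow> map ximat w ! k \<in> mpart (isodd (w ! k))"
  using ximat_mpart[of "w ! k"] subsetD[OF _ nth_mem[of k w]] by (auto simp: index_words_def)

lemma permute_index_words [simp]:
  "\<sigma> permutes {..<d} \<Longrightarrow> w \<in> index_words d \<Longrightarrow> permute_list \<sigma> w \<in> index_words d"
  by (simp add: index_words_def)

lemma permute_list_eq_iff:
  assumes "\<sigma> permutes {..<d}" "length u = d" "length w = d"
  shows "permute_list \<sigma> u = permute_list \<sigma> w \<longleftrightarrow> u = w"
proof
  assume "permute_list \<sigma> u = permute_list \<sigma> w"
  then have "permute_list (inv \<sigma>) (permute_list \<sigma> u) = permute_list (inv \<sigma>) (permute_list \<sigma> w)" by simp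
  then show "u = w" using assms by (simp add: permute_list_inverse)
qed simp

text \<open>Both sides are multilinear in the word, so it suffices to compare them on basis words,
  where the action permutes the letters up to the sign of the homogeneous case.\<close>

lemma coef_act:
  assumes "supported d p" "\<sigma> permutes {..<d}" "length w = d"
  shows "coef (permute_list \<sigma> w) (act \<sigma> p) = perm_sign d \<sigma> (parity w) * coef w p"
proof -
  have m: "multilinear mscale d (wcoef (permute_list \<sigma> w))"
    using assms(3) by (intro multilinear_wcoef) simp
  have "lin_eval (\<lambda>xs. lin_eval (wcoef (permute_list \<sigma> w)) (word_act \<sigma> xs)) p =
      lin_eval (\<lambda>xs. perm_sign d \<sigma> (parity w) * wcoef w xs) p"
  proof (rule lin_eval_eq_on_basis[OF multilinear_word_act[OF m assms(2)] multilinear_mult[OF multilinear_wcoef[OF assms(3)]] assms(1)])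
    fix u assume u: "u \<in> index_words d"
    then have l: "length u = d" by (simp add: index_words_def)
    have "lin_eval (wcoef (permute_list \<sigma> w)) (word_act \<sigma> (map ximat u)) =
      perm_sign d \<sigma> (parity u) * wcoef (permute_list \<sigma> w) (permute_list \<sigma> (map ximat u))"
      using l index_word_mpart[OF u] by (intro lin_eval_word_act_homogeneous[OF m assms(2)]) auto
    also have "permute_list \<sigma> (map ximat u) = map ximat (permute_list \<sigma> u)"
      using assms(2) l by (simp add: permute_list_map)
    finally show "lin_eval (wcoef (permute_list \<sigma> w)) (word_act \<sigma> (map ximat u)) =
        perm_sign d \<sigma> (parity w) * wcoef w (map ximat u)"
      using permute_list_eq_iff[OF assms(2,3) l]
      by (auto simp: wcoef_ximat[OF u] wcoef_ximat[OF permute_index_words[OF assms(2) u]])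
  qed
  then show ?thesis
    unfolding coef_def act_def lin_eval_lin_ext lin_eval_mult_left .
qed

text \<open>The structure constants of the tensor power with respect to the basis words, including
  the sign of the super product.\<close>

definition mult_coef :: "nat \<Rightarrow> ('a, 'n) index list \<Rightarrow> ('a, 'n) index list \<Rightarrow> ('a, 'n) index list \<Rightarrow> 'k" where
  "mult_coef d u v w = mult_sign d (parity u) (parity v) *
     wcoef w (map2 matrix_mult (map ximat u) (map ximat v))"

lemma coef_mul:
  assumes "supported d p" "supported d q" "length w = d"
  shows "coef w (mul p q) = (\<Sum>u\<in>supp p. \<Sum>v\<in>supp q. coef u p * coef v q * mult_coef d u v w)"
proof -
  note m = multilinear_wcoef[OF assms(3)]
  have keys: "length y = d" if "y \<in> Poly_Mapping.keys q" for y
    using assms(2) that by (simp add: supported_def)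
  have "coef w (mul p q) = lin_eval (\<lambda>xs. lin_eval (\<lambda>ys. lin_eval (wcoef w) (word_mult xs ys)) q) p"
    by (simp add: coef_def mul_def lin_eval_bilin_ext)
  also have "\<dots> = (\<Sum>u\<in>supp p. coef u p * lin_eval (\<lambda>ys. lin_eval (wcoef w) (word_mult (map ximat u) ys)) q)"
    by (intro lin_eval_normal_form[OF _ assms(1)] multilinear_lin_eval multilinear_word_mult_left m keys)
  also have "\<dots> = (\<Sum>u\<in>supp p. \<Sum>v\<in>supp q. coef u p * coef v q * mult_coef d u v w)"
  proof (rule sum.cong[OF refl])
    fix u assume "u \<in> supp p"
    then have u: "u \<in> index_words d" using supp_index_words[OF assms(1)] by blast
    then have lu: "length u = d" by (simp add: index_words_def)
    have "lin_eval (\<lambda>ys. lin_eval (wcoef w) (word_mult (map ximat u) ys)) q =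
        (\<Sum>v\<in>supp q. coef v q * lin_eval (wcoef w) (word_mult (map ximat u) (map ximat v)))"
      by (intro lin_eval_normal_form[OF _ assms(2)] multilinear_word_mult_right m) (simp add: lu)
    also have "\<dots> = (\<Sum>v\<in>supp q. coef v q * mult_coef d u v w)"
    proof (rule sum.cong[OF refl])
      fix v assume "v \<in> supp q"
      then have v: "v \<in> index_words d" using supp_index_words[OF assms(2)] by blast
      then have lv: "length v = d" by (simp add: index_words_def)
      show "coef v q * lin_eval (wcoef w) (word_mult (map ximat u) (map ximat v)) = coef v q * mult_coef d u v w"
        unfolding mult_coef_def
        using lu lv index_word_mpart[OF u] index_word_mpart[OF v]
        by (subst lin_eval_word_mult_homogeneous[OF m, where a = "\<lambda>k. isodd (u ! k)" and b = "\<lambda>k. isodd (v ! k)"]) auto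
    qed
    finally show "coef u p * lin_eval (\<lambda>ys. lin_eval (wcoef w) (word_mult (map ximat u) ys)) q =
        (\<Sum>v\<in>supp q. coef u p * coef v q * mult_coef d u v w)"
      by (simp add: sum_distrib_left algebra_simps)
  qed
  finally show ?thesis .
qed

lemma mul_cong:
  assumes "supported d p" "supported d p'" "supported d q" "supported d q'" "p \<simeq> p'" "q \<simeq> q'"
  shows "mul p q \<simeq> mul p' q'"
proof (rule equivI)
  have "supp p = supp p'" "supp q = supp q'" using assms(5,6) by (auto simp: supp_def equiv_tensor_def)
  then show "coef w (mul p q) = coef w (mul p' q')" if "length w = d" for w
    using assms that by (simp add: coef_mul equiv_tensor_def)
qed (use assms in auto)

lemma act_cong:
  assumes "supported d p" "supported d p'" "\<sigma> permutes {..<d}" "p \<simeq> p'"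
  shows "act \<sigma> p \<simeq> act \<sigma> p'"
proof (rule equivI)
  show "coef w (act \<sigma> p) = coef w (act \<sigma> p')" if "length w = d" for w
    using assms that coef_act[of d _ \<sigma> "permute_list (inv \<sigma>) w"]
    by (simp add: permute_list_inverse equiv_tensor_def)
qed (use assms in auto)

lemma mul_fscale_right: "mul p (fscale c q) = fscale c (mul p q)"
  by (simp add: mul_def bilin_ext_def lin_ext_fscale lin_ext_fun_fscale)

lemma mul_sum_right: "mul p (sum f S) = (\<Sum>s\<in>S. mul p (f s))"
  by (simp add: mul_def bilin_ext_def lin_ext_sum lin_ext_fun_sum)

lemma mul_sum_left: "mul (sum f S) p = (\<Sum>s\<in>S. mul (f s) p)"
  by (simp add: mul_def bilin_ext_def lin_ext_sum)

lemma act_fscale: "act \<sigma> (fscale c p) = fscale c (act \<sigma> p)"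
  by (simp add: act_def lin_ext_fscale)

lemma act_sum: "act \<sigma> (sum f S) = (\<Sum>s\<in>S. act \<sigma> (f s))"
  by (simp add: act_def lin_ext_sum)

lemma supp_act:
  assumes "supported d p" "\<sigma> permutes {..<d}"
  shows "supp (act \<sigma> p) = permute_list \<sigma> ` supp p"
proof -
  have nz: "coef (permute_list \<sigma> w) (act \<sigma> p) \<noteq> 0 \<longleftrightarrow> coef w p \<noteq> 0" if "length w = d" for w
  proof -
    have "perm_sign d \<sigma> (parity w) \<noteq> (0::'k)"
      using perm_sign_square[of d \<sigma> "\<lambda>k. isodd (w ! k)", where 'k = 'k] by auto
    then show ?thesis by (simp add: coef_act[OF assms that])
  qed
  have len: "length w = d" if "w \<in> supp q" "supported d q" for w q
    using that supp_index_words[of d q] by (auto simp: index_words_def)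
  show ?thesis
  proof (intro equalityI subsetI)
    fix w assume w: "w \<in> supp (act \<sigma> p)"
    then have l: "length w = d" using len assms by blast
    have "permute_list (inv \<sigma>) w \<in> supp p"
      using w nz[of "permute_list (inv \<sigma>) w"] l assms(2) by (simp add: supp_def permute_list_inverse)
    then show "w \<in> permute_list \<sigma> ` supp p"
      using l assms(2) by (metis image_eqI permute_list_inverse(1))
  next
    fix w assume "w \<in> permute_list \<sigma> ` supp p"
    then show "w \<in> supp (act \<sigma> p)" using nz len assms(1) by (auto simp: supp_def)
  qed
qed

lemma wcoef_permute:
  assumes "\<sigma> permutes {..<d}" "length w = d" "length xs = d"
  shows "wcoef (permute_list \<sigma> w) (permute_list \<sigma> xs) = wcoef w xs"
proof -
  have "(\<Prod>k<d. coord (permute_list \<sigma> w ! k) (permute_list \<sigma> xs ! k)) = (\<Prod>k<d. coord (w ! \<sigma> k) (xs ! \<sigma> k))"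
    using assms by (intro prod.cong) (auto simp: permute_list_nth)
  also have "\<dots> = (\<Prod>k<d. coord (w ! k) (xs ! k))"
    using prod.permute[OF assms(1), of "\<lambda>k. coord (w ! k) (xs ! k)"] by (simp add: o_def)
  finally show ?thesis using assms by (simp add: wcoef_def entry_product_def)
qed

text \<open>A product of homogeneous matrices is homogeneous, so a basis matrix occurring in it has
  the sum of the two parities.\<close>

lemma wcoef_mult_parity:
  assumes "u \<in> index_words d" "v \<in> index_words d" "length w = d"
    "wcoef w (map2 matrix_mult (map ximat u) (map ximat v)) \<noteq> 0" "k < d"
  shows "isodd (w ! k) = (isodd (u ! k) \<noteq> isodd (v ! k))"
proof (rule coord_mpart)
  have l: "length u = d" "length v = d" using assms by (auto simp: index_words_def)
  then show "matrix_mult (ximat (u ! k)) (ximat (v ! k)) \<in> mpart (isodd (u ! k) \<noteq> isodd (v ! k))"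
    using index_word_mpart[OF assms(1,5)] index_word_mpart[OF assms(2,5)] assms(5)
    by (intro matrix_mult_mpart) auto
  show "coord (w ! k) (matrix_mult (ximat (u ! k)) (ximat (v ! k))) \<noteq> 0"
    using wcoef_nonzero[OF assms(4)] assms(3,5) l by auto
qed

text \<open>Equivariance of the structure constants. It gives \<open>act_mul\<close>, and it shows
  that the summands of a coefficient of a product are constant on orbits.\<close>

lemma mult_coef_permute:
  assumes "\<sigma> permutes {..<d}" "u \<in> index_words d" "v \<in> index_words d" "length w = d"
  shows "perm_sign d \<sigma> (parity u) * perm_sign d \<sigma> (parity v) *
      mult_coef d (permute_list \<sigma> u) (permute_list \<sigma> v) (permute_list \<sigma> w) =
    perm_sign d \<sigma> (parity w) * mult_coef d u v w"
proof -
  have l: "length u = d" "length v = d" using assms by (auto simp: index_words_def)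
  let ?P = "map2 matrix_mult (map ximat u) (map ximat v)"
  have P: "map2 matrix_mult (map ximat (permute_list \<sigma> u)) (map ximat (permute_list \<sigma> v)) = permute_list \<sigma> ?P"
    using assms(1) l permutes_in_image[OF assms(1)]
    by (intro nth_equalityI) (auto simp: permute_list_nth)
  have W: "wcoef (permute_list \<sigma> w) (permute_list \<sigma> ?P) = wcoef w ?P"
    using assms l by (intro wcoef_permute) auto
  have S: "mult_sign d (\<lambda>k. isodd (permute_list \<sigma> u ! k)) (\<lambda>k. isodd (permute_list \<sigma> v ! k)) =
      mult_sign d (\<lambda>k. isodd (u ! \<sigma> k)) (\<lambda>k. isodd (v ! \<sigma> k))"
    using assms l by (intro mult_sign_cong) (auto simp: permute_list_nth)
  show ?thesis
  proof (cases "wcoef w ?P = 0")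
    case True
    then show ?thesis by (simp add: mult_coef_def P W)
  next
    case False
    \<comment> \<open>Since \<open>w\<close> occurs in the product of \<open>u\<close> and
      \<open>v\<close>, its parities are determined by theirs and \<open>mult_sign_permute\<close>
      becomes applicable.\<close>
    have E: "perm_sign d \<sigma> (parity w) = (perm_sign d \<sigma> (\<lambda>k. isodd (u ! k) \<noteq> isodd (v ! k)) :: 'k)"
      using wcoef_mult_parity[OF assms(2-4) False] by (intro perm_sign_cong)
    show ?thesis
      unfolding mult_coef_def P W S E
      using mult_sign_permute[OF assms(1), of "\<lambda>k. isodd (u ! k)" "\<lambda>k. isodd (v ! k)", where 'k = 'k]
      by (simp add: algebra_simps)
  qed
qed

lemma act_mul:
  assumes "supported d p" "supported d q" "\<sigma> permutes {..<d}"
  shows "act \<sigma> (mul p q) \<simeq> mul (act \<sigma> p) (act \<sigma> q)"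
proof (rule equivI)
  fix w' :: "('a, 'n) index list" assume w': "length w' = d"
  define w where "w = permute_list (inv \<sigma>) w'"
  have w: "length w = d" "w' = permute_list \<sigma> w"
    using w' assms(3) by (simp_all add: w_def permute_list_inverse)
  have idx: "u \<in> index_words d" if "u \<in> supp p \<or> u \<in> supp q" for u
    using that supp_index_words assms by blast
  have inj: "inj_on (permute_list \<sigma>) (supp p)" "inj_on (permute_list \<sigma>) (supp q)"
    using idx permute_list_eq_iff[OF assms(3)] by (auto intro!: inj_onI simp: index_words_def)
  have "coef w' (mul (act \<sigma> p) (act \<sigma> q)) =
     (\<Sum>u\<in>supp p. \<Sum>v\<in>supp q. coef (permute_list \<sigma> u) (act \<sigma> p) * coef (permute_list \<sigma> v) (act \<sigma> q) *
        mult_coef d (permute_list \<sigma> u) (permute_list \<sigma> v) w')"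
    unfolding coef_mul[OF supported_act[OF assms(1)] supported_act[OF assms(2)] w']
      supp_act[OF assms(1,3)] supp_act[OF assms(2,3)]
    by (simp add: sum.reindex[OF inj(1)] sum.reindex[OF inj(2)])
  also have "\<dots> = (\<Sum>u\<in>supp p. \<Sum>v\<in>supp q. perm_sign d \<sigma> (parity w) * (coef u p * coef v q * mult_coef d u v w))"
  proof (intro sum.cong refl)
    fix u v assume "u \<in> supp p" "v \<in> supp q"
    then have uv: "u \<in> index_words d" "v \<in> index_words d" using idx by auto
    then have l: "length u = d" "length v = d" by (auto simp: index_words_def)
    show "coef (permute_list \<sigma> u) (act \<sigma> p) * coef (permute_list \<sigma> v) (act \<sigma> q) *
        mult_coef d (permute_list \<sigma> u) (permute_list \<sigma> v) w' =
        perm_sign d \<sigma> (parity w) * (coef u p * coef v q * mult_coef d u v w)"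
      unfolding coef_act[OF assms(1,3) l(1)] coef_act[OF assms(2,3) l(2)] w(2)
      using arg_cong[OF mult_coef_permute[OF assms(3) uv w(1)], of "\<lambda>x. x * (coef u p * coef v q)"]
      by (simp only: ac_simps)
  qed
  also have "\<dots> = coef w' (act \<sigma> (mul p q))"
    unfolding w(2) coef_act[OF supported_mul[OF assms(1,2)] assms(3) w(1)] coef_mul[OF assms(1,2) w(1)]
    by (simp add: sum_distrib_left)
  finally show "coef w' (act \<sigma> (mul p q)) = coef w' (mul (act \<sigma> p) (act \<sigma> q))" ..
qed (use assms in auto)

lemma act_compose:
  assumes "supported d p" "\<sigma> permutes {..<d}" "\<tau> permutes {..<d}"
  shows "act \<tau> (act \<sigma> p) \<simeq> act (\<sigma> \<circ> \<tau>) p"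
proof (rule equivI)
  fix w' :: "('a, 'n) index list" assume w': "length w' = d"
  have st: "\<sigma> \<circ> \<tau> permutes {..<d}" using assms by (intro permutes_compose)
  define w where "w = permute_list (inv (\<sigma> \<circ> \<tau>)) w'"
  have w: "length w = d" "w' = permute_list (\<sigma> \<circ> \<tau>) w"
    using w' st by (simp_all add: w_def permute_list_inverse)
  have w2: "w' = permute_list \<tau> (permute_list \<sigma> w)"
    using w assms by (simp add: permute_list_compose)
  have "perm_sign d \<tau> (\<lambda>k. isodd (permute_list \<sigma> w ! k)) = (perm_sign d \<tau> (\<lambda>k. isodd (w ! \<sigma> k)) :: 'k)"
    using w(1) assms(2) by (intro perm_sign_cong) (auto simp: permute_list_nth)
  then have "coef w' (act \<tau> (act \<sigma> p)) =
      perm_sign d \<sigma> (parity w) * perm_sign d \<tau> (\<lambda>k. isodd (w ! \<sigma> k)) * coef w p"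
    unfolding w2 using w(1) assms by (simp add: coef_act[OF supported_act] coef_act)
  also have "\<dots> = coef w' (act (\<sigma> \<circ> \<tau>) p)"
    unfolding w(2) coef_act[OF assms(1) st w(1)] perm_sign_comp[OF assms(2,3)] by simp
  finally show "coef w' (act \<tau> (act \<sigma> p)) = coef w' (act (\<sigma> \<circ> \<tau>) p)" .
qed (use assms in auto)

lemma act_id:
  assumes "supported d p"
  shows "act id p \<simeq> p"
proof (rule equivI[OF supported_act[OF assms] assms])
  fix w :: "('a, 'n) index list" assume "length w = d"
  then show "coef w (act id p) = coef w p"
    using coef_act[OF assms, of id w] by (simp add: permutes_id perm_sign_fixed_odd)
qed

lemma permutes_symgroup [simp]: "\<sigma> \<in> symgroup d \<longleftrightarrow> \<sigma> permutes {..<d}"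
  by (simp add: symgroup_def)

lemma finite_symgroup [simp]: "finite (symgroup d)"
  by (simp add: symgroup_def finite_permutations)

section \<open>Invariant combinations and symmetrization\<close>

definition symmetric :: "nat \<Rightarrow> ('k, 'a^'n^'n) combination \<Rightarrow> bool" where
  "symmetric d p \<longleftrightarrow> supported d p \<and> (\<forall>\<sigma>. \<sigma> permutes {..<d} \<longrightarrow> act \<sigma> p \<simeq> p)"

lemma symmetric_coef:
  assumes "symmetric d p" "\<sigma> permutes {..<d}" "length w = d"
  shows "coef (permute_list \<sigma> w) p = perm_sign d \<sigma> (parity w) * coef w p"
proof -
  have sup: "supported d p" and eq: "act \<sigma> p \<simeq> p" using assms by (simp_all add: symmetric_def)
  have "coef (permute_list \<sigma> w) p = coef (permute_list \<sigma> w) (act \<sigma> p)"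
    using eq by (simp add: equiv_tensor_def)
  also have "\<dots> = perm_sign d \<sigma> (parity w) * coef w p"
    by (rule coef_act[OF sup assms(2,3)])
  finally show ?thesis .
qed

lemma symmetric_supported: "symmetric d p \<Longrightarrow> supported d p"
  by (simp add: symmetric_def)

lemma symmetric_act: "symmetric d p \<Longrightarrow> \<sigma> permutes {..<d} \<Longrightarrow> act \<sigma> p \<simeq> p"
  by (simp add: symmetric_def)

lemma symmetricI:
  assumes "supported d p"
    "\<And>\<sigma> w. \<sigma> permutes {..<d} \<Longrightarrow> length w = d \<Longrightarrow>
      coef (permute_list \<sigma> w) p = perm_sign d \<sigma> (parity w) * coef w p"
  shows "symmetric d p"
  unfolding symmetric_def
proof (intro conjI allI impI assms(1))
  fix \<sigma> assume \<sigma>: "\<sigma> permutes {..<d}"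
  show "act \<sigma> p \<simeq> p"
  proof (rule equivI[OF supported_act[OF assms(1)] assms(1)])
    fix w' :: "('a, 'n) index list" assume w': "length w' = d"
    define w where "w = permute_list (inv \<sigma>) w'"
    have w: "length w = d" "w' = permute_list \<sigma> w"
      using w' \<sigma> by (simp_all add: w_def permute_list_inverse)
    show "coef w' (act \<sigma> p) = coef w' p"
      unfolding w(2) assms(2)[OF \<sigma> w(1)] coef_act[OF assms(1) \<sigma> w(1)] ..
  qed
qed

lemma symmetric_equiv:
  assumes "symmetric d p" "supported d q" "q \<simeq> p"
  shows "symmetric d q"
proof (rule symmetricI[OF assms(2)])
  have "coef w q = coef w p" for w using assms(3) by (simp add: equiv_tensor_def)
  then show "coef (permute_list \<sigma> w) q = perm_sign d \<sigma> (parity w) * coef w q"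
    if "\<sigma> permutes {..<d}" "length w = d" for \<sigma> w
    using symmetric_coef[OF assms(1) that] by simp
qed

lemma symmetric_add:
  assumes "symmetric d p" "symmetric d q"
  shows "symmetric d (p + q)"
  by (rule symmetricI[OF supported_add[OF assms[THEN symmetric_supported]]])
    (simp only: coef_add symmetric_coef[OF assms(1)] symmetric_coef[OF assms(2)] distrib_left)

lemma symmetric_fscale:
  assumes "symmetric d p"
  shows "symmetric d (fscale c p)"
  by (rule symmetricI[OF supported_fscale[OF symmetric_supported[OF assms]]])
    (simp only: coef_fscale symmetric_coef[OF assms] ac_simps)

lemma symmetric_zero: "symmetric d 0"
  by (rule symmetricI) simp_all

lemma symmetric_mul:
  assumes "symmetric d p" "symmetric d q"
  shows "symmetric d (mul p q)"
  unfolding symmetric_def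
proof (intro conjI allI impI)
  note sup = symmetric_supported[OF assms(1)] symmetric_supported[OF assms(2)]
  show "supported d (mul p q)" using sup by (rule supported_mul)
  fix \<sigma> assume \<sigma>: "\<sigma> permutes {..<d}"
  have "act \<sigma> (mul p q) \<simeq> mul (act \<sigma> p) (act \<sigma> q)"
    using sup \<sigma> by (rule act_mul)
  also have "\<dots> \<simeq> mul p q"
    by (rule mul_cong[OF supported_act[OF sup(1)] sup(1) supported_act[OF sup(2)] sup(2)
          symmetric_act[OF assms(1) \<sigma>] symmetric_act[OF assms(2) \<sigma>]])
  finally show "act \<sigma> (mul p q) \<simeq> mul p q" .
qed

text \<open>The sum runs over the whole group and not over coset representatives. The result is a
  stabilizer order times an orbit sum, but it is linear in \<open>p\<close> and compatible with
  products; the order is cancelled afterwards.\<close>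

definition symmetrize :: "nat \<Rightarrow> ('k, 'a^'n^'n) combination \<Rightarrow> ('k, 'a^'n^'n) combination" where
  "symmetrize d p = (\<Sum>\<sigma>\<in>symgroup d. act \<sigma> p)"

lemma supported_symmetrize [intro]: "supported d p \<Longrightarrow> supported d (symmetrize d p)"
  by (auto simp: symmetrize_def)

lemma symmetrize_cong:
  "supported d p \<Longrightarrow> supported d q \<Longrightarrow> p \<simeq> q \<Longrightarrow> symmetrize d p \<simeq> symmetrize d q"
  unfolding symmetrize_def by (intro equiv_sum) (auto intro: act_cong)

lemma symmetrize_fscale: "symmetrize d (fscale c p) = fscale c (symmetrize d p)"
  by (simp add: symmetrize_def act_fscale formal.scale_sum_right)

lemma symmetrize_sum: "symmetrize d (sum f S) = (\<Sum>s\<in>S. symmetrize d (f s))"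
  unfolding symmetrize_def act_sum by (rule sum.swap)

lemma symmetrize_add: "symmetrize d (p + q) = symmetrize d p + symmetrize d q"
  by (simp add: symmetrize_def act_def lin_ext_add sum.distrib)

lemma symmetrize_act:
  assumes "supported d p" "\<tau> permutes {..<d}"
  shows "symmetrize d (act \<tau> p) \<simeq> symmetrize d p"
proof -
  have "symmetrize d (act \<tau> p) \<simeq> (\<Sum>\<sigma>\<in>symgroup d. act (\<tau> \<circ> \<sigma>) p)"
    unfolding symmetrize_def using assms by (intro equiv_sum act_compose) auto
  also have "(\<Sum>\<sigma>\<in>symgroup d. act (\<tau> \<circ> \<sigma>) p) = symmetrize d p"
    unfolding symmetrize_def symgroup_def
    by (rule setum_permutations_compose_left[OF assms(2), symmetric])
  finally show ?thesis .
qed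

lemma symmetric_symmetrize:
  assumes "supported d p"
  shows "symmetric d (symmetrize d p)"
  unfolding symmetric_def
proof (intro conjI allI impI)
  fix \<tau> assume \<tau>: "\<tau> permutes {..<d}"
  have "act \<tau> (symmetrize d p) = (\<Sum>\<sigma>\<in>symgroup d. act \<tau> (act \<sigma> p))"
    unfolding symmetrize_def by (rule act_sum)
  also have "\<dots> \<simeq> (\<Sum>\<sigma>\<in>symgroup d. act (\<sigma> \<circ> \<tau>) p)"
    using assms \<tau> by (intro equiv_sum act_compose) auto
  also have "(\<Sum>\<sigma>\<in>symgroup d. act (\<sigma> \<circ> \<tau>) p) = symmetrize d p"
    unfolding symmetrize_def symgroup_def by (rule sum_permutations_compose_right[OF \<tau>, symmetric])
  finally show "act \<tau> (symmetrize d p) \<simeq> symmetrize d p" .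
qed (use assms in auto)

text \<open>Projection formula: an invariant factor equals each of its translates and can therefore
  be moved inside the sum.\<close>

lemma mul_symmetrize:
  assumes "symmetric d q" "supported d p"
  shows "mul q (symmetrize d p) \<simeq> symmetrize d (mul q p)"
proof -
  have q: "supported d q" using assms(1) by (simp add: symmetric_def)
  have "mul q (symmetrize d p) = (\<Sum>\<sigma>\<in>symgroup d. mul q (act \<sigma> p))"
    unfolding symmetrize_def by (rule mul_sum_right)
  also have "\<dots> \<simeq> (\<Sum>\<sigma>\<in>symgroup d. mul (act \<sigma> q) (act \<sigma> p))"
    using assms q by (intro equiv_sum mul_cong[of d] equiv_sym[OF symmetric_act] supported_act) simp_all
  also have "\<dots> \<simeq> (\<Sum>\<sigma>\<in>symgroup d. act \<sigma> (mul q p))"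
    using assms q by (intro equiv_sum equiv_sym[OF act_mul[of d]]) auto
  finally show ?thesis by (simp add: symmetrize_def)
qed

subsection \<open>A divisibility description of the generalized Schur algebra\<close>

lemma perm_sign_nonzero: "perm_sign d \<sigma> a \<noteq> (0::'k)"
  using perm_sign_square[of d \<sigma> a, where 'k = 'k] by auto

text \<open>Exchanging two equal odd letters fixes the word but costs a sign, so the coefficient
  equals its own negative; it vanishes because 2 is not a zero divisor.\<close>

lemma symmetric_odd_distinct:
  assumes "symmetric d p" "coef w p \<noteq> 0" "length w = d" "k < d" "l < d" "k \<noteq> l" "w ! k = w ! l"
  shows "\<not> isodd (w ! k)"
proof
  assume odd: "isodd (w ! k)"
  \<comment> \<open>At the positions \<open>0\<close> and \<open>1\<close> no odd letters lie in between, so the transposition has sign \<open>-1\<close>.\<close>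
  obtain \<tau> where \<tau>: "\<tau> permutes {..<d}" "\<tau> 0 = k" "\<tau> 1 = l"
    by (rule permutation_to_front[OF assms(4-6)])
  define v where "v = permute_list \<tau> w"
  have d: "1 < d" using assms(4-6) by linarith
  have v: "length v = d" "v ! 0 = w ! k" "v ! 1 = w ! k"
    using \<tau> d assms by (simp_all add: v_def permute_list_nth)
  have nz: "coef v p \<noteq> 0"
    unfolding v_def symmetric_coef[OF assms(1) \<tau>(1) assms(3)] using assms(2) perm_sign_nonzero by simp
  have t: "Transposition.transpose 0 1 permutes {..<d}" using d by (intro permutes_swap_id) auto
  have "permute_list (Transposition.transpose 0 1) v = v"
    using v t d by (intro nth_equalityI) (auto simp: permute_list_nth Transposition.transpose_def)
  then have "coef v p = - coef v p"
    using symmetric_coef[OF assms(1) t v(1)] perm_sign_transpose_01[of "\<lambda>k. isodd (v ! k)" d, where 'k = 'k] v odd d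
    by simp
  then have "coef v p + coef v p = 0" by (rule eq_neg_iff_add_eq_0[THEN iffD1])
  then have "2 * coef v p = 0" unfolding mult_2 .
  then show False using nz by simp
qed

abbreviation isc :: "('a, 'n) index \<Rightarrow> bool" where "isc i \<equiv> fst i \<in> Bc"

abbreviation isa :: "('a, 'n) index \<Rightarrow> bool" where "isa i \<equiv> fst i \<in> Ba"

text \<open>
  \<open>card (stab_on isc w)\<close> is the product of the factorials of the multiplicities in \<open>w\<close> of the letters
  over \<open>Bc\<close> (\<open>c_factorial_card\<close>).
\<close>

definition in_T :: "nat \<Rightarrow> ('k, 'a^'n^'n) combination \<Rightarrow> bool" where
  "in_T d p \<longleftrightarrow> symmetric d p \<and> (\<forall>w. of_nat (card (stab_on isc w)) dvd coef w p)"

lemma in_T_symmetric: "in_T d p \<Longrightarrow> symmetric d p" by (simp add: in_T_def)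
lemma in_T_supported: "in_T d p \<Longrightarrow> supported d p" by (simp add: in_T_def symmetric_def)
lemma in_T_dvd: "in_T d p \<Longrightarrow> of_nat (card (stab_on isc w)) dvd coef w p" by (simp add: in_T_def)

lemma in_T_zero: "in_T d 0" by (simp add: in_T_def symmetric_zero)
lemma in_T_add: "in_T d p \<Longrightarrow> in_T d q \<Longrightarrow> in_T d (p + q)"
  by (simp add: in_T_def symmetric_add coef_add)
lemma in_T_fscale: "in_T d p \<Longrightarrow> in_T d (fscale c p)"
  by (simp add: in_T_def symmetric_fscale coef_fscale)

lemma coord_aa: "X \<in> matrices_over \<aa> \<Longrightarrow> coord i X \<noteq> 0 \<Longrightarrow> isa i"
  using repr_parts(3)[of "X $ fst (snd i) $ snd (snd i)" "fst i"]
  by (simp add: coord_def matrices_over_def)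

lemma ximat_aa: "isa i \<Longrightarrow> ximat i \<in> matrices_over \<aa>"
  using span_base[of "fst i" Ba] subspace_0[OF subspace_\<aa>]
  by (auto simp: matrices_over_def xi_def bases)

lemma isc_even: "isc i \<Longrightarrow> \<not> isodd i" using B_disjoint by auto

text \<open>Letters over \<open>Bc\<close> are even, so permuting them among themselves costs no
  sign.\<close>

lemma stab_isc_sign:
  assumes "h \<in> stab_on isc w" "length w = d"
  shows "perm_sign d h (parity w) = (1 :: 'k)"
proof (rule perm_sign_fixed_odd)
  show "h permutes {..<d}" using stab_on_permutes[OF assms(1)] assms(2) by simp
  show "h k = k" if "k < d" "isodd (w ! k)" for k
    using stab_on_moved[OF assms(1), of k] isc_even that by blast
qed

text \<open>
  Restriction to the \<open>Bc\<close>-positions of \<open>u\<close> and to the remaining \<open>Bc\<close>-positions of \<open>v\<close> makes \<open>K\<close> act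
  freely on the product of the two stabilizers.
\<close>

lemma card_joint_stabilizer_dvd:
  fixes u v w :: "('a, 'n) index list"
  assumes len: "length u = d" "length v = d" "length w = d"
    and K: "K = {h \<in> stab_on isc w. permute_list h u = u \<and> permute_list h v = v}"
    and moved: "\<And>h k. h \<in> K \<Longrightarrow> h k \<noteq> k \<Longrightarrow> isc (u ! k) \<or> isc (v ! k)"
  shows "card K dvd card (stab_on isc u) * card (stab_on isc v)"
proof -
  define S where "S = {k. k < d \<and> isc (u ! k)}"
  define S' where "S' = {k. k < d \<and> isc (v ! k) \<and> \<not> isc (u ! k)}"
  have perm: "h permutes {..<d}" if "h \<in> K" for h
    using that stab_on_permutes[of h isc w] len by (simp add: K)
  have lt: "h k < d \<longleftrightarrow> k < d" if "h \<in> K" for h k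
    using permutes_in_image[OF perm[OF that], of k] by simp
  have nth: "u ! h k = u ! k" "v ! h k = v ! k" if "h \<in> K" "k < d" for h k
    using that permute_list_nth[of h u k] permute_list_nth[of h v k] perm[OF that(1)] len by (auto simp: K)
  have presS: "h k \<in> S" if "h \<in> K" "k \<in> S" for h k
    using that nth[OF that(1)] lt[OF that(1)] by (auto simp: S_def)
  have presS': "h k \<in> S'" if "h \<in> K" "k \<in> S'" for h k
    using that nth[OF that(1)] lt[OF that(1)] by (auto simp: S'_def)
  have r1: "restrict_perm S h \<in> stab_on isc u" if "h \<in> K" for h
  proof -
    have "restrict_perm S h permutes S"
      using presS[OF that] by (intro restrict_perm_permutes[OF perm[OF that]]) (auto simp: S_def)
    then show ?thesis using nth(1)[OF that] len by (auto simp: stab_on_def S_def restrict_perm_def)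
  qed
  have r2: "restrict_perm S' h \<in> stab_on isc v" if "h \<in> K" for h
  proof -
    have "restrict_perm S' h permutes S'"
      using presS'[OF that] by (intro restrict_perm_permutes[OF perm[OF that]]) (auto simp: S'_def)
    then have "restrict_perm S' h permutes {k. k < length v \<and> isc (v ! k)}"
      by (rule permutes_subset) (auto simp: S'_def len)
    then show ?thesis using nth(2)[OF that] len by (auto simp: stab_on_def S'_def restrict_perm_def)
  qed
  have comp: "restrict_perm S (g \<circ> h) = restrict_perm S g \<circ> restrict_perm S h"
    "restrict_perm S' (g \<circ> h) = restrict_perm S' g \<circ> restrict_perm S' h" if "h \<in> K" for g h
    using presS[OF that] presS'[OF that] by (intro restrict_perm_comp; blast)+
  define act where "act h = (\<lambda>(a :: nat \<Rightarrow> nat, b :: nat \<Rightarrow> nat). (a \<circ> restrict_perm S h, b \<circ> restrict_perm S' h))"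
    for h :: "nat \<Rightarrow> nat"
  \<comment> \<open>Summing the constant 1 turns the orbit argument into a statement on
    cardinalities: for a free action the order of the group divides the number of points.\<close>
  have "of_nat (card K) dvd (\<Sum>x\<in>stab_on isc u \<times> stab_on isc v. 1 :: int)"
  proof (rule card_group_dvd_sum[where act = act])
    show "finite (stab_on isc u \<times> stab_on isc v)" by (simp add: finite_stab_on)
    have "finite K" "id \<in> K" by (simp_all add: K finite_stab_on stab_on_id)
    moreover have "g \<circ> h \<in> K" if "g \<in> K" "h \<in> K" for g h
      using that perm[OF that(2)] len stab_on_comp[of g isc w h] by (simp add: K permute_list_compose)
    moreover have "inv g \<in> K" if "g \<in> K" for g
    proof -
      have "permute_list (inv g) (permute_list g u) = u" "permute_list (inv g) (permute_list g v) = v"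
        using perm[OF that] len by (simp_all add: permute_list_inverse)
      then show ?thesis using that stab_on_inv[of g isc w] by (simp add: K)
    qed
    moreover have "bij g" if "g \<in> K" for g using perm[OF that] by (rule permutes_bij)
    ultimately show "perm_group K" by (simp add: perm_group_def)
    show "act g x \<in> stab_on isc u \<times> stab_on isc v"
      if "g \<in> K" "x \<in> stab_on isc u \<times> stab_on isc v" for g x
      using that r1[OF that(1)] r2[OF that(1)] by (auto simp: act_def intro: stab_on_comp)
    have rid: "restrict_perm A id = id" for A :: "nat set" by (auto simp: restrict_perm_def)
    show "act id x = x" for x by (cases x) (simp add: act_def rid)
    show "act (g \<circ> h) x = act h (act g x)" if "g \<in> K" "h \<in> K" for g h x
      by (cases x) (simp add: act_def comp[OF that(2)] o_assoc)
    fix x assume x: "x \<in> stab_on isc u \<times> stab_on isc v"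
    have "g = id" if g: "g \<in> K" "act g x = x" for g
    proof -
      obtain a b where ab: "x = (a, b)" "bij a" "bij b" using x stab_on_bij by (cases x) auto
      have e: "a \<circ> restrict_perm S g = a" "b \<circ> restrict_perm S' g = b"
        using g(2) by (auto simp: act_def ab(1))
      have "restrict_perm S g k = k" "restrict_perm S' g k = k" for k
        using fun_cong[OF e(1), of k] fun_cong[OF e(2), of k] bij_is_inj[OF ab(2)] bij_is_inj[OF ab(3)]
        by (auto dest: injD)
      then have fixS: "k \<in> S \<Longrightarrow> g k = k" "k \<in> S' \<Longrightarrow> g k = k" for k
        by (metis restrict_perm_def)+
      have "g k = k" for k
      proof (rule ccontr)
        assume "g k \<noteq> k"
        then have "k < d" using perm[OF g(1)] permutes_not_in[of g "{..<d}" k] by auto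
        then show False using moved[OF g(1) \<open>g k \<noteq> k\<close>] fixS \<open>g k \<noteq> k\<close> by (auto simp: S_def S'_def)
      qed
      then show ?thesis by auto
    qed
    then have "{g \<in> K. act g x = x} \<subseteq> {id}" by blast
    moreover have "id \<in> {g \<in> K. act g x = x}"
      by (cases x) (simp add: act_def rid K stab_on_id)
    ultimately have "{g \<in> K. act g x = x} = {id}" by blast
    then show "of_nat (card {g \<in> K. act g x = x}) dvd (1 :: int)" by simp
  qed simp
  then have "int (card K) dvd int (card (stab_on isc u) * card (stab_on isc v))"
    by (simp add: card_cartesian_product)
  then show ?thesis by (simp only: int_dvd_int_iff)
qed

lemma in_T_mul:
  assumes "in_T d p" "in_T d q"
  shows "in_T d (mul p q)"
  unfolding in_T_def
proof (intro conjI allI)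
  note sym = in_T_symmetric[OF assms(1)] in_T_symmetric[OF assms(2)]
  note sup = in_T_supported[OF assms(1)] in_T_supported[OF assms(2)]
  show "symmetric d (mul p q)" using sym by (rule symmetric_mul)
  fix w :: "('a, 'n) index list"
  show "of_nat (card (stab_on isc w)) dvd coef w (mul p q)"
  proof (cases "length w = d")
    case False
    then show ?thesis using coef_wrong_length[OF supported_mul[OF sup]] by simp
  next
    case True
    let ?H = "stab_on isc w"
    define F where "F = (\<lambda>(u, v). coef u p * coef v q * mult_coef d u v w)"
    define act where "act h = (\<lambda>(u :: ('a, 'n) index list, v :: ('a, 'n) index list).
        (permute_list h u, permute_list h v))" for h :: "nat \<Rightarrow> nat"
    have act_apply: "act h (u, v) = (permute_list h u, permute_list h v)" for h u v by (simp add: act_def)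
    have idx: "u \<in> index_words d" if "u \<in> supp p \<or> u \<in> supp q" for u
      using that supp_index_words[OF sup(1)] supp_index_words[OF sup(2)] by blast
    have len: "length u = d" if "u \<in> supp p \<or> u \<in> supp q" for u
      using idx[OF that] by (simp add: index_words_def)
    have perm: "h permutes {..<d}" if "h \<in> ?H" for h using stab_on_permutes[OF that] True by simp
    have "of_nat (card ?H) dvd (\<Sum>x\<in>supp p \<times> supp q. F x)"
    proof (rule card_group_dvd_sum[where act = act])
      show "finite (supp p \<times> supp q)" by (simp add: finite_supp)
      show "perm_group ?H" by (rule perm_group_stab_on)
      show "act g x \<in> supp p \<times> supp q" if g: "g \<in> ?H" and x: "x \<in> supp p \<times> supp q" for g x
      proof -
        obtain u v where uv: "x = (u, v)" "u \<in> supp p" "v \<in> supp q" using x by blast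
        have "coef (permute_list g u) p \<noteq> 0"
          unfolding symmetric_coef[OF sym(1) perm[OF g] len[OF disjI1[OF uv(2)]]]
          using uv(2) perm_sign_nonzero by (simp add: supp_def)
        moreover have "coef (permute_list g v) q \<noteq> 0"
          unfolding symmetric_coef[OF sym(2) perm[OF g] len[OF disjI2[OF uv(3)]]]
          using uv(3) perm_sign_nonzero by (simp add: supp_def)
        ultimately show ?thesis by (simp add: uv(1) act_apply supp_def)
      qed
      show "act id x = x" for x by (cases x) (simp add: act_apply)
      show "act (g \<circ> h) x = act h (act g x)" if gh: "g \<in> ?H" "h \<in> ?H" "x \<in> supp p \<times> supp q" for g h x
      proof -
        obtain u v where uv: "x = (u, v)" "u \<in> supp p" "v \<in> supp q" using gh(3) by blast
        show ?thesis using perm[OF gh(2)] len[of u] len[of v] uv(2,3)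
          unfolding uv(1) act_apply by (simp add: permute_list_compose)
      qed
      show "F (act g x) = F x" if g: "g \<in> ?H" and x: "x \<in> supp p \<times> supp q" for g x
      proof -
        obtain u v where uv: "x = (u, v)" "u \<in> supp p" "v \<in> supp q" using x by blast
        note l = len[OF disjI1[OF uv(2)]] len[OF disjI2[OF uv(3)]]
        \<comment> \<open>The signs of \<open>u\<close> and \<open>v\<close> are those which the
          coefficients of \<open>p\<close> and \<open>q\<close> acquire under \<open>g\<close>,
          while the sign of \<open>w\<close> is 1; so the summand does not change.\<close>
        have "perm_sign d g (parity u) * perm_sign d g (parity v) *
            mult_coef d (permute_list g u) (permute_list g v) w = mult_coef d u v w"
          using mult_coef_permute[OF perm[OF g] idx[OF disjI1[OF uv(2)]] idx[OF disjI2[OF uv(3)]] True]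
            stab_isc_sign[OF g True] stab_on_permute_list[OF g] by simp
        from arg_cong[OF this, of "\<lambda>x. x * (coef u p * coef v q)"]
        show ?thesis
          unfolding uv(1) act_apply F_def prod.case symmetric_coef[OF sym(1) perm[OF g] l(1)]
            symmetric_coef[OF sym(2) perm[OF g] l(2)]
          by (simp only: ac_simps)
      qed
      show "of_nat (card {g \<in> ?H. act g x = x}) dvd F x" if x: "x \<in> supp p \<times> supp q" for x
      proof (cases "F x = 0")
        case False
        obtain u v where uv: "x = (u, v)" "u \<in> supp p" "v \<in> supp q" using x by blast
        note l = len[OF disjI1[OF uv(2)]] len[OF disjI2[OF uv(3)]]
        note ix = idx[OF disjI1[OF uv(2)]] idx[OF disjI2[OF uv(3)]]
        have nz: "wcoef w (map2 matrix_mult (map ximat u) (map ximat v)) \<noteq> 0"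
          using False by (auto simp: F_def uv(1) mult_coef_def)
        define K where "K = {h \<in> ?H. permute_list h u = u \<and> permute_list h v = v}"
        have "card K dvd card (stab_on isc u) * card (stab_on isc v)"
        proof (rule card_joint_stabilizer_dvd[OF l True K_def])
          fix h k assume h: "h \<in> K" "h k \<noteq> k"
          then have hH: "h \<in> ?H" and fixes_uv: "permute_list h u = u" "permute_list h v = v" by (auto simp: K_def)
          have k: "k < d" "isc (w ! k)" using stab_on_moved[OF hH h(2)] True by auto
          have hk: "h k < d" using stab_on_lt[OF hH, of k] k True by simp
          \<comment> \<open>The letter of \<open>u\<close> at \<open>k\<close> is repeated at
            \<open>h k\<close>, hence even; the letter of \<open>v\<close> at \<open>k\<close> is
            then even too, because that of \<open>w\<close> is. It remains to exclude that both
            letters lie over \<open>Ba\<close>.\<close>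
          have "u ! k = u ! h k"
            using permute_list_nth[of h u k] perm[OF hH] l k fixes_uv by simp
          then have ue: "\<not> isodd (u ! k)"
            using symmetric_odd_distinct[OF sym(1) _ l(1) k(1) hk] uv(2) h(2) by (auto simp: supp_def)
          then have ve: "\<not> isodd (v ! k)"
            using wcoef_mult_parity[OF ix True nz k(1)] isc_even[OF k(2)] by simp
          have c: "coord (w ! k) (matrix_mult (ximat (u ! k)) (ximat (v ! k))) \<noteq> 0"
            using wcoef_nonzero[OF nz] l k(1) True by simp
          have "\<not> (isa (u ! k) \<and> isa (v ! k))"
          proof
            assume "isa (u ! k) \<and> isa (v ! k)"
            then have "matrix_mult (ximat (u ! k)) (ximat (v ! k)) \<in> matrices_over \<aa>"
              using matrix_mult_over[OF subspace_\<aa> mult_\<aa> ximat_aa ximat_aa] by blast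
            then show False using coord_aa[OF _ c] k(2) B_disjoint by blast
          qed
          moreover have "u ! k \<in> labels B" "v ! k \<in> labels B"
            using ix k(1) l by (auto simp: index_words_def)
          ultimately show "isc (u ! k) \<or> isc (v ! k)"
            using ue ve by (auto simp: labels_def B_def)
        qed
        then obtain c where "card (stab_on isc u) * card (stab_on isc v) = card K * c" by (rule dvdE)
        then have "(of_nat (card K) :: 'k) dvd of_nat (card (stab_on isc u)) * of_nat (card (stab_on isc v))"
          unfolding of_nat_mult[symmetric] by simp
        also have "\<dots> dvd coef u p * coef v q"
          by (intro mult_dvd_mono in_T_dvd[OF assms(1)] in_T_dvd[OF assms(2)])
        also have "\<dots> dvd F x" by (simp add: F_def uv(1))
        finally show ?thesis by (simp add: uv(1) act_apply K_def)
      qed simp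
    qed
    then show ?thesis
      unfolding coef_mul[OF sup True] F_def sum.cartesian_product .
  qed
qed

text \<open>An element \<open>e\<close> supported on the orbit of \<open>w\<close> with the smallest
  admissible coefficient at \<open>w\<close> can be subtracted from \<open>p\<close> with a suitable
  factor, which removes this orbit from the support. \<open>V\<close> is abstract because the lemma
  serves both for the span of the elements \<open>eta\<close> and for the generated
  subalgebra.\<close>

lemma T_reduce:
  assumes V: "\<And>p q. p \<in> V \<Longrightarrow> q \<in> V \<Longrightarrow> p + q \<in> V" "\<And>c p. p \<in> V \<Longrightarrow> fscale c p \<in> V"
      "0 \<in> V" "\<And>p q. p \<in> V \<Longrightarrow> supported d q \<Longrightarrow> q \<simeq> p \<Longrightarrow> q \<in> V"
    and p: "in_T d p"
    and E: "\<And>w. w \<in> supp p \<Longrightarrow> \<exists>e\<in>V. in_T d e \<and> coef w e = of_nat (card (stab_on isc w)) \<and>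
      (\<forall>v\<in>supp e. mset v = mset w)"
  shows "p \<in> V"
  using p E
proof (induction "card (supp p)" arbitrary: p rule: less_induct)
  case less
  show ?case
  proof (cases "supp p = {}")
    case True
    then have "p \<simeq> 0" by (auto simp: supp_def equiv_tensor_def)
    then show ?thesis using V(4)[OF V(3)] in_T_supported[OF less.prems(1)] by blast
  next
    case False
    then obtain w where w: "w \<in> supp p" by blast
    from less.prems(2)[OF w] obtain e where e: "e \<in> V" "in_T d e"
      "coef w e = of_nat (card (stab_on isc w))" "\<forall>v\<in>supp e. mset v = mset w" by blast
    obtain c where c: "coef w p = coef w e * c"
      using in_T_dvd[OF less.prems(1), of w] unfolding e(3)[symmetric] by (rule dvdE)
    let ?p = "p + fscale (- c) e"
    have T: "in_T d ?p" using less.prems(1) e(2) by (intro in_T_add in_T_fscale)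
    have len: "length w = d" using w supp_index_words[OF in_T_supported[OF less.prems(1)]] by (auto simp: index_words_def)
    \<comment> \<open>By invariance the support of \<open>p\<close> contains the whole orbit of
      \<open>w\<close>; subtracting a multiple of \<open>e\<close> therefore adds no new
      words.\<close>
    have "v \<in> supp p" if v: "v \<in> supp e" for v
    proof -
      have "mset v = mset w" using e(4) v by blast
      then obtain \<sigma> where \<sigma>: "\<sigma> permutes {..<length w}" "permute_list \<sigma> w = v"
        by (rule mset_eq_permutation)
      then show ?thesis
        using symmetric_coef[OF in_T_symmetric[OF less.prems(1)], of \<sigma> w] len w perm_sign_nonzero
        by (auto simp: supp_def)
    qed
    moreover have "coef w ?p = 0" by (simp add: coef_diff coef_fscale c)
    ultimately have sub: "supp ?p \<subseteq> supp p - {w}"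
      by (auto simp: supp_def coef_diff coef_fscale)
    then have "card (supp ?p) < card (supp p)"
      using w by (intro psubset_card_mono finite_supp) blast
    moreover have "\<exists>e\<in>V. in_T d e \<and> coef w e = of_nat (card (stab_on isc w)) \<and> (\<forall>v\<in>supp e. mset v = mset w)"
      if "w \<in> supp ?p" for w using less.prems(2) sub that by blast
    ultimately have "?p \<in> V" using less.hyps[OF _ T] by blast
    then have "?p + fscale c e \<in> V" using V(1,2) e(1) by blast
    moreover have "p \<simeq> ?p + fscale c e" by (simp add: equiv_tensor_def coef_add coef_fscale)
    ultimately show ?thesis using V(4) in_T_supported[OF less.prems(1)] by blast
  qed
qed

section \<open>Sums over cosets of stabilizers\<close>

lemma act_single: "act \<sigma> (word xs) = word_act \<sigma> xs"
  by (simp add: act_def lin_ext_def fscale_def) (intro poly_mapping_eqI, simp add: map.rep_eq when_def)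

lemma coef_act_single:
  assumes "length xs = d" "\<And>k. k < d \<Longrightarrow> xs ! k \<in> mpart (a k)" "\<sigma> permutes {..<d}" "length w = d"
  shows "coef w (act \<sigma> (word xs)) = perm_sign d \<sigma> a * wcoef w (permute_list \<sigma> xs)"
  unfolding act_single coef_def
  by (rule lin_eval_word_act_homogeneous[OF multilinear_wcoef[OF assms(4)] assms(3,1,2)])

lemma act_single_equiv:
  assumes "length xs = d" "\<And>k. k < d \<Longrightarrow> xs ! k \<in> mpart (a k)" "\<sigma> permutes {..<d}"
  shows "act \<sigma> (word xs) \<simeq> fscale (perm_sign d \<sigma> a) (word (permute_list \<sigma> xs))"
  using assms
  by (intro equivI[of d] supported_act supported_fscale supported_single)
    (simp_all add: coef_act_single[OF assms] coef_fscale coef_single)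

text \<open>The construction behind \<open>xi_sum\<close>, for an arbitrary set \<open>H\<close> of
  permutations and arbitrary factors. The full stabilizer gives \<open>eta\<close>; the stabilizer
  of the factors in M_n(\<aa>) gives the orbit sums of the generation argument.\<close>

definition coset_sum :: "(nat \<Rightarrow> nat) set \<Rightarrow> ('a^'n^'n) list \<Rightarrow> ('k, 'a^'n^'n) combination" where
  "coset_sum H xs = (\<Sum>C\<in>right_cosets H (length xs). word_act (SOME \<sigma>. \<sigma> \<in> C) xs)"

lemma supported_coset_sum: "length xs = d \<Longrightarrow> supported d (coset_sum H xs)"
  unfolding coset_sum_def by (auto intro!: supported_sum supported_word_act)

lemma act_stab:
  assumes "length xs = d" "\<And>k. k < d \<Longrightarrow> xs ! k \<in> mpart (a k)" "h \<in> stab_on P xs"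
    "\<And>k. k < d \<Longrightarrow> a k \<Longrightarrow> h k = k"
  shows "act h (word xs) \<simeq> word xs"
proof -
  have p: "h permutes {..<d}" using stab_on_permutes[OF assms(3)] assms(1) by simp
  have "perm_sign d h a = (1 :: 'k)" by (rule perm_sign_fixed_odd[OF p assms(4)])
  then show ?thesis
    using act_single_equiv[OF assms(1,2) p] stab_on_permute_list[OF assms(3)] by simp
qed

lemma act_stab_comp:
  assumes "length xs = d" "\<And>k. k < d \<Longrightarrow> xs ! k \<in> mpart (a k)" "h \<in> stab_on P xs"
    "\<And>k. k < d \<Longrightarrow> a k \<Longrightarrow> h k = k" "\<sigma> permutes {..<d}"
  shows "act (h \<circ> \<sigma>) (word xs) \<simeq> act \<sigma> (word xs)"
proof -
  let ?s = "word xs"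
  have p: "h permutes {..<d}" using stab_on_permutes[OF assms(3)] assms(1) by simp
  have s: "supported d ?s" using assms(1) by (rule supported_single)
  have "act (h \<circ> \<sigma>) ?s \<simeq> act \<sigma> (act h ?s)"
    by (rule equiv_sym[OF act_compose[OF s p assms(5)]])
  also have "\<dots> \<simeq> act \<sigma> ?s"
    by (rule act_cong[OF supported_act[OF s] s assms(5) act_stab[OF assms(1-4)]])
  finally show ?thesis .
qed

text \<open>The stabilizer fixes the odd positions, so it acts without sign and the terms are
  constant on cosets. This is the link through which properties of full symmetrizations reach coset
  sums.\<close>

lemma coset_sum_symmetrize:
  assumes "length xs = d" "\<And>k. k < d \<Longrightarrow> xs ! k \<in> mpart (a k)"
    "\<And>h k. h \<in> stab_on P xs \<Longrightarrow> k < d \<Longrightarrow> a k \<Longrightarrow> h k = k"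
  shows "fscale (of_nat (card (stab_on P xs))) (coset_sum (stab_on P xs) xs) \<simeq> symmetrize d (word xs)"
  unfolding equiv_tensor_def
proof
  fix w
  let ?H = "stab_on P xs" and ?F = "\<lambda>\<sigma>. coef w (act \<sigma> (word xs))"
  have "of_nat (card ?H) * (\<Sum>C\<in>right_cosets ?H d. ?F (SOME \<sigma>. \<sigma> \<in> C)) = (\<Sum>\<sigma>\<in>symgroup d. ?F \<sigma>)"
  proof (rule sum_right_cosets)
    show "?H \<subseteq> symgroup d" using stab_on_permutes[of _ P xs] assms(1) by auto
    show "perm_group ?H" by (rule perm_group_stab_on)
    show "?F (h \<circ> \<sigma>) = ?F \<sigma>" if "h \<in> ?H" "\<sigma> \<in> symgroup d" for h \<sigma>
      using act_stab_comp[OF assms(1,2) that(1) assms(3)[OF that(1)], of \<sigma>] that(2) by (simp add: equiv_tensor_def)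
  qed
  then show "coef w (fscale (of_nat (card ?H)) (coset_sum ?H xs)) = coef w (symmetrize d (word xs))"
    by (simp add: coef_fscale coset_sum_def coef_sum symmetrize_def act_single assms(1))
qed

text \<open>In a domain the nonzero factor cancels from the invariance condition, so a coset sum
  inherits invariance from the symmetrization.\<close>

lemma symmetric_cancel:
  assumes "symmetric d (fscale c p)" "c \<noteq> 0" "supported d p"
  shows "symmetric d p"
proof (rule symmetricI[OF assms(3)])
  fix \<sigma> :: "nat \<Rightarrow> nat" and w :: "('a, 'n) index list" assume "\<sigma> permutes {..<d}" "length w = d"
  from symmetric_coef[OF assms(1) this]
  have "c * coef (permute_list \<sigma> w) p = c * (perm_sign d \<sigma> (parity w) * coef w p)"
    by (simp add: coef_fscale algebra_simps)
  then show "coef (permute_list \<sigma> w) p = perm_sign d \<sigma> (parity w) * coef w p"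
    using assms(2) by simp
qed

lemma symmetric_coset_sum:
  assumes "length xs = d" "\<And>k. k < d \<Longrightarrow> xs ! k \<in> mpart (a k)"
    "\<And>h k. h \<in> stab_on P xs \<Longrightarrow> k < d \<Longrightarrow> a k \<Longrightarrow> h k = k"
  shows "symmetric d (coset_sum (stab_on P xs) xs)"
proof (rule symmetric_cancel)
  note sup = supported_coset_sum[OF assms(1)]
  have "fscale (of_nat (card (stab_on P xs))) (coset_sum (stab_on P xs) xs) \<simeq> symmetrize d (word xs)"
    using assms by (rule coset_sum_symmetrize)
  then show "symmetric d (fscale (of_nat (card (stab_on P xs))) (coset_sum (stab_on P xs) xs))"
    by (rule symmetric_equiv[OF symmetric_symmetrize[OF supported_single[OF assms(1)]] supported_fscale[OF sup]])
  show "of_nat (card (stab_on P xs)) \<noteq> (0::'k)" using card_stab_on_pos by simp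
  show "supported d (coset_sum (stab_on P xs) xs)" by (rule sup)
qed

definition odd_distinct :: "('a, 'n) index list \<Rightarrow> bool" where
  "odd_distinct w \<longleftrightarrow> (\<forall>k<length w. \<forall>l<length w. k \<noteq> l \<and> w ! k = w ! l \<longrightarrow> \<not> isodd (w ! k))"

lemma stab_fixes_odd:
  assumes "odd_distinct w" "h \<in> stab_on P w" "isodd (w ! k)"
  shows "h k = k"
proof (rule ccontr)
  assume "h k \<noteq> k"
  then have "k < length w" using stab_on_moved[OF assms(2)] by blast
  then show False using assms(1,3) \<open>h k \<noteq> k\<close> stab_on_lt[OF assms(2), of k] stab_on_nth[OF assms(2), of k]
    unfolding odd_distinct_def by metis
qed

lemma odd_distinct_supp:
  assumes "symmetric d p" "w \<in> supp p"
  shows "odd_distinct w"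
proof -
  have "length w = d" using supp_index_words[OF symmetric_supported[OF assms(1)]] assms(2)
    by (auto simp: index_words_def)
  then show ?thesis unfolding odd_distinct_def
    using symmetric_odd_distinct[OF assms(1)] assms(2) by (auto simp: supp_def)
qed

lemma inj_on_ximat: "w \<in> index_words d \<Longrightarrow> inj_on ximat (set w)"
  by (rule inj_onI, rule ximat_inj) (auto simp: index_words_def)

lemma coef_act_basis:
  assumes "w \<in> index_words d" "\<sigma> permutes {..<d}" "length v = d"
  shows "coef v (act \<sigma> (word (map ximat w))) =
    (if v = permute_list \<sigma> w then perm_sign d \<sigma> (parity w) else 0)"
proof -
  have l: "length w = d" using assms(1) by (simp add: index_words_def)
  have "permute_list \<sigma> (map ximat w) = map ximat (permute_list \<sigma> w)"
    using assms(2) l by (simp add: permute_list_map)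
  then show ?thesis
    using coef_act_single[OF _ index_word_mpart[OF assms(1)] assms(2,3)] l
    by (simp add: wcoef_ximat[OF permute_index_words[OF assms(2,1)]])
qed

text \<open>The coefficient counts the permutations that fix \<open>w\<close>; each counts with sign
  1, since repeated letters are even.\<close>

lemma coef_symmetrize_basis:
  assumes "w \<in> index_words d" "odd_distinct w"
  shows "coef w (symmetrize d (word (map ximat w))) = of_nat (card (stab_on (\<lambda>_. True) w))"
proof -
  have l: "length w = d" using assms(1) by (simp add: index_words_def)
  have "coef w (symmetrize d (word (map ximat w))) =
      (\<Sum>\<sigma>\<in>symgroup d. coef w (act \<sigma> (word (map ximat w))))"
    by (simp add: symmetrize_def coef_sum)
  also have "\<dots> = (\<Sum>\<sigma>\<in>symgroup d. if permute_list \<sigma> w = w then 1 else 0)"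
  proof (rule sum.cong[OF refl])
    fix \<sigma> assume "\<sigma> \<in> symgroup d"
    then have p: "\<sigma> permutes {..<d}" by simp
    have "perm_sign d \<sigma> (parity w) = (1::'k)" if "permute_list \<sigma> w = w"
    proof (rule perm_sign_fixed_odd[OF p])
      fix k assume "isodd (w ! k)"
      then show "\<sigma> k = k"
        using stab_fixes_odd[OF assms(2), of \<sigma> "\<lambda>_. True" k] that p l by (simp add: stab_on_True)
    qed
    then show "coef w (act \<sigma> (word (map ximat w))) = (if permute_list \<sigma> w = w then 1 else 0)"
      by (simp add: coef_act_basis[OF assms(1) p l])
  qed
  also have "\<dots> = of_nat (card {\<sigma> \<in> symgroup d. permute_list \<sigma> w = w})"
    by (simp add: sum.If_cases Int_def)
  also have "{\<sigma> \<in> symgroup d. permute_list \<sigma> w = w} = stab_on (\<lambda>_. True) w"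
    by (simp add: stab_on_True l)
  finally show ?thesis .
qed

lemma coef_symmetrize_mset:
  assumes "w \<in> index_words d" "coef v (symmetrize d (word (map ximat w))) \<noteq> 0"
  shows "mset v = mset w"
proof -
  have l: "length w = d" using assms(1) by (simp add: index_words_def)
  then have "supported d (symmetrize d (word (map ximat w)))"
    by (intro supported_symmetrize supported_single) simp
  then have lv: "length v = d" using coef_wrong_length assms(2) by blast
  have "\<exists>\<sigma>\<in>symgroup d. coef v (act \<sigma> (word (map ximat w))) \<noteq> 0"
  proof (rule ccontr)
    assume "\<not> ?thesis"
    then show False using assms(2) by (simp add: symmetrize_def coef_sum)
  qed
  then obtain \<sigma> where "\<sigma> permutes {..<d}" "v = permute_list \<sigma> w"
    using coef_act_basis[OF assms(1) _ lv] by (auto split: if_splits)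
  then show ?thesis using l by simp
qed

text \<open>Along a single orbit an invariant changes only by signs and the order of the group does
  not change at all, so divisibility at one word suffices.\<close>

lemma in_T_orbit:
  assumes "symmetric d e" "length w = d" "coef w e = of_nat (card (stab_on isc w))"
    "\<forall>v\<in>supp e. mset v = mset w"
  shows "in_T d e"
  unfolding in_T_def
proof (intro conjI allI assms(1))
  fix v
  show "of_nat (card (stab_on isc v)) dvd coef v e"
  proof (cases "coef v e = 0")
    case False
    then have m: "mset v = mset w" using assms(4) by (simp add: supp_def)
    then obtain \<sigma> where \<sigma>: "\<sigma> permutes {..<length w}" "permute_list \<sigma> w = v"
      by (rule mset_eq_permutation)
    have "coef v e = perm_sign d \<sigma> (parity w) * of_nat (card (stab_on isc w))"
      using symmetric_coef[OF assms(1) _ assms(2), of \<sigma>] \<sigma> assms(2,3) by simp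
    then show ?thesis by (simp add: card_stab_on m)
  qed simp
qed

text \<open>The letters split into those over \<open>Ba\<close>, those over \<open>Bc\<close> and
  the odd ones; the latter occur at most once and contribute the factor 1.\<close>

lemma card_stab_split:
  assumes "w \<in> index_words d" "odd_distinct w"
  shows "card (stab_on (\<lambda>_. True) w) = card (stab_on isa w) * card (stab_on isc w)"
proof -
  let ?M = "mset w"
  have "filter_mset isa ?M + (filter_mset isc ?M + filter_mset isodd ?M) = ?M"
  proof (rule multiset_eqI)
    fix i
    show "count (filter_mset isa ?M + (filter_mset isc ?M + filter_mset isodd ?M)) i = count ?M i"
    proof (cases "i \<in> set w")
      case True
      then have "fst i \<in> B" using assms(1) by (auto simp: index_words_def labels_def)
      then show ?thesis using B_disjoint by (auto simp: B_def)
    qed (simp add: count_eq_zero_iff[THEN iffD2])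
  qed
  then have "fact_mset ?M = fact_mset (filter_mset isa ?M + (filter_mset isc ?M + filter_mset isodd ?M))" by simp
  also have "\<dots> = fact_mset (filter_mset isa ?M) * (fact_mset (filter_mset isc ?M) * fact_mset (filter_mset isodd ?M))"
    using B_disjoint by (subst fact_mset_disjoint_union, force, subst fact_mset_disjoint_union, force) simp
  also have "fact_mset (filter_mset isodd ?M) = 1"
  proof (rule fact_mset_multiplicity_free)
    fix i
    show "count (filter_mset isodd ?M) i \<le> 1"
    proof (rule ccontr)
      assume "\<not> ?thesis"
      then have "isodd i" and c: "card {k. k < length w \<and> w ! k = i} > 1"
        by (auto simp: count_mset_conv_card split: if_splits)
      from c have "\<not> card {k. k < length w \<and> w ! k = i} \<le> Suc 0" by simp
      then obtain k l where "k < length w" "w ! k = i" "l < length w" "w ! l = i" "k \<noteq> l"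
        using card_le_Suc0_iff_eq[of "{k. k < length w \<and> w ! k = i}"] by auto
      then show False using assms(2) \<open>isodd i\<close> unfolding odd_distinct_def by metis
    qed
  qed
  finally show ?thesis by (simp add: card_stab_on)
qed

lemma coset_sum_basis:
  assumes "w \<in> index_words d" "odd_distinct w" "H = stab_on P (map ximat w)"
  shows "of_nat (card H) * coef w (coset_sum H (map ximat w)) = of_nat (card (stab_on (\<lambda>_. True) w))"
    and "symmetric d (coset_sum H (map ximat w))"
    and "\<forall>v\<in>supp (coset_sum H (map ximat w)). mset v = mset w"
proof -
  have l: "length (map ximat w) = d" using assms(1) by (simp add: index_words_def)
  have fix_odd: "h k = k" if "h \<in> stab_on P (map ximat w)" "k < d" "isodd (w ! k)" for h k
    using stab_fixes_odd[OF assms(2)] that unfolding stab_on_map[OF inj_on_ximat[OF assms(1)]] by blast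
  have eq: "fscale (of_nat (card H)) (coset_sum H (map ximat w)) \<simeq> symmetrize d (word (map ximat w))"
    unfolding assms(3)
    using l index_word_mpart[OF assms(1)] fix_odd by (rule coset_sum_symmetrize)
  show "symmetric d (coset_sum H (map ximat w))"
    unfolding assms(3) using l index_word_mpart[OF assms(1)] fix_odd by (rule symmetric_coset_sum)
  have c: "of_nat (card H) * coef v (coset_sum H (map ximat w)) =
      coef v (symmetrize d (word (map ximat w)))" for v
    using eq by (simp add: equiv_tensor_def coef_fscale)
  show "of_nat (card H) * coef w (coset_sum H (map ximat w)) = of_nat (card (stab_on (\<lambda>_. True) w))"
    unfolding c by (rule coef_symmetrize_basis[OF assms(1,2)])
  show "\<forall>v\<in>supp (coset_sum H (map ximat w)). mset v = mset w"
  proof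
    fix v assume "v \<in> supp (coset_sum H (map ximat w))"
    then have "coef v (symmetrize d (word (map ximat w))) \<noteq> 0"
      unfolding c[symmetric] using card_stab_on_pos[of P "map ximat w"] by (simp add: supp_def assms(3))
    then show "mset v = mset w" by (rule coef_symmetrize_mset[OF assms(1)])
  qed
qed

section \<open>From combinations to tensors\<close>

abbreviation cls :: "nat \<Rightarrow> ('k, 'a^'n^'n) combination \<Rightarrow> ('k, 'a^'n^'n) tensor" where
  "cls d p \<equiv> tensor_class mscale d p"

lemma cls_self: "supported d p \<Longrightarrow> p \<in> cls d p"
  by (simp add: tensor_class_eq)

lemma cls_eqI: "supported d p \<Longrightarrow> supported d q \<Longrightarrow> p \<simeq> q \<Longrightarrow> cls d p = cls d q"
  by (simp add: tensor_class_eq_iff)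

text \<open>The operations on tensors are defined as unions over all representatives; for a
  compatible operation all the sets in the union coincide.\<close>

lemma UN_cls:
  assumes "supported d p" "\<And>q. supported d q \<Longrightarrow> q \<simeq> p \<Longrightarrow> F q = F p"
  shows "(\<Union>q\<in>cls d p. F q) = F p"
proof -
  have "F q = F p" if "q \<in> cls d p" for q
    using that assms(2)[of q] by (simp add: tensor_class_eq[OF assms(1)])
  then have "(\<Union>q\<in>cls d p. F q) = (\<Union>q\<in>cls d p. F p)" by (intro SUP_cong) auto
  then show ?thesis using cls_self[OF assms(1)] by blast
qed

lemma tensor_add_cls:
  assumes "supported d p" "supported d q"
  shows "tensor_add mscale d (cls d p) (cls d q) = cls d (p + q)"
proof -
  have "(\<Union>q'\<in>cls d q. cls d (p' + q')) = cls d (p' + q)" if "supported d p'" for p'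
    using assms that by (intro UN_cls cls_eqI equiv_add) auto
  moreover have "(\<Union>p'\<in>cls d p. cls d (p' + q)) = cls d (p + q)"
    using assms by (intro UN_cls cls_eqI equiv_add) auto
  ultimately show ?thesis
    using assms by (simp add: tensor_add_def tensor_class_eq[of d p])
qed

lemma tensor_scale_cls:
  assumes "supported d p"
  shows "tensor_scale mscale d c (cls d p) = cls d (fscale c p)"
  unfolding tensor_scale_def
  using assms by (intro UN_cls cls_eqI equiv_fscale) auto

lemma tensor_mult_cls:
  assumes "supported d p" "supported d q"
  shows "tensor_mult d (cls d p) (cls d q) = cls d (mul p q)"
proof -
  have "(\<Union>q'\<in>cls d q. cls d (mul p' q')) = cls d (mul p' q)" if "supported d p'" for p'
    using assms that by (intro UN_cls cls_eqI mul_cong[of d]) auto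
  moreover have "(\<Union>p'\<in>cls d p. cls d (mul p' q)) = cls d (mul p q)"
    using assms by (intro UN_cls cls_eqI mul_cong[of d]) auto
  ultimately show ?thesis
    using assms by (simp add: tensor_mult_def tensor_class_eq[of d p] mul_def)
qed

lemma tensor_act_cls:
  assumes "supported d p" "\<sigma> permutes {..<d}"
  shows "tensor_act d \<sigma> (cls d p) = cls d (act \<sigma> p)"
  unfolding tensor_act_def act_def[symmetric]
  using assms by (intro UN_cls cls_eqI act_cong[of d]) auto

lemma tensors_over_cls:
  "X \<in> tensors_over mscale d W \<longleftrightarrow> (\<exists>p. supported d p \<and> (\<forall>xs\<in>Poly_Mapping.keys p. set xs \<subseteq> W) \<and> X = cls d p)"
  by (auto simp: tensors_over_def supported_def)

lemma tensors_over_UNIV: "X \<in> tensors_over mscale d UNIV \<longleftrightarrow> (\<exists>p. supported d p \<and> X = cls d p)"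
  by (simp add: tensors_over_cls)

lemma invariants_UNIV: "X \<in> invariants UNIV d \<longleftrightarrow> (\<exists>p. symmetric d p \<and> X = cls d p)"
proof -
  have "cls d p \<in> invariants UNIV d \<longleftrightarrow> symmetric d p" if "supported d p" for p
  proof -
    have "matrices_over UNIV = (UNIV :: ('a^'n^'n) set)" by (simp add: matrices_over_def)
    then have "cls d p \<in> invariants UNIV d \<longleftrightarrow> (\<forall>\<sigma>\<in>symgroup d. cls d (act \<sigma> p) = cls d p)"
      using that by (auto simp: invariants_def tensors_over_UNIV tensor_act_cls)
    then show ?thesis
      using that supported_act[OF that] by (auto simp: symmetric_def tensor_class_eq_iff)
  qed
  moreover have "X \<in> invariants UNIV d \<Longrightarrow> \<exists>p. supported d p \<and> X = cls d p"
    by (auto simp: invariants_def tensors_over_cls)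
  ultimately show ?thesis using symmetric_supported by blast
qed

definition T_tensors :: "nat \<Rightarrow> ('k, 'a^'n^'n) tensor set" where
  "T_tensors d = cls d ` {p. in_T d p}"

lemma T_tensorsE:
  assumes "X \<in> T_tensors d"
  obtains p where "in_T d p" "X = cls d p"
  using assms unfolding T_tensors_def by blast

lemma T_tensorsI: "in_T d p \<Longrightarrow> cls d p \<in> T_tensors d" by (simp add: T_tensors_def)

lemma submodule_T_tensors: "tensor_submodule mscale d (T_tensors d)"
  unfolding tensor_submodule_def
proof (intro conjI ballI allI)
  show "T_tensors d \<subseteq> tensors_over mscale d UNIV"
    unfolding tensors_over_UNIV subset_iff using in_T_supported by (blast elim: T_tensorsE)
  show "cls d 0 \<in> T_tensors d" by (rule T_tensorsI[OF in_T_zero])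
  show "tensor_add mscale d X Y \<in> T_tensors d" if XY: "X \<in> T_tensors d" "Y \<in> T_tensors d" for X Y
  proof -
    from XY obtain p q where "in_T d p" "in_T d q" "X = cls d p" "Y = cls d q" by (blast elim: T_tensorsE)
    then show ?thesis by (simp add: tensor_add_cls in_T_supported T_tensorsI in_T_add)
  qed
  show "tensor_scale mscale d c X \<in> T_tensors d" if X: "X \<in> T_tensors d" for c X
  proof -
    from X obtain p where "in_T d p" "X = cls d p" by (rule T_tensorsE)
    then show ?thesis by (simp add: tensor_scale_cls in_T_supported T_tensorsI in_T_fscale)
  qed
qed

lemma T_tensors_mult:
  assumes "X \<in> T_tensors d" "Y \<in> T_tensors d"
  shows "tensor_mult d X Y \<in> T_tensors d"
proof -
  from assms obtain p q where "in_T d p" "in_T d q" "X = cls d p" "Y = cls d q" by (blast elim: T_tensorsE)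
  then show ?thesis by (simp add: tensor_mult_cls in_T_supported T_tensorsI in_T_mul)
qed

lemma T_tensors_invariants: "T_tensors d \<subseteq> invariants UNIV d"
  unfolding invariants_UNIV subset_iff using in_T_symmetric by (blast elim: T_tensorsE)

section \<open>The spanning elements of the generalized Schur algebra\<close>

lemma xi_word_ximat: "xi_word bs rs ss = map ximat (zip bs (zip rs ss))"
  by (simp add: xi_word_def case_prod_unfold)

text \<open>\<open>Tri\<close> expresses evenness by membership in \<open>A0\<close>, words of
  labels express oddness by membership in \<open>B1\<close>; for basis elements these conditions are
  complementary.\<close>

lemma Tri_index_word:
  assumes "(bs, rs, ss) \<in> Tri B d" "w = zip bs (zip rs (ss :: 'n list))"
  shows "w \<in> index_words d" "odd_distinct w" "length bs = d" "length rs = d" "length ss = d"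
proof -
  show l: "length bs = d" "length rs = d" "length ss = d" using assms(1) by (auto simp: Tri_def)
  have bs: "set bs \<subseteq> B" using assms(1) by (auto simp: Tri_def)
  then show "w \<in> index_words d"
    using l by (auto simp: assms(2) index_words_def labels_def dest: set_zip_leftD)
  show "odd_distinct w"
    unfolding odd_distinct_def
  proof (intro allI impI)
    fix k m assume km: "k < length w" "m < length w" "k \<noteq> m \<and> w ! k = w ! m"
    then have "bs ! k \<in> A0" using assms(1) l by (auto simp: Tri_def assms(2))
    moreover have "bs ! k \<in> B" using km(1) bs l by (auto simp: assms(2))
    ultimately show "\<not> isodd (w ! k)" using km(1) l B_mem_A0_iff by (simp add: assms(2))
  qed
qed

lemma index_word_Tri:
  assumes "w \<in> index_words d" "odd_distinct w"
  obtains bs rs ss where "(bs, rs, ss) \<in> Tri B d" "w = zip bs (zip rs (ss :: 'n list))"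
proof
  let ?bs = "map fst w" and ?rs = "map (fst \<circ> snd) w" and ?ss = "map (snd \<circ> snd) w"
  show z: "w = zip ?bs (zip ?rs ?ss)" by (intro nth_equalityI) auto
  have l: "length w = d" and wB: "set w \<subseteq> labels B" using assms(1) by (auto simp: index_words_def)
  have bs: "set ?bs \<subseteq> B" using wB by (auto simp: labels_def)
  have rep: "?bs ! k \<in> A0"
    if "k < d" "m < d" "k \<noteq> m" "(?bs ! k, ?rs ! k, ?ss ! k) = (?bs ! m, ?rs ! m, ?ss ! m)" for k m
  proof -
    have "w ! k = w ! m" using that l by (simp add: prod_eq_iff)
    then have "\<not> isodd (w ! k)" using assms(2) that l by (auto simp: odd_distinct_def)
    moreover have "w ! k \<in> labels B" using wB that(1) l by auto
    then have "fst (w ! k) \<in> B" by (simp add: labels_def)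
    ultimately show ?thesis using B_mem_A0_iff that(1) l by simp
  qed
  show "(?bs, ?rs, ?ss) \<in> Tri B d"
    unfolding Tri_def mem_Collect_eq prod.case
  proof (intro conjI allI impI)
    show "length ?bs = d" "length ?rs = d" "length ?ss = d" using l by simp_all
    show "set ?bs \<subseteq> B" by (rule bs)
    show "?bs ! k \<in> A0" if "k < d" "m < d"
        "k \<noteq> m \<and> (?bs ! k, ?rs ! k, ?ss ! k) = (?bs ! m, ?rs ! m, ?ss ! m)" for k m
      using rep[OF that(1,2)] that(3) by blast
  qed
qed

lemma stabilizer_stab_on:
  assumes "length bs = d" "length rs = d" "length ss = d"
  shows "stabilizer bs rs ss = stab_on (\<lambda>_. True) (zip bs (zip rs (ss :: 'n list)))"
proof -
  have "permute_list \<sigma> (zip bs (zip rs ss)) = zip bs (zip rs ss) \<longleftrightarrow>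
      permute_list \<sigma> bs = bs \<and> permute_list \<sigma> rs = rs \<and> permute_list \<sigma> ss = ss"
    if p: "\<sigma> permutes {..<d}" for \<sigma>
  proof -
    have "permute_list \<sigma> (zip bs (zip rs ss)) = zip (permute_list \<sigma> bs) (permute_list \<sigma> (zip rs ss))"
      by (rule permute_list_zip[OF p]) (simp_all add: assms)
    also have "permute_list \<sigma> (zip rs ss) = zip (permute_list \<sigma> rs) (permute_list \<sigma> ss)"
      by (rule permute_list_zip[OF p]) (simp_all add: assms)
    finally show ?thesis by (auto simp: zip_eq_conv assms)
  qed
  then show ?thesis
    by (auto simp: stabilizer_def stab_on_True assms)
qed

lemma c_factorial_card:
  assumes "length bs = d" "length rs = d" "length ss = d"
  shows "c_factorial Bc bs rs ss = card (stab_on isc (zip bs (zip rs (ss :: 'n list))))"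
proof -
  let ?w = "zip bs (zip rs ss)"
  let ?M = "filter_mset isc (mset ?w)"
  have count: "count ?M (b, r, s) = multiplicity bs rs ss b r s" if "b \<in> Bc" for b r s
  proof -
    have "{k. k < length ?w \<and> ?w ! k = (b, r, s)} = {k. k < length bs \<and> (bs ! k, rs ! k, ss ! k) = (b, r, s)}"
      using assms by auto
    then show ?thesis using that by (simp add: count_mset_conv_card multiplicity_def)
  qed
  have triple: "(\<Prod>x\<in>S \<times> UNIV. g x) = (\<Prod>b\<in>S. \<Prod>r\<in>UNIV. \<Prod>s\<in>UNIV. g (b, r, s))"
    for S and g :: "('a, 'n) index \<Rightarrow> nat"
    by (simp add: prod.cartesian_product case_prod_unfold)
  have "fact_mset ?M = (\<Prod>x\<in>(Bc \<inter> set bs) \<times> UNIV. fact (count ?M x))"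
    by (rule fact_mset_superset) (auto dest: set_zip_leftD)
  also have "\<dots> = (\<Prod>b\<in>Bc \<inter> set bs. \<Prod>r\<in>UNIV. \<Prod>s\<in>UNIV. fact (count ?M (b, r, s)))"
    by (rule triple)
  also have "\<dots> = c_factorial Bc bs rs ss"
    unfolding c_factorial_def by (intro prod.cong refl arg_cong[where f = fact] count) simp
  finally show ?thesis by (simp add: card_stab_on)
qed

text \<open>Summing over cosets of the full stabilizer gives coefficient 1 at the word itself, and
  the factorials turn it into the order by which coefficients of elements of T are divisible. So
  \<open>eta\<close> is an element as required by \<open>T_reduce\<close>.\<close>

lemma eta_cls:
  assumes "(bs, rs, ss) \<in> Tri B d" "w = zip bs (zip rs (ss :: 'n list))"
  obtains e where "eta Bc bs rs ss = cls d e" "in_T d e" "coef w e = of_nat (card (stab_on isc w))"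
    "\<forall>v\<in>supp e. mset v = mset w"
proof -
  note w = Tri_index_word[OF assms]
  let ?H = "stab_on (\<lambda>_. True) (map ximat w)"
  let ?x = "coset_sum ?H (map ximat w)"
  let ?e = "fscale (of_nat (card (stab_on isc w))) ?x"
  have lw: "length (map ximat w) = d" using w(1) by (simp add: index_words_def)
  have H: "?H = stab_on (\<lambda>_. True) w" by (rule stab_on_map[OF inj_on_ximat[OF w(1)]])
  have sx: "supported d ?x" by (rule supported_coset_sum[OF lw])
  have "xi_sum bs rs ss = cls d ?x"
    using lw by (simp add: xi_sum_def coset_sum_def xi_word_ximat stabilizer_stab_on[OF w(3-5)] H w(3) flip: assms(2))
  then have e: "eta Bc bs rs ss = cls d ?e"
    by (simp add: eta_def w(3) tensor_scale_cls[OF sx] c_factorial_card[OF w(3-5)] flip: assms(2))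
  note cs = coset_sum_basis[OF w(1,2) refl, of "\<lambda>_. True"]
  have "coef w ?x = 1"
    using cs(1) card_stab_on_pos[of "\<lambda>_. True" w] by (simp add: H)
  then have c: "coef w ?e = of_nat (card (stab_on isc w))" by (simp add: coef_fscale)
  have s: "\<forall>v\<in>supp ?e. mset v = mset w" using cs(3) by (simp add: supp_def coef_fscale)
  have "in_T d ?e"
    by (rule in_T_orbit[OF symmetric_fscale[OF cs(2)] _ c s]) (use lw in simp)
  then show ?thesis using that e c s by blast
qed

text \<open>The elements \<open>eta\<close> satisfy the divisibility condition; conversely, for any
  submodule that contains them, \<open>T_reduce\<close> applies to the set of its
  representatives.\<close>

lemma T_alg_eq: "T_alg Ba Bc B1 d = T_tensors d"
proof -
  let ?E = "{eta Bc bs rs ss | bs rs (ss :: 'n list). (bs, rs, ss) \<in> Tri (Ba \<union> Bc \<union> B1) d}"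
  have "tensor_submodule mscale d hull ?E \<subseteq> T_tensors d"
  proof (rule hull_minimal)
    show "?E \<subseteq> T_tensors d"
    proof clarify
      fix bs rs and ss :: "'n list" assume "(bs, rs, ss) \<in> Tri (Ba \<union> Bc \<union> B1) d"
      then have "(bs, rs, ss) \<in> Tri B d" by (simp add: B_def)
      then obtain e where "eta Bc bs rs ss = cls d e" "in_T d e" by (rule eta_cls[OF _ refl])
      then show "eta Bc bs rs ss \<in> T_tensors d" by (simp add: T_tensorsI)
    qed
  qed (rule submodule_T_tensors)
  moreover have "T_tensors d \<subseteq> U" if U: "tensor_submodule mscale d U" "?E \<subseteq> U" for U
  proof
    fix X assume "X \<in> T_tensors d"
    then obtain p where p: "in_T d p" "X = cls d p" by (auto simp: T_tensors_def)
    define V where "V = {p. supported d p \<and> cls d p \<in> U}"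
    have "p \<in> V"
    proof (rule T_reduce[OF _ _ _ _ p(1)])
      show "p + q \<in> V" if "p \<in> V" "q \<in> V" for p q
        using that U(1) by (auto simp: V_def tensor_submodule_def tensor_add_cls[symmetric])
      show "fscale c p \<in> V" if "p \<in> V" for c p
        using that U(1) by (auto simp: V_def tensor_submodule_def tensor_scale_cls[symmetric])
      show "0 \<in> V" using U(1) by (simp add: V_def tensor_submodule_def)
      show "q \<in> V" if "p \<in> V" "supported d q" "q \<simeq> p" for p q
        using that by (simp add: V_def tensor_class_eq_iff[THEN iffD2, of d q p])
      fix w assume w: "w \<in> supp p"
      have "w \<in> index_words d" using w supp_index_words[OF in_T_supported[OF p(1)]] by blast
      then obtain bs rs ss where t: "(bs, rs, ss) \<in> Tri B d" "w = zip bs (zip rs (ss :: 'n list))"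
        using odd_distinct_supp[OF in_T_symmetric[OF p(1)] w] by (rule index_word_Tri)
      obtain e where e: "eta Bc bs rs ss = cls d e" "in_T d e" "coef w e = of_nat (card (stab_on isc w))"
        "\<forall>v\<in>supp e. mset v = mset w"
        by (rule eta_cls[OF t])
      have "eta Bc bs rs ss \<in> U" using U(2) t(1) unfolding B_def by blast
      then have "e \<in> V" using e in_T_supported[OF e(2)] by (simp add: V_def)
      then show "\<exists>e\<in>V. in_T d e \<and> coef w e = of_nat (card (stab_on isc w)) \<and> (\<forall>v\<in>supp e. mset v = mset w)"
        using e by blast
    qed
    then show "X \<in> U" by (simp add: V_def p(2))
  qed
  then have "T_tensors d \<subseteq> tensor_submodule mscale d hull ?E" unfolding hull_def by blast
  ultimately show ?thesis unfolding T_alg_def by blast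
qed

section \<open>Invariants over the even subalgebra\<close>

lemma stab_on_isc_trivial:
  assumes "card {k. k < length w \<and> isc (w ! k)} \<le> 1"
  shows "card (stab_on isc w) = 1"
proof -
  have "h = id" if "h \<in> stab_on isc w" for h
  proof
    fix k
    show "h k = id k"
    proof (rule ccontr)
      assume ne: "h k \<noteq> id k"
      have p: "h permutes {k. k < length w \<and> isc (w ! k)}" using that by (simp add: stab_on_def)
      then have "k \<in> {k. k < length w \<and> isc (w ! k)}" "h k \<in> {k. k < length w \<and> isc (w ! k)}"
        using ne permutes_not_in[OF p, of k] permutes_in_image[OF p, of k] by auto
      moreover have "\<forall>x\<in>{k. k < length w \<and> isc (w ! k)}. \<forall>y\<in>{k. k < length w \<and> isc (w ! k)}. x = y"
        using assms by (subst card_le_Suc0_iff_eq[symmetric]) simp_all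
      ultimately show False using ne unfolding id_def by blast
    qed
  qed
  then have "stab_on isc w = {id}" using stab_on_id by blast
  then show ?thesis by simp
qed

text \<open>With at most one letter over \<open>Bc\<close> the group in the divisibility condition
  is trivial. Both kinds of generators belong to T for this reason.\<close>

lemma in_T_few_isc:
  assumes "symmetric d p" "\<And>w. w \<in> supp p \<Longrightarrow> card {k. k < length w \<and> isc (w ! k)} \<le> 1"
  shows "in_T d p"
  unfolding in_T_def
proof (intro conjI allI assms(1))
  fix w show "of_nat (card (stab_on isc w)) dvd coef w p"
    using assms(2)[of w] stab_on_isc_trivial[of w] by (cases "coef w p = 0") (auto simp: supp_def)
qed

lemma invariants_aa_in_T:
  assumes "X \<in> invariants \<aa> d"
  obtains p where "in_T d p" "X = cls d p" "\<And>w. w \<in> supp p \<Longrightarrow> \<forall>i\<in>set w. isa i"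
proof -
  have "X \<in> invariants UNIV d"
    using assms by (auto simp: invariants_def tensors_over_cls matrices_over_def)
  then obtain p where p: "symmetric d p" "X = cls d p" by (auto simp: invariants_UNIV)
  \<comment> \<open>Both \<open>p\<close> and \<open>q\<close> represent \<open>X\<close>:
    \<open>p\<close> is known to be invariant, and \<open>q\<close> shows which letters can
    occur.\<close>
  from assms obtain q where q: "supported d q" "\<forall>xs\<in>Poly_Mapping.keys q. set xs \<subseteq> matrices_over \<aa>" "X = cls d q"
    by (auto simp: invariants_def tensors_over_cls)
  have "cls d p = cls d q" using p(2) q(3) by simp
  then have eq: "p \<simeq> q" using tensor_class_eq_iff[OF symmetric_supported[OF p(1)] q(1)] by simp
  have aa: "\<forall>i\<in>set w. isa i" if "w \<in> supp p" for w
  proof -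
    have "coef w q \<noteq> 0" using that eq by (simp add: supp_def equiv_tensor_def)
    then obtain xs where xs: "xs \<in> Poly_Mapping.keys q" "wcoef w xs \<noteq> 0" by (rule coef_nonzero)
    have "isa (w ! k)" if "k < length w" for k
    proof -
      have "length xs = length w" "coord (w ! k) (xs ! k) \<noteq> 0" using wcoef_nonzero[OF xs(2)] that by auto
      moreover have "xs ! k \<in> matrices_over \<aa>"
      proof -
        have "xs ! k \<in> set xs" using that \<open>length xs = length w\<close> by simp
        then show ?thesis using q(2) xs(1) by blast
      qed
      ultimately show ?thesis using coord_aa by blast
    qed
    then show ?thesis by (metis in_set_conv_nth)
  qed
  have "in_T d p"
  proof (rule in_T_few_isc[OF p(1)])
    fix w assume "w \<in> supp p"
    then have "\<not> isc (w ! k)" if "k < length w" for k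
      using aa[of w] nth_mem[OF that] B_disjoint by blast
    then have "{k. k < length w \<and> isc (w ! k)} = {}" by blast
    then show "card {k. k < length w \<and> isc (w ! k)} \<le> 1" by (simp only: card.empty)
  qed
  then show ?thesis using that p aa by blast
qed

text \<open>Membership requires some representative whose factors all lie in M_n(\<aa>); the normal
  form is one.\<close>

lemma invariants_aaI:
  assumes "symmetric d p" "\<And>w. w \<in> supp p \<Longrightarrow> \<forall>i\<in>set w. isa i"
  shows "cls d p \<in> invariants \<aa> d"
proof -
  note s = symmetric_supported[OF assms(1)]
  have eq: "cls d p = cls d (normal_form p)"
    using s supported_normal_form[OF s] equiv_sym[OF normal_form_equiv[OF s]] by (simp add: tensor_class_eq_iff)
  have "set xs \<subseteq> matrices_over \<aa>" if "xs \<in> Poly_Mapping.keys (normal_form p)" for xs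
  proof -
    have "xs \<in> (\<Union>u\<in>supp p. Poly_Mapping.keys (fscale (coef u p) (word (map ximat u))))"
      using that keys_sum[of "\<lambda>u. fscale (coef u p) (word (map ximat u))" "supp p"]
      unfolding normal_form_def by blast
    then obtain u where u: "u \<in> supp p" "xs \<in> Poly_Mapping.keys (fscale (coef u p) (word (map ximat u)))"
      by blast
    have "xs = map ximat u" using u(2) by (auto simp: in_keys_iff lookup_single when_def split: if_splits)
    then show ?thesis using assms(2)[OF u(1)] ximat_aa by auto
  qed
  then have "cls d p \<in> tensors_over mscale d (matrices_over \<aa>)"
    using supported_normal_form[OF s] eq by (auto simp: tensors_over_cls)
  moreover have "tensor_act d \<sigma> (cls d p) = cls d p" if "\<sigma> \<in> symgroup d" for \<sigma>
    using that assms(1) s by (simp add: tensor_act_cls tensor_class_eq_iff supported_act symmetric_act)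
  ultimately show ?thesis by (simp add: invariants_def)
qed

subsection \<open>The star product with an identity tensor\<close>

lemma matrix_one_aa: "matrix_one \<in> matrices_over \<aa>"
  using one_\<aa> subspace_0[OF subspace_\<aa>] by (auto simp: matrices_over_def matrix_one_def)

lemma matrices_aa_mpart: "X \<in> matrices_over \<aa> \<Longrightarrow> X \<in> mpart False"
  using \<aa>_subset by (auto simp: matrices_over_def mpart_def part_def)

definition one_except :: "nat \<Rightarrow> nat \<Rightarrow> 'a^'n^'n \<Rightarrow> ('a^'n^'n) list" where
  "one_except d k y = (replicate d matrix_one)[k := y]"

lemma length_one_except [simp]: "length (one_except d k y) = d"
  by (simp add: one_except_def)

lemma nth_one_except: "j < d \<Longrightarrow> one_except d k y ! j = (if j = k then y else matrix_one)"
  by (simp add: one_except_def nth_list_update)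

lemma multilinear_one_except:
  assumes "multilinear mscale d h" "k < d"
  shows "h (one_except d k (x + y)) = h (one_except d k x) + h (one_except d k y)"
    "h (one_except d k (mscale c x)) = c * h (one_except d k x)"
  using assms by (simp_all add: multilinear_def one_except_def)

lemma permute_one_except:
  assumes "\<sigma> permutes {..<d}" "k < d"
  shows "permute_list \<sigma> (one_except d k y) = one_except d (inv \<sigma> k) y"
proof -
  have "permute_list \<sigma> (replicate d matrix_one) = replicate d (matrix_one :: 'a^'n^'n)"
    using assms(1) permutes_in_image[OF assms(1)] by (intro nth_equalityI) (auto simp: permute_list_nth)
  then show ?thesis unfolding one_except_def using assms by (subst permute_list_update) auto
qed

lemma one_except_mpart:
  assumes "y \<in> mpart e" "j < d"
  shows "one_except d k y ! j \<in> mpart (j = k \<and> e)"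
  using assms matrices_aa_mpart[OF matrix_one_aa] by (simp add: nth_one_except)

lemma perm_sign_one_odd:
  "perm_sign d \<sigma> (\<lambda>j. j = k \<and> e) = (1::'k)"
  unfolding perm_sign_def by (intro prod.neutral) (auto simp: index_pairs_def)

text \<open>The sign rule concerns homogeneous factors, while \<open>y\<close> is arbitrary. It is
  expanded into basis matrices; for each of these at most one factor of the word is odd, so no sign
  arises.\<close>

lemma act_one_except:
  assumes "\<sigma> permutes {..<d}" "k < d"
  shows "act \<sigma> (word (one_except d k y)) \<simeq> word (one_except d (inv \<sigma> k) y)"
proof (rule equivI[of d])
  fix w :: "('a, 'n) index list" assume w: "length w = d"
  note m = multilinear_wcoef[OF w] and m' = multilinear_word_act[OF multilinear_wcoef[OF w] assms(1)]
  have inv: "inv \<sigma> k < d" using permutes_in_image[OF permutes_inv[OF assms(1)], of k] assms(2) by simp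
  have hom: "lin_eval (wcoef w) (word_act \<sigma> (one_except d k y)) = wcoef w (one_except d (inv \<sigma> k) y)"
    if "y \<in> mpart e" for y e
    using lin_eval_word_act_homogeneous[OF m assms(1) length_one_except one_except_mpart[OF that]]
    by (simp add: perm_sign_one_odd permute_one_except[OF assms])
  have "lin_eval (wcoef w) (word_act \<sigma> (one_except d k y)) = wcoef w (one_except d (inv \<sigma> k) y)"
  proof -
    have "y \<in> mat.span (ximat ` labels B)" by simp
    then show ?thesis
    proof (induction rule: mat.span_induct_alt)
      case base
      have "0 \<in> mpart False"
        using subspace_0[OF subspace_A0] by (simp add: mpart_def part_def matrices_over_def)
      then show ?case by (rule hom)
    next
      case (step c x y)
      then obtain i where "i \<in> labels B" "x = ximat i" by blast
      then show ?case
        using step.IH hom[OF ximat_mpart[of i]]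
        by (simp add: multilinear_one_except[OF m inv] multilinear_one_except[OF m' assms(2)])
    qed
  qed
  then show "coef w (act \<sigma> (word (one_except d k y))) = coef w (word (one_except d (inv \<sigma> k) y))"
    by (simp add: act_single coef_single) (simp add: coef_def)
qed (intro supported_act supported_single length_one_except)+

text \<open>The star product of the identity tensor with \<open>y\<close> in explicit form, see
  \<open>star_one_eq_diag\<close>.\<close>

definition diag :: "nat \<Rightarrow> 'a^'n^'n \<Rightarrow> ('k, 'a^'n^'n) combination" where
  "diag d y = (\<Sum>k<d. word (one_except d k y))"

lemma supported_diag: "supported d (diag d y)"
  unfolding diag_def by (intro supported_sum supported_single) simp

lemma symmetric_diag: "symmetric d (diag d y)"
  unfolding symmetric_def
proof (intro conjI allI impI supported_diag)
  fix \<sigma> assume \<sigma>: "\<sigma> permutes {..<d}"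
  have "act \<sigma> (diag d y) = (\<Sum>k<d. act \<sigma> (word (one_except d k y)))"
    unfolding diag_def by (rule act_sum)
  also have "\<dots> \<simeq> (\<Sum>k<d. word (one_except d (inv \<sigma> k) y))"
    using \<sigma> by (intro equiv_sum act_one_except) auto
  also have "(\<Sum>k<d. word (one_except d (inv \<sigma> k) y)) = diag d y"
    unfolding diag_def using sum.permute[OF permutes_inv[OF \<sigma>], of "\<lambda>k. word (one_except d k y)"]
    by (simp add: o_def)
  finally show "act \<sigma> (diag d y) \<simeq> diag d y" .
qed

lemma in_T_diag: "in_T d (diag d y)"
proof (rule in_T_few_isc[OF symmetric_diag])
  fix w assume "w \<in> supp (diag d y)"
  then have "(\<Sum>k<d. wcoef w (one_except d k y)) \<noteq> 0"
    by (simp add: supp_def diag_def coef_sum coef_single)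
  then obtain k where "wcoef w (one_except d k y) \<noteq> 0" by (meson sum.neutral)
  from wcoef_nonzero[OF this] have w: "length w = d" "\<forall>j<d. coord (w ! j) (one_except d k y ! j) \<noteq> 0" by auto
  have "\<not> isc (w ! j)" if "j < d" "j \<noteq> k" for j
  proof -
    have "coord (w ! j) matrix_one \<noteq> 0" using w(2)[rule_format, OF that(1)] that by (simp add: nth_one_except)
    then show ?thesis using coord_aa[OF matrix_one_aa] B_disjoint by blast
  qed
  then have "{j. j < length w \<and> isc (w ! j)} \<subseteq> {k}" using w(1) by auto
  then show "card {j. j < length w \<and> isc (w ! j)} \<le> 1"
    using card_mono[of "{k}"] by fastforce
qed

definition tcat :: "('k, 'a^'n^'n) combination \<Rightarrow> ('k, 'a^'n^'n) combination \<Rightarrow> ('k, 'a^'n^'n) combination" where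
  "tcat p q = bilin_ext (\<lambda>xs ys. word (xs @ ys)) p q"

lemma supported_tcat: "supported d p \<Longrightarrow> supported f q \<Longrightarrow> supported (d + f) (tcat p q)"
  unfolding tcat_def by (rule supported_bilin_ext) (auto simp: supported_def[of d p] supported_def[of f q] intro: supported_single)

lemma tcat_cong:
  assumes "supported d p" "supported d p'" "supported f q" "supported f q'" "p \<simeq> p'" "q \<simeq> q'"
  shows "tcat p q \<simeq> tcat p' q'"
proof (rule equivI[of "d + f"])
  fix w :: "('a, 'n) index list" assume w: "length w = d + f"
  note m = multilinear_wcoef[OF w]
  have c: "coef w (tcat p q) = lin_eval (\<lambda>xs. lin_eval (\<lambda>ys. wcoef w (xs @ ys)) q) p" for p q
    by (simp add: coef_def tcat_def lin_eval_bilin_ext)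
  have "lin_eval (\<lambda>ys. wcoef w (xs @ ys)) q = lin_eval (\<lambda>ys. wcoef w (xs @ ys)) q'" if "length xs = d" for xs
  proof (rule lin_eval_equiv[OF _ assms(3,4,6)])
    have "xs @ ys[k := x] = (xs @ ys)[d + k := x]" for ys k x using that by (simp add: list_update_append)
    then show "multilinear mscale f (\<lambda>ys. wcoef w (xs @ ys))" using m that by (simp add: multilinear_def)
  qed
  then have "coef w (tcat p q) = coef w (tcat p q')"
    unfolding c using assms(1) by (intro lin_eval_cong) (simp add: supported_def)
  also have "\<dots> = coef w (tcat p' q')"
    unfolding c
  proof (rule lin_eval_equiv[OF multilinear_lin_eval assms(1,2,5)])
    fix ys assume "ys \<in> Poly_Mapping.keys q'"
    then have "length ys = f" using assms(4) by (simp add: supported_def)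
    moreover have "xs[k := x] @ ys = (xs @ ys)[k := x]" if "length xs = d" "k < d" for xs k x
      using that by (simp add: list_update_append)
    ultimately show "multilinear mscale d (\<lambda>xs. wcoef w (xs @ ys))" using m by (simp add: multilinear_def)
  qed
  finally show "coef w (tcat p q) = coef w (tcat p' q')" .
qed (use assms supported_tcat in auto)

lemma star_cls:
  assumes "supported d p" "supported f q"
  shows "star d f (cls d p) (cls f q) = cls (d + f) (\<Sum>\<sigma>\<in>shortest_reps d f. act \<sigma> (tcat p q))"
proof -
  let ?S = "\<lambda>p q. \<Sum>\<sigma>\<in>shortest_reps d f. act \<sigma> (tcat p q)"
  have cong: "cls (d + f) (?S p q) = cls (d + f) (?S p' q')"
    if "supported d p" "supported d p'" "supported f q" "supported f q'" "p \<simeq> p'" "q \<simeq> q'" for p p' q q'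
    by (intro cls_eqI equiv_sum supported_sum supported_act act_cong[of "d + f"] supported_tcat
        tcat_cong[OF that] that(1-4)) (simp_all add: shortest_reps_def)
  have "(\<Union>q'\<in>cls f q. cls (d + f) (?S p' q')) = cls (d + f) (?S p' q)" if "supported d p'" for p'
    using assms that by (intro UN_cls cong) auto
  moreover have "(\<Union>p'\<in>cls d p. cls (d + f) (?S p' q)) = cls (d + f) (?S p q)"
    using assms by (intro UN_cls cong) auto
  ultimately show ?thesis
    using assms by (simp add: star_def tensor_class_eq[of d p] act_def tcat_def)
qed

text \<open>The shortest representatives correspond bijectively to the positions to which they carry
  the last letter \<open>y\<close>, and no signs occur.\<close>

lemma star_one_eq_diag:
  assumes "d \<ge> 1"
  shows "star (d - 1) 1 (pure_tensor mscale (replicate (d - 1) matrix_one)) (pure_tensor mscale [y]) = cls d (diag d y)"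
proof -
  let ?p = "word (replicate (d - 1) matrix_one)" and ?q = "Poly_Mapping.single [y] (1::'k)"
  let ?R = "shortest_reps (d - 1) 1"
  have d: "d - 1 + 1 = d" using assms by simp
  have sp: "supported (d - 1) ?p" and sq: "supported 1 ?q" by (auto intro: supported_single)
  have "replicate (d - 1) matrix_one @ [y] = one_except d (d - 1) y"
    using assms by (intro nth_equalityI) (auto simp: nth_one_except nth_append)
  then have tc: "tcat ?p ?q \<simeq> word (one_except d (d - 1) y)"
    by (simp add: equiv_tensor_def coef_def tcat_def lin_eval_bilin_ext)
  have perm: "\<sigma> permutes {..<d}" if "\<sigma> \<in> ?R" for \<sigma> using that unfolding shortest_reps_def mem_Collect_eq d permutes_symgroup by blast
  have stc: "supported d (tcat ?p ?q)" using supported_tcat[OF sp sq] by (simp only: d)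
  have "(\<Sum>\<sigma>\<in>?R. act \<sigma> (tcat ?p ?q)) \<simeq> (\<Sum>\<sigma>\<in>?R. act \<sigma> (word (one_except d (d - 1) y)))"
    by (intro equiv_sum act_cong[OF stc supported_single[OF length_one_except] perm tc])
  also have "\<dots> \<simeq> (\<Sum>\<sigma>\<in>?R. word (one_except d (inv \<sigma> (d - 1)) y))"
    using assms by (intro equiv_sum act_one_except perm) auto
  also have "(\<Sum>\<sigma>\<in>?R. word (one_except d (inv \<sigma> (d - 1)) y)) = diag d y"
    unfolding diag_def
    using sum.reindex_bij_betw[OF bij_betw_shortest_reps[of "d - 1"], of "\<lambda>k. word (one_except d k y)"]
    by (simp only: d)
  finally have eq: "(\<Sum>\<sigma>\<in>?R. act \<sigma> (tcat ?p ?q)) \<simeq> diag d y" .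
  have "star (d - 1) 1 (pure_tensor mscale (replicate (d - 1) matrix_one)) (pure_tensor mscale [y]) =
      star (d - 1) 1 (cls (d - 1) ?p) (cls 1 ?q)"
    by (simp add: pure_tensor_def)
  also have "\<dots> = cls d (\<Sum>\<sigma>\<in>?R. act \<sigma> (tcat ?p ?q))"
    unfolding star_cls[OF sp sq] d ..
  also have "\<dots> = cls d (diag d y)"
    by (rule cls_eqI[OF supported_sum[OF supported_act[OF stc]] supported_diag eq])
  finally show ?thesis .
qed

subsection \<open>Generation\<close>

abbreviation is_amat :: "'a^'n^'n \<Rightarrow> bool" where "is_amat X \<equiv> X \<in> matrices_over \<aa>"

text \<open>Membership in \<open>mpart True\<close> would not serve as oddness of a factor, since
  the zero matrix belongs to it and to M_n(\<aa>); odd basis matrices lie outside M_n(\<aa>) and are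
  never moved by \<open>stab_on is_amat\<close>.\<close>

definition is_oddmat :: "'a^'n^'n \<Rightarrow> bool" where "is_oddmat X \<longleftrightarrow> X \<in> ximat ` labels B1"

text \<open>Factors outside M_n(\<aa>) are basis matrices, so that they are homogeneous and can be
  counted; factors inside are arbitrary, so that the identity matrix is allowed.\<close>

definition good_word :: "nat \<Rightarrow> ('a^'n^'n) list \<Rightarrow> bool" where
  "good_word d xs \<longleftrightarrow> length xs = d \<and> set xs \<subseteq> matrices_over \<aa> \<union> ximat ` labels (Bc \<union> B1)"

lemma ximat_not_amat:
  assumes "i \<in> labels (Bc \<union> B1)"
  shows "\<not> is_amat (ximat i)"
proof
  assume "is_amat (ximat i)"
  moreover have "i \<in> labels B" using assms by (auto simp: labels_def B_def)
  ultimately have "isa i" using coord_aa[of "ximat i" i] by (simp add: coord_ximat)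
  then show False using assms B_disjoint by (auto simp: labels_def)
qed

lemma is_oddmat_not_amat: "is_oddmat X \<Longrightarrow> \<not> is_amat X"
  using ximat_not_amat by (auto simp: is_oddmat_def labels_def)

lemma good_word_nth_cases:
  assumes "good_word d xs" "k < d" "\<not> is_amat (xs ! k)"
  obtains i where "i \<in> labels (Bc \<union> B1)" "xs ! k = ximat i"
proof -
  have "k < length xs" and sub: "set xs \<subseteq> matrices_over \<aa> \<union> ximat ` labels (Bc \<union> B1)"
    using assms(1,2) by (simp_all add: good_word_def)
  from subsetD[OF sub nth_mem[OF this(1)]] show ?thesis using assms(3) that by blast
qed

lemma good_word_mpart:
  assumes "good_word d xs" "k < d"
  shows "xs ! k \<in> mpart (is_oddmat (xs ! k))"
proof (cases "is_amat (xs ! k)")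
  case True
  then have "\<not> is_oddmat (xs ! k)" using is_oddmat_not_amat by blast
  then show ?thesis using matrices_aa_mpart[OF True] by simp
next
  case False
  then obtain i where i: "i \<in> labels (Bc \<union> B1)" "xs ! k = ximat i"
    by (rule good_word_nth_cases[OF assms])
  have iB: "i \<in> labels B" using i(1) by (auto simp: labels_def B_def)
  have "is_oddmat (ximat i) \<longleftrightarrow> isodd i"
  proof
    assume "is_oddmat (ximat i)"
    then obtain j where j: "j \<in> labels B1" "ximat i = ximat j" by (auto simp: is_oddmat_def)
    then have "i = j" using iB ximat_inj[of i j] by (auto simp: labels_def B_def)
    then show "isodd i" using j by (simp add: labels_def)
  qed (simp add: is_oddmat_def labels_def)
  then show ?thesis using ximat_mpart[OF iB] i(2) by simp
qed

text \<open>
  Only equal factors from \<open>M\<^sub>n(\<aa>)\<close>, which need not be basis elements, are identified: the symmetrization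
  is divided by the factorials of their multiplicities, but not by those of the other factors.
\<close>

definition orbit_sum :: "('a^'n^'n) list \<Rightarrow> ('k, 'a^'n^'n) combination" where
  "orbit_sum xs = coset_sum (stab_on is_amat xs) xs"

lemma supported_orbit_sum: "length xs = d \<Longrightarrow> supported d (orbit_sum xs)"
  unfolding orbit_sum_def by (rule supported_coset_sum)

lemma good_stab_fixes_odd:
  "h \<in> stab_on is_amat xs \<Longrightarrow> is_oddmat (xs ! k) \<Longrightarrow> h k = k"
  using stab_on_moved[of h is_amat xs k] is_oddmat_not_amat by blast

lemma orbit_sum_symmetrize:
  assumes "good_word d xs"
  shows "fscale (of_nat (card (stab_on is_amat xs))) (orbit_sum xs) \<simeq> symmetrize d (word xs)"
  unfolding orbit_sum_def
proof (rule coset_sum_symmetrize[where a = "\<lambda>k. is_oddmat (xs ! k)"])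
  show "length xs = d" using assms by (simp add: good_word_def)
  show "xs ! k \<in> mpart (is_oddmat (xs ! k))" if "k < d" for k using assms that by (rule good_word_mpart)
  show "h k = k" if "h \<in> stab_on is_amat xs" "is_oddmat (xs ! k)" for h k
    using that by (rule good_stab_fixes_odd)
qed

lemma symmetric_orbit_sum:
  assumes "good_word d xs"
  shows "symmetric d (orbit_sum xs)"
  unfolding orbit_sum_def
proof (rule symmetric_coset_sum[where a = "\<lambda>k. is_oddmat (xs ! k)"])
  show "length xs = d" using assms by (simp add: good_word_def)
  show "xs ! k \<in> mpart (is_oddmat (xs ! k))" if "k < d" for k using assms that by (rule good_word_mpart)
  show "h k = k" if "h \<in> stab_on is_amat xs" "is_oddmat (xs ! k)" for h k
    using that by (rule good_stab_fixes_odd)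
qed

text \<open>A factor in M_n(\<aa>) expands into basis matrices over \<open>Ba\<close> only, and a
  factor outside is itself a single basis matrix not over \<open>Ba\<close>.\<close>

lemma coef_act_good:
  assumes "good_word d xs" "\<sigma> permutes {..<d}" "length w = d"
    "coef w (act \<sigma> (word xs)) \<noteq> 0" "k < d"
  shows "isa (w ! k) \<longleftrightarrow> is_amat (xs ! \<sigma> k)"
proof -
  have l: "length xs = d" using assms(1) by (simp add: good_word_def)
  have "wcoef w (permute_list \<sigma> xs) \<noteq> 0"
    using assms(4) coef_act_single[OF l good_word_mpart[OF assms(1)] assms(2,3)] by auto
  then have "coord (w ! k) (permute_list \<sigma> xs ! k) \<noteq> 0"
    using wcoef_nonzero[of w "permute_list \<sigma> xs"] assms(3,5) by blast
  then have c: "coord (w ! k) (xs ! \<sigma> k) \<noteq> 0" using assms l by (simp add: permute_list_nth)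
  show ?thesis
  proof
    assume a: "isa (w ! k)"
    show "is_amat (xs ! \<sigma> k)"
    proof (rule ccontr)
      assume na: "\<not> is_amat (xs ! \<sigma> k)"
      have "\<sigma> k < d" using permutes_in_image[OF assms(2), of k] assms(5) by simp
      then obtain i where i: "i \<in> labels (Bc \<union> B1)" "xs ! \<sigma> k = ximat i"
        using na by (rule good_word_nth_cases[OF assms(1)])
      have "i \<in> labels B" using i(1) by (auto simp: labels_def B_def)
      then have "w ! k = i" using c unfolding i(2) by (simp add: coord_ximat split: if_splits)
      then show False using a i(1) B_disjoint by (auto simp: labels_def)
    qed
  next
    assume "is_amat (xs ! \<sigma> k)"
    then show "isa (w ! k)" using c by (rule coord_aa)
  qed
qed

text \<open>The number of letters from Y, which is the main induction parameter;
  \<open>mat_deg\<close> is the same count for words of matrices.\<close>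

definition word_deg :: "('a, 'n) index list \<Rightarrow> nat" where
  "word_deg w = card {k. k < length w \<and> \<not> isa (w ! k)}"

definition mat_deg :: "('a^'n^'n) list \<Rightarrow> nat" where
  "mat_deg xs = card {k. k < length xs \<and> \<not> is_amat (xs ! k)}"

lemma word_deg_orbit_sum:
  assumes "good_word d xs" "w \<in> supp (orbit_sum xs)"
  shows "word_deg w = mat_deg xs"
proof -
  have l: "length xs = d" using assms(1) by (simp add: good_word_def)
  have lw: "length w = d"
    using assms(2) supp_index_words[OF supported_orbit_sum[OF l]] by (auto simp: index_words_def)
  have "of_nat (card (stab_on is_amat xs)) * coef w (orbit_sum xs) = coef w (symmetrize d (word xs))"
    using orbit_sum_symmetrize[OF assms(1)] by (simp add: equiv_tensor_def coef_fscale)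
  moreover have "of_nat (card (stab_on is_amat xs)) * coef w (orbit_sum xs) \<noteq> 0"
    using assms(2) card_stab_on_pos[of is_amat xs] by (simp add: supp_def)
  ultimately have "coef w (symmetrize d (word xs)) \<noteq> 0" by metis
  then obtain \<sigma> where \<sigma>: "\<sigma> permutes {..<d}" "coef w (act \<sigma> (word xs)) \<noteq> 0"
    unfolding symmetrize_def coef_sum using sum.neutral by (metis (mono_tags, lifting) permutes_symgroup)
  have "bij_betw \<sigma> {k. k < length w \<and> \<not> isa (w ! k)} {k. k < length xs \<and> \<not> is_amat (xs ! k)}"
  proof (rule bij_betw_byWitness[where f' = "inv \<sigma>"])
    have lt: "\<sigma> k < d \<longleftrightarrow> k < d" "inv \<sigma> k < d \<longleftrightarrow> k < d" for k
      using permutes_in_image[OF \<sigma>(1), of k] permutes_in_image[OF permutes_inv[OF \<sigma>(1)], of k] by simp_all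
    note iff = coef_act_good[OF assms(1) \<sigma>(1) lw \<sigma>(2)]
    show "\<sigma> ` {k. k < length w \<and> \<not> isa (w ! k)} \<subseteq> {k. k < length xs \<and> \<not> is_amat (xs ! k)}"
      using iff lt l lw by auto
    show "inv \<sigma> ` {k. k < length xs \<and> \<not> is_amat (xs ! k)} \<subseteq> {k. k < length w \<and> \<not> isa (w ! k)}"
      using iff[of "inv \<sigma> _"] lt l lw permutes_inverses(1)[OF \<sigma>(1)] by auto
  qed (use permutes_inverses[OF \<sigma>(1)] in auto)
  then show ?thesis unfolding word_deg_def mat_deg_def by (rule bij_betw_same_card)
qed

text \<open>
  A letter of \<open>w\<close> over \<open>Bc\<close> comes from a factor of \<open>xs\<close> outside \<open>M\<^sub>n(\<aa>)\<close>, which \<open>stab_on is_amat xs\<close>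
  does not move, so the permutations of these letters act freely on the cosets that contribute.
\<close>

lemma in_T_orbit_sum:
  assumes "good_word d xs"
  shows "in_T d (orbit_sum xs)"
  unfolding in_T_def
proof (intro conjI allI symmetric_orbit_sum[OF assms])
  fix w
  let ?s = "word xs" and ?H = "stab_on is_amat xs" and ?G = "stab_on isc w"
  have l: "length xs = d" using assms by (simp add: good_word_def)
  have s: "supported d ?s" using l by (rule supported_single)
  show "of_nat (card ?G) dvd coef w (orbit_sum xs)"
  proof (cases "length w = d")
    case False
    then show ?thesis using coef_wrong_length[OF supported_orbit_sum[OF l]] by simp
  next
    case True
    define F where "F C = coef w (act (SOME \<sigma>. \<sigma> \<in> C) ?s)" for C :: "(nat \<Rightarrow> nat) set"
    have H_perm: "g permutes {..<d}" if "g \<in> ?H" for g using stab_on_permutes[OF that] l by simp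
    have G_perm: "h permutes {..<d}" if "h \<in> ?G" for h using stab_on_permutes[OF that] True by simp
    have inv_H: "coef w (act (g \<circ> \<sigma>) ?s) = coef w (act \<sigma> ?s)" if "g \<in> ?H" "\<sigma> permutes {..<d}" for g \<sigma>
      using act_stab_comp[OF l good_word_mpart[OF assms] that(1) good_stab_fixes_odd[OF that(1)] that(2)]
      by (simp add: equiv_tensor_def)
    \<comment> \<open>\<open>F\<close> does not depend on the chosen representative and may be
      computed from any element of the coset.\<close>
    have F: "F ((\<lambda>g. g \<circ> \<sigma>) ` ?H) = coef w (act \<sigma> ?s)" if "\<sigma> permutes {..<d}" for \<sigma>
    proof -
      let ?C = "(\<lambda>g. g \<circ> \<sigma>) ` ?H"
      have "\<sigma> \<in> ?C" using imageI[OF stab_on_id[of is_amat xs], of "\<lambda>g. g \<circ> \<sigma>"] by simp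
      then have "(SOME \<sigma>. \<sigma> \<in> ?C) \<in> ?C" by (rule someI[of "\<lambda>\<sigma>. \<sigma> \<in> ?C"])
      then obtain g where "g \<in> ?H" "(SOME \<sigma>. \<sigma> \<in> ?C) = g \<circ> \<sigma>" by blast
      then show ?thesis unfolding F_def using inv_H that by simp
    qed
    have cosetE: "\<exists>\<sigma>. \<sigma> permutes {..<d} \<and> C = (\<lambda>g. g \<circ> \<sigma>) ` ?H" if "C \<in> right_cosets ?H d" for C
      using that by (auto simp: right_cosets_def)
    \<comment> \<open>The group \<open>?G\<close> acts on the cosets by multiplication from the
      right.\<close>
    have shift: "(\<lambda>\<sigma>. \<sigma> \<circ> h) ` ((\<lambda>g. g \<circ> \<sigma>) ` ?H) = (\<lambda>g. g \<circ> (\<sigma> \<circ> h)) ` ?H" for h \<sigma> :: "nat \<Rightarrow> nat"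
      by (simp add: image_image o_assoc)
    have "of_nat (card ?G) dvd (\<Sum>C\<in>right_cosets ?H d. F C)"
    proof (rule card_group_dvd_sum[where act = "\<lambda>h C. (\<lambda>\<sigma>. \<sigma> \<circ> h) ` C"])
      show "finite (right_cosets ?H d)" by (simp add: right_cosets_def)
      show "perm_group ?G" by (rule perm_group_stab_on)
      show "(\<lambda>\<sigma>. \<sigma> \<circ> h) ` C \<in> right_cosets ?H d" if h: "h \<in> ?G" and C: "C \<in> right_cosets ?H d" for h C
      proof -
        obtain \<sigma> where \<sigma>: "\<sigma> permutes {..<d}" "C = (\<lambda>g. g \<circ> \<sigma>) ` ?H" using cosetE[OF C] by blast
        have "\<sigma> \<circ> h \<in> symgroup d" using permutes_compose[OF G_perm[OF h] \<sigma>(1)] by simp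
        then show ?thesis unfolding \<sigma>(2) shift right_cosets_def by blast
      qed
      show "(\<lambda>\<sigma>. \<sigma> \<circ> id) ` C = C" for C :: "(nat \<Rightarrow> nat) set" by simp
      show "(\<lambda>\<sigma>. \<sigma> \<circ> (g \<circ> h)) ` C = (\<lambda>\<sigma>. \<sigma> \<circ> h) ` ((\<lambda>\<sigma>. \<sigma> \<circ> g) ` C)" for g h and C :: "(nat \<Rightarrow> nat) set"
        by (simp add: image_image o_assoc)
      show "F ((\<lambda>\<sigma>. \<sigma> \<circ> h) ` C) = F C" if h: "h \<in> ?G" and C: "C \<in> right_cosets ?H d" for h C
      proof -
        obtain \<sigma> where \<sigma>: "\<sigma> permutes {..<d}" "C = (\<lambda>g. g \<circ> \<sigma>) ` ?H" using cosetE[OF C] by blast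
        have "coef w (act (\<sigma> \<circ> h) ?s) = coef w (act h (act \<sigma> ?s))"
          using act_compose[OF s \<sigma>(1) G_perm[OF h]] by (simp add: equiv_tensor_def)
        also have "\<dots> = coef w (act \<sigma> ?s)"
          using coef_act[OF supported_act[OF s] G_perm[OF h] True, of \<sigma>]
          by (simp add: stab_on_permute_list[OF h] stab_isc_sign[OF h True])
        finally show ?thesis
          unfolding \<sigma>(2) shift F[OF \<sigma>(1)] F[OF permutes_compose[OF G_perm[OF h] \<sigma>(1)]] .
      qed
      show "of_nat (card {h \<in> ?G. (\<lambda>\<sigma>. \<sigma> \<circ> h) ` C = C}) dvd F C" if C: "C \<in> right_cosets ?H d" for C
      proof (cases "F C = 0")
        case False
        obtain \<sigma> where \<sigma>: "\<sigma> permutes {..<d}" "C = (\<lambda>g. g \<circ> \<sigma>) ` ?H" using cosetE[OF C] by blast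
        have nz: "coef w (act \<sigma> ?s) \<noteq> 0" using False F[OF \<sigma>(1)] \<sigma>(2) by simp
        have "h = id" if h: "h \<in> ?G" "(\<lambda>\<sigma>. \<sigma> \<circ> h) ` C = C" for h
        proof
          fix k
          have "\<sigma> \<in> C" unfolding \<sigma>(2) using imageI[OF stab_on_id[of is_amat xs], of "\<lambda>g. g \<circ> \<sigma>"] by simp
          then have "\<sigma> \<circ> h \<in> C" using h(2) by blast
          \<comment> \<open>If \<open>h\<close> fixes the coset of \<open>\<sigma>\<close>, it is
            conjugate by \<open>\<sigma>\<close> to some \<open>g\<close> that stabilizes
            \<open>xs\<close>; a position moved by \<open>h\<close> then corresponds to one moved by
            \<open>g\<close>.\<close>
          then obtain g where g: "g \<in> ?H" "\<sigma> \<circ> h = g \<circ> \<sigma>" unfolding \<sigma>(2) by blast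
          show "h k = id k"
          proof (rule ccontr)
            assume "h k \<noteq> id k"
            then have "h k \<noteq> k" by simp
            then have k: "k < d" "isc (w ! k)" using stab_on_moved[OF h(1)] True by auto
            have "\<sigma> (h k) \<noteq> \<sigma> k" using \<open>h k \<noteq> k\<close> permutes_inj[OF \<sigma>(1)] by (auto dest: injD)
            then have "g (\<sigma> k) \<noteq> \<sigma> k" using fun_cong[OF g(2), of k] by simp
            then have "is_amat (xs ! \<sigma> k)" using stab_on_moved[OF g(1)] by blast
            then have "isa (w ! k)" using coef_act_good[OF assms \<sigma>(1) True nz k(1)] by simp
            then show False using k(2) B_disjoint by blast
          qed
        qed
        moreover have "id \<in> {h \<in> ?G. (\<lambda>\<sigma>. \<sigma> \<circ> h) ` C = C}" by (simp add: stab_on_id)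
        ultimately have "{h \<in> ?G. (\<lambda>\<sigma>. \<sigma> \<circ> h) ` C = C} = {id}" by blast
        then show ?thesis by simp
      qed simp
    qed
    then show ?thesis
      by (simp add: orbit_sum_def coset_sum_def coef_sum l F_def act_single)
  qed
qed

section \<open>Changing one factor of a word\<close>

lemma coef_single_update:
  assumes "length zs = d" "l < d"
  shows "word (zs[l := mscale c x + y]) \<simeq>
    fscale c (word (zs[l := x])) + word (zs[l := y])"
    and "word (zs[l := 0]) \<simeq> 0"
proof -
  have s: "supported d (word (zs[l := x]))" for x
    using assms(1) by (intro supported_single) simp
  show "word (zs[l := mscale c x + y]) \<simeq>
    fscale c (word (zs[l := x])) + word (zs[l := y])"
  proof (rule equivI[of d])
    fix w :: "('a, 'n) index list" assume "length w = d"
    from multilinear_wcoef[OF this]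
    show "coef w (word (zs[l := mscale c x + y])) =
        coef w (fscale c (word (zs[l := x])) + word (zs[l := y]))"
      using assms by (simp add: multilinear_def coef_single coef_add coef_fscale)
  qed (intro s supported_add supported_fscale)+
  show "word (zs[l := 0]) \<simeq> 0"
  proof (rule equivI[of d])
    fix w :: "('a, 'n) index list" assume "length w = d"
    then have "wcoef w (zs[l := 0]) = 0"
      using assms by (intro multilinear_has_zero[OF module_mscale multilinear_wcoef, of w d _ l]) auto
    then show "coef w (word (zs[l := 0])) = coef w 0" by (simp add: coef_single)
  qed (intro s supported_zero)+
qed

lemma mul_one_except_single:
  assumes "good_word d zs" "l < d" "y \<in> mpart e"
  shows "mul (word (one_except d l y)) (word zs) \<simeq>
    fscale (mult_sign d (\<lambda>j. j = l \<and> e) (\<lambda>j. is_oddmat (zs ! j)))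
      (word (zs[l := matrix_mult y (zs ! l)]))"
proof (rule equivI[of d])
  have len: "length zs = d" using assms(1) by (simp add: good_word_def)
  show "supported d (mul (word (one_except d l y)) (word zs))"
    using len by (intro supported_mul supported_single) auto
  show "supported d (fscale (mult_sign d (\<lambda>j. j = l \<and> e) (\<lambda>j. is_oddmat (zs ! j)))
      (word (zs[l := matrix_mult y (zs ! l)])))"
    using len by (intro supported_fscale supported_single) auto
  fix w :: "('a, 'n) index list" assume w: "length w = d"
  have map2: "map2 matrix_mult (one_except d l y) zs = zs[l := matrix_mult y (zs ! l)]"
    using len by (intro nth_equalityI) (auto simp: nth_one_except nth_list_update)
  show "coef w (mul (word (one_except d l y)) (word zs)) =
    coef w (fscale (mult_sign d (\<lambda>j. j = l \<and> e) (\<lambda>j. is_oddmat (zs ! j)))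
      (word (zs[l := matrix_mult y (zs ! l)])))"
    using lin_eval_word_mult_homogeneous[OF multilinear_wcoef[OF w] length_one_except
        one_except_mpart[OF assms(3)] len good_word_mpart[OF assms(1)], of l]
    by (simp add: coef_def mul_def lin_eval_bilin_ext lin_eval_fscale map2)
qed

text \<open>The transposition of the two positions stabilizes \<open>zs\<close> without sign,
  because the equal factors are even. It carries one product to the other, and symmetrization does
  not distinguish them.\<close>

lemma symmetrize_mul_one_except_eq:
  assumes "good_word d zs" "l < d" "l' < d" "zs ! l = zs ! l'" "is_amat (zs ! l)"
  shows "symmetrize d (mul (word (one_except d l y)) (word zs)) \<simeq>
    symmetrize d (mul (word (one_except d l' y)) (word zs))"
proof -
  let ?t = "Transposition.transpose l l'"
  let ?o = "\<lambda>l. word (one_except d l y)" and ?z = "word zs"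
  have len: "length zs = d" using assms(1) by (simp add: good_word_def)
  have so: "supported d (?o l)" for l by (intro supported_single) simp
  have sz: "supported d ?z" using len by (rule supported_single)
  have t: "?t permutes {..<d}" using assms(2,3) by (intro permutes_swap_id) auto
  have "?t permutes {k. k < length zs \<and> is_amat (zs ! k)}"
    using assms(2-5) len by (intro permutes_swap_id) auto
  then have st: "?t \<in> stab_on is_amat zs"
    using assms(4) by (auto simp: stab_on_def Transposition.transpose_def)
  have "act ?t (mul (?o l) ?z) \<simeq> mul (act ?t (?o l)) (act ?t ?z)"
    by (rule act_mul[OF so sz t])
  also have "\<dots> \<simeq> mul (?o l') ?z"
  proof (rule mul_cong[OF supported_act[OF so] so supported_act[OF sz] sz])
    show "act ?t (?o l) \<simeq> ?o l'"
      using act_one_except[OF t assms(2), of y] by (simp add: inv_transpose_eq)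
    show "act ?t ?z \<simeq> ?z"
      by (rule act_stab[OF len good_word_mpart[OF assms(1)] st good_stab_fixes_odd[OF st]])
  qed
  finally have eq: "act ?t (mul (?o l) ?z) \<simeq> mul (?o l') ?z" .
  have "symmetrize d (mul (?o l) ?z) \<simeq> symmetrize d (act ?t (mul (?o l) ?z))"
    by (rule equiv_sym[OF symmetrize_act[OF supported_mul[OF so sz] t]])
  also have "\<dots> \<simeq> symmetrize d (mul (?o l') ?z)"
    by (rule symmetrize_cong[OF supported_act[OF supported_mul[OF so sz]] supported_mul[OF so sz] eq])
  finally show ?thesis .
qed

text \<open>Expresses the orders before and after a change at \<open>l\<close> through their common
  part, the factorials of the untouched factors in M_n(\<aa>).\<close>

lemma card_stab_update:
  assumes "l < length zs"
  defines "R \<equiv> filter_mset is_amat (mset zs - {#zs ! l#})"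
  shows "card (stab_on is_amat (zs[l := x])) = (if is_amat x then Suc (count R x) else 1) * fact_mset R"
  using assms(1) by (simp add: card_stab_on mset_update fact_mset_add R_def)

lemma count_mset_remove:
  assumes "l < length zs"
  shows "Suc (count (mset zs - {#zs ! l#}) (zs ! l)) = card {k. k < length zs \<and> zs ! k = zs ! l}"
proof -
  have "count (mset zs) (zs ! l) > 0" using assms by simp
  then show ?thesis by (simp add: count_mset_conv_card)
qed

lemma card_stab_nth:
  assumes "l < length zs"
  shows "card (stab_on is_amat zs) =
    (if is_amat (zs ! l) then card {k. k < length zs \<and> zs ! k = zs ! l} else 1) *
      fact_mset (filter_mset is_amat (mset zs - {#zs ! l#}))"
proof -
  have "Suc (count (filter_mset is_amat (mset zs - {#zs ! l#})) (zs ! l)) = card {k. k < length zs \<and> zs ! k = zs ! l}"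
    if "is_amat (zs ! l)"
    unfolding count_mset_remove[OF assms, symmetric] by (simp only: count_filter_mset that if_True)
  then show ?thesis
    using card_stab_update[OF assms, of "zs ! l"] unfolding list_update_id by presburger
qed

lemma good_word_update:
  "good_word d zs \<Longrightarrow> l < d \<Longrightarrow> x \<in> matrices_over \<aa> \<union> ximat ` labels (Bc \<union> B1) \<Longrightarrow> good_word d (zs[l := x])"
  using set_update_subset_insert[of zs l x] by (auto simp: good_word_def)

lemma ximat_good: "i \<in> labels B \<Longrightarrow> ximat i \<in> matrices_over \<aa> \<union> ximat ` labels (Bc \<union> B1)"
  using ximat_aa[of i] by (auto simp: labels_def B_def)

lemma mat_deg_update:
  assumes "l < length zs"
  shows "mat_deg (zs[l := x]) + (if is_amat (zs ! l) then 0 else 1) = mat_deg zs + (if is_amat x then 0 else 1)"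
proof -
  let ?S = "{k. k < length zs \<and> k \<noteq> l \<and> \<not> is_amat (zs ! k)}"
  have "{k. k < length (zs[l := x]) \<and> \<not> is_amat (zs[l := x] ! k)} = (if is_amat x then ?S else insert l ?S)"
    using assms by (auto simp: nth_list_update split: if_splits)
  moreover have "{k. k < length zs \<and> \<not> is_amat (zs ! k)} = (if is_amat (zs ! l) then ?S else insert l ?S)"
    using assms by auto
  ultimately show ?thesis unfolding mat_deg_def by simp
qed

text \<open>Secondary induction parameter: the length and \<open>mat_deg\<close> being fixed, a
  smaller value means more identity factors.\<close>

definition nonone :: "('a^'n^'n) list \<Rightarrow> nat" where
  "nonone xs = card {k. k < length xs \<and> is_amat (xs ! k) \<and> xs ! k \<noteq> matrix_one}"

lemma nonone_one:
  assumes "l < length xs" "\<not> is_amat (xs ! l)"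
  shows "nonone (xs[l := matrix_one]) = nonone xs"
  unfolding nonone_def using assms by (intro arg_cong[of _ _ card]) (auto simp: nth_list_update)

lemma nonone_less:
  assumes "l < length zs" "is_amat (zs ! l)" "zs ! l \<noteq> matrix_one" "\<not> is_amat x"
  shows "nonone (zs[l := x]) < nonone zs"
  unfolding nonone_def
proof (rule psubset_card_mono)
  show "{k. k < length (zs[l := x]) \<and> is_amat (zs[l := x] ! k) \<and> zs[l := x] ! k \<noteq> matrix_one} \<subset>
      {k. k < length zs \<and> is_amat (zs ! k) \<and> zs ! k \<noteq> matrix_one}"
    using assms by (auto simp: nth_list_update split: if_splits)
qed simp

section \<open>Closure properties that force a set to contain T\<close>

context
  fixes V :: "('k, 'a^'n^'n) combination set" and d :: nat
  assumes V_add: "\<And>p q. p \<in> V \<Longrightarrow> q \<in> V \<Longrightarrow> p + q \<in> V"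
    and V_fscale: "\<And>c p. p \<in> V \<Longrightarrow> fscale c p \<in> V"
    and V_zero: "0 \<in> V"
    and V_equiv: "\<And>p q. p \<in> V \<Longrightarrow> supported d q \<Longrightarrow> q \<simeq> p \<Longrightarrow> q \<in> V"
    and V_mul: "\<And>p q. p \<in> V \<Longrightarrow> q \<in> V \<Longrightarrow> mul p q \<in> V"
    and V_aa: "\<And>p. symmetric d p \<Longrightarrow> (\<And>w. w \<in> supp p \<Longrightarrow> \<forall>i\<in>set w. isa i) \<Longrightarrow> p \<in> V"
    and V_diag: "\<And>i. i \<in> labels (Bc \<union> B1) \<Longrightarrow> diag d (ximat i) \<in> V"
begin

text \<open>\<open>V\<close> is closed under scalars but need not be closed under division by
  integers, so a sum of terms is divisible inside \<open>V\<close> only if this is kept track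
  of.\<close>

definition multiple_in_V :: "nat \<Rightarrow> ('k, 'a^'n^'n) combination \<Rightarrow> bool" where
  "multiple_in_V N p \<longleftrightarrow> (\<exists>r\<in>V. fscale (of_nat N) r \<simeq> p)"

lemma multiple_in_V_zero: "multiple_in_V N 0"
  unfolding multiple_in_V_def using V_zero by (intro bexI[of _ 0]) (simp_all add: equiv_tensor_def coef_fscale)

lemma multiple_in_V_add:
  assumes "multiple_in_V N p" "multiple_in_V N q"
  shows "multiple_in_V N (p + q)"
proof -
  from assms obtain r s where "r \<in> V" "s \<in> V" "fscale (of_nat N) r \<simeq> p" "fscale (of_nat N) s \<simeq> q"
    unfolding multiple_in_V_def by blast
  then show ?thesis unfolding multiple_in_V_def
    by (intro bexI[of _ "r + s"] V_add) (simp_all add: equiv_tensor_def coef_fscale coef_add algebra_simps)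
qed

lemma multiple_in_V_fscale:
  assumes "multiple_in_V N p"
  shows "multiple_in_V N (fscale c p)"
proof -
  from assms obtain r where "r \<in> V" "fscale (of_nat N) r \<simeq> p" unfolding multiple_in_V_def by blast
  then show ?thesis unfolding multiple_in_V_def
    by (intro bexI[of _ "fscale c r"] V_fscale) (simp_all add: equiv_tensor_def coef_fscale algebra_simps)
qed

lemma multiple_in_V_equiv: "multiple_in_V N p \<Longrightarrow> p \<simeq> q \<Longrightarrow> multiple_in_V N q"
  unfolding multiple_in_V_def using equiv_trans by blast

lemma multiple_in_V_sum: "(\<And>s. s \<in> S \<Longrightarrow> multiple_in_V N (f s)) \<Longrightarrow> multiple_in_V N (sum f S)"
  by (induction S rule: infinite_finite_induct) (auto simp: multiple_in_V_zero multiple_in_V_add)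

text \<open>The order for \<open>zs\<close> is \<open>c\<close> times the factorials of the factors
  in M_n(\<aa>) other than that at \<open>l\<close>. Symmetrizing the updated word produces these
  factorials times an integer multiple of an orbit sum; the factor \<open>c\<close> completes them
  to the full order.\<close>

lemma multiple_in_V_update:
  assumes zs: "good_word d zs" and l: "l < d"
    and Q: "\<And>x. x \<in> matrices_over \<aa> \<union> ximat ` labels (Bc \<union> B1) \<Longrightarrow> orbit_sum (zs[l := x]) \<in> V"
    and c: "c = (if is_amat (zs ! l) then card {k. k < d \<and> zs ! k = zs ! l} else 1)"
  shows "multiple_in_V (card (stab_on is_amat zs)) (fscale (of_nat c) (symmetrize d (word (zs[l := x]))))"
proof -
  let ?N = "card (stab_on is_amat zs)"
  let ?P = "\<lambda>x. fscale (of_nat c) (symmetrize d (word (zs[l := x])))"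
  have len: "length zs = d" using zs by (simp add: good_word_def)
  have s: "supported d (word (zs[l := x]))" for x
    using len by (intro supported_single) simp
  define R where "R = filter_mset is_amat (mset zs - {#zs ! l#})"
  have N: "?N = c * fact_mset R"
    unfolding R_def c using card_stab_nth[of l zs] l len by simp
  have basis: "multiple_in_V ?N (?P x)" if x: "x \<in> matrices_over \<aa> \<union> ximat ` labels (Bc \<union> B1)" for x
  proof -
    define c' where "c' = (if is_amat x then Suc (count R x) else 1)"
    have N': "card (stab_on is_amat (zs[l := x])) = c' * fact_mset R"
      using card_stab_update[of l zs x] l len by (simp add: R_def c'_def)
    have "fscale (of_nat (c' * fact_mset R)) (orbit_sum (zs[l := x])) \<simeq> symmetrize d (word (zs[l := x]))"
      using orbit_sum_symmetrize[OF good_word_update[OF zs l x]] by (simp only: N')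
    then have "fscale (of_nat ?N) (fscale (of_nat c') (orbit_sum (zs[l := x]))) \<simeq> ?P x"
      unfolding N by (simp add: equiv_tensor_def coef_fscale algebra_simps)
    then show ?thesis unfolding multiple_in_V_def using V_fscale[OF Q[OF x]] by blast
  qed
  \<comment> \<open>The new factor is a product of matrices and need not be admissible in a good
    word; by linearity it is replaced by basis matrices, which are.\<close>
  have "x \<in> mat.span (ximat ` labels B)" by simp
  then show ?thesis
  proof (induction rule: mat.span_induct_alt)
    case base
    have "0 \<simeq> ?P 0"
      using symmetrize_cong[OF s supported_zero coef_single_update(2)[OF len l]]
      by (simp add: equiv_tensor_def coef_fscale symmetrize_def coef_sum act_def lin_ext_def)
    then show ?case by (rule multiple_in_V_equiv[OF multiple_in_V_zero])
  next
    case (step b x y)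
    then obtain i where i: "i \<in> labels B" "x = ximat i" by blast
    have "symmetrize d (word (zs[l := mscale b x + y])) \<simeq>
        symmetrize d (fscale b (word (zs[l := x])) + word (zs[l := y]))"
      by (rule symmetrize_cong[OF s supported_add[OF supported_fscale[OF s] s] coef_single_update(1)[OF len l]])
    also have "\<dots> = fscale b (symmetrize d (word (zs[l := x]))) + symmetrize d (word (zs[l := y]))"
      by (simp only: symmetrize_add symmetrize_fscale)
    finally have "fscale b (?P x) + ?P y \<simeq> ?P (mscale b x + y)"
      by (simp add: equiv_tensor_def coef_fscale coef_add algebra_simps)
    then show ?case
      using multiple_in_V_add[OF multiple_in_V_fscale[OF basis[OF ximat_good[OF i(1)]]] step.IH]
      unfolding i(2) by (rule multiple_in_V_equiv[rotated])
  qed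
qed

text \<open>Induction on \<open>nonone\<close>. The product of \<open>diag d y\<close> with the
  orbit sum of \<open>zs\<close> is computed after multiplication by the order \<open>?N\<close>,
  where it becomes a sum of symmetrized words, one for each position \<open>l\<close> at which
  \<open>y\<close> is multiplied in. Positions with the identity yield \<open>xs\<close>; the others
  are grouped by equal factors.\<close>

lemma orbit_sum_in_V:
  assumes low: "\<And>p. in_T d p \<Longrightarrow> (\<And>w. w \<in> supp p \<Longrightarrow> word_deg w < f) \<Longrightarrow> p \<in> V"
    and "good_word d xs" "mat_deg xs = f" "f > 0"
  shows "orbit_sum xs \<in> V"
  using assms(2,3)
proof (induction "nonone xs" arbitrary: xs rule: less_induct)
  case less
  have low_orbit_sum: "orbit_sum zs \<in> V" if "good_word d zs" "mat_deg zs < f" for zs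
    using low[OF in_T_orbit_sum[OF that(1)]] word_deg_orbit_sum[OF that(1)] that(2) by simp
  note xs = \<open>good_word d xs\<close>
  have len: "length xs = d" using xs by (simp add: good_word_def)
  have "{k. k < length xs \<and> \<not> is_amat (xs ! k)} \<noteq> {}"
    using \<open>mat_deg xs = f\<close> \<open>f > 0\<close> unfolding mat_deg_def by (metis card.empty less_irrefl)
  then obtain k where k: "k < d" "\<not> is_amat (xs ! k)" using len by blast
  obtain i where i: "i \<in> labels (Bc \<union> B1)" "xs ! k = ximat i"
    by (rule good_word_nth_cases[OF xs k])
  define y where "y = ximat i"
  have iB: "i \<in> labels B" using i(1) by (auto simp: labels_def B_def)
  have y: "y \<in> mpart (isodd i)" unfolding y_def by (rule ximat_mpart[OF iB])
  \<comment> \<open>With the identity in place of \<open>y\<close> the degree drops by one, so the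
    orbit sum of \<open>zs\<close> is already known to lie in \<open>V\<close>.\<close>
  define zs where "zs = xs[k := matrix_one]"
  have zs: "good_word d zs" unfolding zs_def using good_word_update[OF xs k(1)] matrix_one_aa by blast
  have lz: "length zs = d" using zs by (simp add: good_word_def)
  have zk: "zs ! k = matrix_one" using k(1) len by (simp add: zs_def)
  have xs_zs: "xs = zs[k := y]" using i(2) by (simp add: zs_def y_def flip: i(2))
  have deg_zs: "Suc (mat_deg zs) = f"
    using mat_deg_update[of k xs matrix_one] k len \<open>mat_deg xs = f\<close> matrix_one_aa by (simp add: zs_def)
  have nonone_zs: "nonone zs = nonone xs" unfolding zs_def using k len by (intro nonone_one) auto
  let ?N = "card (stab_on is_amat zs)"
  let ?o = "\<lambda>l. word (one_except d l y)" and ?z = "word zs"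
  define t where "t l = symmetrize d (mul (?o l) ?z)" for l
  define s :: "nat \<Rightarrow> 'k" where "s l = mult_sign d (\<lambda>j. j = l \<and> isodd i) (\<lambda>j. is_oddmat (zs ! j))" for l
  have so: "supported d (?o l)" for l by (intro supported_single) simp
  have sz: "supported d ?z" using lz by (rule supported_single)
  have t_eq: "t l \<simeq> fscale (s l) (symmetrize d (word (zs[l := matrix_mult y (zs ! l)])))" if "l < d" for l
  proof -
    have su: "supported d (word (zs[l := matrix_mult y (zs ! l)]))"
      using lz by (intro supported_single) simp
    have "t l \<simeq> symmetrize d (fscale (s l) (word (zs[l := matrix_mult y (zs ! l)])))"
      unfolding t_def s_def
      by (rule symmetrize_cong[OF supported_mul[OF so sz] supported_fscale[OF su] mul_one_except_single[OF zs that y]])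
    also have "\<dots> = fscale (s l) (symmetrize d (word (zs[l := matrix_mult y (zs ! l)])))"
      by (rule symmetrize_fscale)
    finally show ?thesis .
  qed
  have t_swap: "t l \<simeq> t l'" if "l < d" "l' < d" "zs ! l = zs ! l'" "is_amat (zs ! l)" for l l'
    unfolding t_def by (rule symmetrize_mul_one_except_eq[OF zs that])
  \<comment> \<open>Equal factors from M_n(\<aa>) contribute equal terms; their number is the factor
    \<open>c\<close> needed in \<open>multiple_in_V_update\<close>. Factors outside M_n(\<aa>) are
    treated one by one, with \<open>c = 1\<close>.\<close>
  have group_const: "(\<Sum>l | l \<in> {..<d} \<and> zs ! l = v. t l) \<simeq> fscale (of_nat (card {l. l < d \<and> zs ! l = v})) (t l0)"
    if "l0 < d" "zs ! l0 = v" "is_amat v" for v l0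
  proof -
    have "(\<Sum>l | l \<in> {..<d} \<and> zs ! l = v. t l) \<simeq> (\<Sum>l | l \<in> {..<d} \<and> zs ! l = v. t l0)"
      using that by (intro equiv_sum t_swap) auto
    then show ?thesis by (simp add: equiv_tensor_def coef_sum coef_fscale)
  qed
  have update: "multiple_in_V ?N (fscale (of_nat (if is_amat (zs ! l) then card {m. m < d \<and> zs ! m = zs ! l} else 1)) (t l))"
    if l: "l < d" "zs ! l \<noteq> matrix_one" for l
  proof -
    have "orbit_sum (zs[l := x]) \<in> V" if x: "x \<in> matrices_over \<aa> \<union> ximat ` labels (Bc \<union> B1)" for x
    proof (cases "mat_deg (zs[l := x]) < f")
      case True
      then show ?thesis by (rule low_orbit_sum[OF good_word_update[OF zs l(1) x]])
    next
      case False
      \<comment> \<open>The degree can return to \<open>f\<close> only if a factor from M_n(\<aa>)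
        other than the identity is replaced by one outside; then \<open>nonone\<close> drops and the
        inner induction hypothesis applies.\<close>
      then have *: "is_amat (zs ! l)" "\<not> is_amat x" "mat_deg (zs[l := x]) = f"
        using mat_deg_update[of l zs x] l(1) lz deg_zs by (auto split: if_splits)
      have "nonone (zs[l := x]) < nonone xs"
        using nonone_less[of l zs x] l lz * nonone_zs by simp
      then show ?thesis using less.hyps good_word_update[OF zs l(1) x] *(3) by blast
    qed
    note m = multiple_in_V_fscale[OF multiple_in_V_update[OF zs l(1) this refl], of "s l" "matrix_mult y (zs ! l)"]
    have "fscale (s l) (fscale b p) \<simeq> fscale b (t l)"
      if "t l \<simeq> fscale (s l) p" for b p
      using that by (simp add: equiv_tensor_def coef_fscale mult.left_commute)
    from multiple_in_V_equiv[OF m this[OF t_eq[OF l(1)]]] show ?thesis .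
  qed
  have rest: "multiple_in_V ?N (\<Sum>v\<in>(!) zs ` {..<d} - {matrix_one}. \<Sum>l | l \<in> {..<d} \<and> zs ! l = v. t l)"
  proof (rule multiple_in_V_sum)
    fix v assume "v \<in> (!) zs ` {..<d} - {matrix_one}"
    then obtain l0 where l0: "l0 < d" "zs ! l0 = v" "v \<noteq> matrix_one" by auto
    show "multiple_in_V ?N (\<Sum>l | l \<in> {..<d} \<and> zs ! l = v. t l)"
    proof (cases "is_amat v")
      case True
      show ?thesis
        using update[of l0] l0 True by (intro multiple_in_V_equiv[OF _ equiv_sym[OF group_const[OF l0(1,2) True]]]) simp
    next
      case False
      have "multiple_in_V ?N (t l)" if "l < d" "zs ! l = v" for l
        using update[of l] that l0(3) False by simp
      then show ?thesis by (intro multiple_in_V_sum) auto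
    qed
  qed
  then obtain r where r: "r \<in> V"
    "fscale (of_nat ?N) r \<simeq> (\<Sum>v\<in>(!) zs ` {..<d} - {matrix_one}. \<Sum>l | l \<in> {..<d} \<and> zs ! l = v. t l)"
    unfolding multiple_in_V_def by blast
  define c where "c = card {l. l < d \<and> zs ! l = matrix_one}"
  \<comment> \<open>Putting \<open>y\<close>, which lies outside M_n(\<aa>), at position
    \<open>k\<close> leaves one identity fewer, so the factorial of \<open>c\<close> loses the
    factor \<open>c\<close>.\<close>
  have N: "?N = c * card (stab_on is_amat xs)"
  proof -
    have kl: "k < length zs" and ny: "\<not> is_amat y" using k lz ximat_not_amat[OF i(1)] by (simp_all add: y_def)
    have "card (stab_on is_amat xs) = fact_mset (filter_mset is_amat (mset zs - {#zs ! k#}))"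
      using card_stab_update[OF kl, of y] unfolding xs_zs[symmetric] by (simp only: ny if_False mult_1)
    moreover have "?N = c * fact_mset (filter_mset is_amat (mset zs - {#zs ! k#}))"
      using card_stab_nth[OF kl] unfolding c_def by (simp only: zk matrix_one_aa if_True lz)
    ultimately show ?thesis by simp
  qed
  have one: "(\<Sum>l | l \<in> {..<d} \<and> zs ! l = matrix_one. t l) \<simeq> fscale (of_nat ?N) (fscale (s k) (orbit_sum xs))"
  proof -
    have "(\<Sum>l | l \<in> {..<d} \<and> zs ! l = matrix_one. t l) \<simeq> fscale (of_nat c) (t k)"
      unfolding c_def by (rule group_const[OF k(1) zk matrix_one_aa])
    also have "\<dots> \<simeq> fscale (of_nat c) (fscale (s k) (symmetrize d (word xs)))"
      using t_eq[OF k(1)] by (intro equiv_fscale) (simp add: zk flip: xs_zs)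
    also have "\<dots> \<simeq> fscale (of_nat c) (fscale (s k) (fscale (of_nat (card (stab_on is_amat xs))) (orbit_sum xs)))"
      by (intro equiv_fscale equiv_sym[OF orbit_sum_symmetrize[OF xs]])
    finally show ?thesis unfolding N by (simp add: equiv_tensor_def coef_fscale algebra_simps)
  qed
  have "fscale (of_nat ?N) (mul (diag d y) (orbit_sum zs)) \<simeq> mul (diag d y) (fscale (of_nat ?N) (orbit_sum zs))"
    by (simp add: mul_fscale_right)
  also have "\<dots> \<simeq> mul (diag d y) (symmetrize d ?z)"
    by (rule mul_cong[OF supported_diag supported_diag supported_fscale[OF supported_orbit_sum[OF lz]]
          supported_symmetrize[OF sz] equiv_refl orbit_sum_symmetrize[OF zs]])
  also have "\<dots> \<simeq> symmetrize d (mul (diag d y) ?z)"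
    by (rule mul_symmetrize[OF symmetric_diag sz])
  also have "symmetrize d (mul (diag d y) ?z) = (\<Sum>l<d. t l)"
    by (simp only: diag_def mul_sum_left symmetrize_sum t_def)
  also have "(\<Sum>l<d. t l) = (\<Sum>v\<in>(!) zs ` {..<d}. \<Sum>l | l \<in> {..<d} \<and> zs ! l = v. t l)"
    by (rule sum.image_gen) simp
  also have "\<dots> = (\<Sum>l | l \<in> {..<d} \<and> zs ! l = matrix_one. t l) +
      (\<Sum>v\<in>(!) zs ` {..<d} - {matrix_one}. \<Sum>l | l \<in> {..<d} \<and> zs ! l = v. t l)"
  proof (rule sum.remove)
    have "zs ! k \<in> (!) zs ` {..<d}" using k(1) by (intro imageI) simp
    then show "matrix_one \<in> (!) zs ` {..<d}" by (simp only: zk)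
  qed simp
  also have "\<dots> \<simeq> fscale (of_nat ?N) (fscale (s k) (orbit_sum xs)) + fscale (of_nat ?N) r"
    by (rule equiv_add[OF one equiv_sym[OF r(2)]])
  also have "\<dots> \<simeq> fscale (of_nat ?N) (fscale (s k) (orbit_sum xs) + r)"
    by (simp add: equiv_tensor_def coef_fscale coef_add algebra_simps)
  \<comment> \<open>All terms carry the factor \<open>?N\<close>, which cancels since the ground
    ring is a domain of characteristic 0.\<close>
  finally have "mul (diag d y) (orbit_sum zs) \<simeq> fscale (s k) (orbit_sum xs) + r"
    by (rule equiv_cancel[rotated]) (use card_stab_on_pos in simp)
  then have eq: "coef w (mul (diag d y) (orbit_sum zs)) = s k * coef w (orbit_sum xs) + coef w r" for w
    by (simp add: equiv_tensor_def coef_fscale coef_add)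
  \<comment> \<open>The coefficient of the wanted orbit sum is a sign, hence invertible, and the
    relation can be solved for it.\<close>
  have "s k * s k = 1" unfolding s_def by (rule mult_sign_square)
  then have "s k * (s k * x) = x" for x by (simp flip: mult.assoc)
  then have "orbit_sum xs \<simeq> fscale (s k) (mul (diag d y) (orbit_sum zs) + fscale (-1) r)"
    by (simp only: equiv_tensor_def coef_fscale coef_add eq) (simp add: algebra_simps)
  moreover have "fscale (s k) (mul (diag d y) (orbit_sum zs) + fscale (-1) r) \<in> V"
    using V_diag[OF i(1)] low_orbit_sum[OF zs] deg_zs r(1) by (intro V_fscale V_add V_mul) (auto simp: y_def)
  ultimately show ?case using V_equiv supported_orbit_sum[OF len] by blast
qed

text \<open>Induction on a bound \<open>f\<close> for the number of letters from Y.
  \<open>T_reduce\<close> leaves one orbit sum for each word of the support, and only words of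
  degree exactly \<open>f > 0\<close> require the product argument.\<close>

lemma in_T_in_V: "in_T d p \<Longrightarrow> (\<And>w. w \<in> supp p \<Longrightarrow> word_deg w \<le> f) \<Longrightarrow> p \<in> V"
proof (induction f arbitrary: p rule: less_induct)
  case (less f)
  note p = less.prems(1)
  have low: "q \<in> V" if "in_T d q" "\<And>w. w \<in> supp q \<Longrightarrow> word_deg w < f" for q
  proof (cases f)
    case 0
    then have "supp q = {}" using that(2) by auto
    then show ?thesis using V_aa[OF in_T_symmetric[OF that(1)]] by blast
  next
    case (Suc g)
    then show ?thesis using less.IH[of g q] that by (simp add: less_Suc_eq_le)
  qed
  show ?case
  proof (rule T_reduce[OF V_add V_fscale V_zero V_equiv p])
    fix w assume w: "w \<in> supp p"
    have wi: "w \<in> index_words d" using w supp_index_words[OF in_T_supported[OF p]] by blast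
    have od: "odd_distinct w" by (rule odd_distinct_supp[OF in_T_symmetric[OF p] w])
    let ?xs = "map ximat w"
    have lw: "length w = d" using wi by (simp add: index_words_def)
    have good: "good_word d ?xs"
      unfolding good_word_def set_map
      using lw wi by (intro conjI image_subsetI ximat_good) (auto simp: index_words_def)
    have amat: "is_amat (ximat i) \<longleftrightarrow> isa i" if "i \<in> set w" for i
    proof -
      have "i \<in> labels B" using that wi by (auto simp: index_words_def)
      then show ?thesis using ximat_aa[of i] ximat_not_amat[of i] by (auto simp: labels_def B_def)
    qed
    have stab: "stab_on is_amat ?xs = stab_on isa w"
    proof -
      have "{k. k < length w \<and> is_amat (ximat (w ! k))} = {k. k < length w \<and> isa (w ! k)}"
        using amat by auto
      then show ?thesis unfolding stab_on_map[OF inj_on_ximat[OF wi]] unfolding stab_on_def by simp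
    qed
    note cs = coset_sum_basis[OF wi od refl, of is_amat, folded orbit_sum_def]
    \<comment> \<open>The coefficient is the order of the full stabilizer divided by that of its
      \<open>Ba\<close>-part, which is precisely the order that \<open>T_reduce\<close> asks
      for.\<close>
    have "of_nat (card (stab_on isa w)) * coef w (orbit_sum ?xs) =
        of_nat (card (stab_on isa w)) * of_nat (card (stab_on isc w))"
      using cs(1) by (simp add: stab card_stab_split[OF wi od])
    then have c: "coef w (orbit_sum ?xs) = of_nat (card (stab_on isc w))"
      using card_stab_on_pos[of isa w] by simp
    have deg: "mat_deg ?xs = word_deg w"
      unfolding mat_deg_def word_deg_def using amat by (intro arg_cong[of _ _ card]) auto
    have "orbit_sum ?xs \<in> V"
    proof (cases "word_deg w = f \<and> f > 0")
      case True
      then show ?thesis using orbit_sum_in_V[OF low good] deg by blast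
    next
      case False
      \<comment> \<open>In degree 0 all letters lie over \<open>Ba\<close>, so the orbit sum is an
        invariant over \<aa> and belongs to the generators.\<close>
      then consider "word_deg w < f" | "word_deg w = 0" using less.prems(2)[OF w] by linarith
      then show ?thesis
      proof cases
        case 1
        then show ?thesis using low[OF in_T_orbit_sum[OF good]] word_deg_orbit_sum[OF good] deg by simp
      next
        case 2
        show ?thesis
        proof (rule V_aa[OF symmetric_orbit_sum[OF good]])
          fix v assume "v \<in> supp (orbit_sum ?xs)"
          then have "word_deg v = 0" using word_deg_orbit_sum[OF good] deg 2 by simp
          then have "{k. k < length v \<and> \<not> isa (v ! k)} = {}" by (simp add: word_deg_def)
          then have "isa (v ! k)" if "k < length v" for k using that by blast
          then show "\<forall>i\<in>set v. isa i" by (metis in_set_conv_nth)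
        qed
      qed
    qed
    then show "\<exists>e\<in>V. in_T d e \<and> coef w e = of_nat (card (stab_on isc w)) \<and> (\<forall>v\<in>supp e. mset v = mset w)"
      using in_T_orbit_sum[OF good] c cs(3) by blast
  qed
qed

end


text \<open>T is a subalgebra of the invariants and contains the generators. Conversely, the
  representatives of any subalgebra that contains the generators have the closure properties under
  which \<open>in_T_in_V\<close> was proved.\<close>

lemma generated_subalgebra_eq_T_tensors:
  assumes "d \<ge> 1" and Y: "Y = mat.span {xi b r s | b r s. b \<in> Bc \<union> B1}"
  shows "generated_subalgebra d (invariants \<aa> d \<union>
      {star (d - 1) 1 (pure_tensor mscale (replicate (d - 1) matrix_one)) (pure_tensor mscale [y]) | y. y \<in> Y}) =
    T_tensors d"
    (is "generated_subalgebra d ?G = _")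
proof -
  have star: "star (d - 1) 1 (pure_tensor mscale (replicate (d - 1) matrix_one)) (pure_tensor mscale [y]) = cls d (diag d y)" for y
    using assms(1) by (rule star_one_eq_diag)
  have "?G \<subseteq> T_tensors d"
  proof (intro Un_least subsetI)
    fix X :: "('k, 'a^'n^'n) tensor" assume "X \<in> invariants \<aa> d"
    then show "X \<in> T_tensors d" by (rule invariants_aa_in_T) (simp add: T_tensorsI)
  next
    fix X assume "X \<in> {star (d - 1) 1 (pure_tensor mscale (replicate (d - 1) matrix_one)) (pure_tensor mscale [y]) | y. y \<in> Y}"
    then obtain y where "X = star (d - 1) 1 (pure_tensor mscale (replicate (d - 1) matrix_one)) (pure_tensor mscale [y])"
      by blast
    then show "X \<in> T_tensors d" using T_tensorsI[OF in_T_diag, of d y] by (simp only: star)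
  qed
  then have "generated_subalgebra d ?G \<subseteq> T_tensors d"
    unfolding generated_subalgebra_def
    using submodule_T_tensors T_tensors_mult T_tensors_invariants
    by (intro hull_minimal) (simp_all add: is_subalgebra_def)
  moreover have "T_tensors d \<subseteq> U" if U: "is_subalgebra d U" "U \<subseteq> invariants UNIV d" "?G \<subseteq> U" for U
  proof
    fix X assume "X \<in> T_tensors d"
    then obtain p where p: "in_T d p" "X = cls d p" by (rule T_tensorsE)
    \<comment> \<open>Supports and coefficients are defined for combinations, so \<open>U\<close> is
      pulled back to its representatives.\<close>
    define V where "V = {p. supported d p \<and> cls d p \<in> U}"
    have sub: "tensor_submodule mscale d U" using U(1) by (simp add: is_subalgebra_def)
    have "p \<in> V"
    proof (rule in_T_in_V[OF _ _ _ _ _ _ _ p(1)])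
      show "p + q \<in> V" if "p \<in> V" "q \<in> V" for p q
        using that sub by (auto simp: V_def tensor_submodule_def tensor_add_cls[symmetric])
      show "fscale c p \<in> V" if "p \<in> V" for c p
        using that sub by (auto simp: V_def tensor_submodule_def tensor_scale_cls[symmetric])
      show "0 \<in> V" using sub by (simp add: V_def tensor_submodule_def)
      show "q \<in> V" if "p \<in> V" "supported d q" "q \<simeq> p" for p q
        using that by (simp add: V_def tensor_class_eq_iff[THEN iffD2, of d q p])
      show "mul p q \<in> V" if "p \<in> V" "q \<in> V" for p q
        using that U(1) by (auto simp: V_def is_subalgebra_def tensor_mult_cls[symmetric])
      show "p \<in> V" if "symmetric d p" "\<And>w. w \<in> supp p \<Longrightarrow> \<forall>i\<in>set w. isa i" for p
        using invariants_aaI[OF that] U(3) symmetric_supported[OF that(1)] by (auto simp: V_def)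
      show "diag d (ximat i) \<in> V" if "i \<in> labels (Bc \<union> B1)" for i
      proof -
        have "ximat i \<in> {xi b r s | b r s. b \<in> Bc \<union> B1}" using that by (auto simp: labels_def)
        then have "ximat i \<in> Y" unfolding Y by (rule mat.span_base)
        then have "cls d (diag d (ximat i)) \<in> U" using U(3) star by blast
        then show ?thesis by (simp add: V_def supported_diag)
      qed
      \<comment> \<open>A word of length \<open>d\<close> has at most \<open>d\<close> letters from
        Y; this bound starts the induction.\<close>
      show "word_deg w \<le> d" if "w \<in> supp p" for w
      proof -
        have "length w = d" using that supp_index_words[OF in_T_supported[OF p(1)]] by (auto simp: index_words_def)
        then show ?thesis
          unfolding word_deg_def using card_mono[of "{..<d}" "{k. k < length w \<and> \<not> isa (w ! k)}"] by auto
      qed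
    qed
    then show "X \<in> U" by (simp add: V_def p(2))
  qed
  then have "T_tensors d \<subseteq> generated_subalgebra d ?G"
    unfolding generated_subalgebra_def hull_def by blast
  ultimately show ?thesis by blast
qed

end

theorem theorem4p13:
  fixes smul :: "'k::{idom, ring_char_0} \<Rightarrow> 'a::{ring, monoid_mult} \<Rightarrow> 'a"
    and A0 A1 \<aa> \<cc> Ba Bc B1 :: "'a set"
    and Y :: "('a^'n::finite^'n) set"
    and d :: nat
  assumes "unital_good_pair smul A0 A1 \<aa>"
    and "good_pair.adapted_basis smul A0 A1 \<aa> \<cc> Ba Bc B1"
    and "d \<ge> 1"
    and "Y = module.span (matrix_scale smul) {xi b r s | b r s. b \<in> Bc \<union> B1}"
  shows "superalgebra.T_alg smul A0 A1 Ba Bc B1 d =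
         superalgebra.generated_subalgebra smul A0 A1 d
           (superalgebra.invariants smul A0 A1 \<aa> d \<union>
            {superalgebra.star smul A0 A1 (d - 1) 1
               (pure_tensor (matrix_scale smul) (replicate (d - 1) matrix_one))
               (pure_tensor (matrix_scale smul) [y]) | y. y \<in> Y})"
proof -
  interpret unital_good_pair smul A0 A1 \<aa> by (rule assms(1))
  interpret adapted_pair smul A0 A1 \<aa> \<cc> Ba Bc B1 "TYPE('n)"
    by unfold_locales (rule assms(2))
  show ?thesis
    unfolding T_alg_eq generated_subalgebra_eq_T_tensors[OF assms(3,4)] ..
qed

end
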